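(* If $A\in(W^s_p(\Omega))^{2\times2}$ with $0<s\le1$ and $p>\frac2s$, then the output mesh $\mathcal T$ of GREEDY for $A$, started from $\mathcal T_0$ with any tolerance $\delta>0$ for which $\#\mathcal T\ge c_0\#\mathcal T_0$ (with fixed $c_0>1$), satisfies $$\|A-\widehat A_{\mathcal T}\|_{L^\infty(\Omega)}\lesssim|\Omega|^{\frac s2-\frac1p}\,|A|_{W^s_p(\Omega)}\,(\#\mathcal T)^{-\frac s2}.$$ Thus $A$ belongs to the approximation class $\mathbb A_{\frac s2}$, and the GREEDY algorithm provides a quasi-optimal approximation of $A$ (i.e. it realizes this rate).
   Context: **Meshes.** $\mathcal T_0$ is a conforming triangulation of the closure of a bounded polygonal domain $\Omega\subset\mathbb R^2$, each triangle having an assigned newest vertex. Refinements $\mathcal T$ of $\mathcal T_0$ are obtained by finitely many newest-vertex bisections; hanging nodes are allowed. Nodes are the vertices of triangles of $\mathcal T$; a node is proper if it is a vertex of all triangles containing it, otherwise hanging. A hanging node $x$ was created as midpoint of a side $[x',x'']$ of a triangle of a preceding mesh. Global index: $\lambda(x)=0$ if $x$ is proper, $\lambda(x)=\max(\lambda(x'),\lambda(x''))+1$ if $x$ is hanging. For a fixed $\Lambda\ge1$, $\mathcal T$ is $\Lambda$-admissible if all its nodes have global index $\le\Lambda$. $\mathbb T_N$ is the set of $\Lambda$-admissible refinements of $\mathcal T_0$ with at most $N$ elements. **Approximation class.** $\widehat A_{\mathcal T}$ is the piecewise constant field equal on $E$ to $A_E=\frac1{|E|}\int_EA$; $\zeta_{\mathcal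 T}(E;A)=\|A-A_E\|_{L^\infty(E)}$, $\zeta_{\mathcal T}(A)=\|A-\widehat A_{\mathcal T}\|_{L^\infty(\Omega)}$. $\mathbb A_\sigma$ is the set of $A\in(L^\infty(\Omega))^{2\times2}$ for which there is $C$ with $\inf_{\mathcal T\in\mathbb T_N}\zeta_{\mathcal T}(A)\le CN^{-\sigma}$ for all $N\ge\#\mathcal T_0$. **GREEDY**$(\mathcal T,\delta)$: while $\mathcal M=\{E\in\mathcal T:\zeta_{\mathcal T}(E;A)>\delta\}\neq\emptyset$ do $\mathcal T\leftarrow$ REFINE$(\mathcal T,\mathcal M)$; return $\mathcal T$. **REFINE.** For a triangle $E$, $nv(E)$ is its newest vertex, $oe(E)$ the opposite side, $moe(E)$ the midpoint of $oe(E)$; bisection joins $nv(E)$ with $moe(E)$, and $moe(E)$ is the newest vertex of both children. The labeling of $\mathcal T_0$ is such that a side shared by two triangles of $\mathcal T_0$ is opposite to the newest vertex of both or of neither. $\lambda(moe(E))$ is the global index that $moe(E)$ has, or would have once $E$ is bisected. Two elements $E',E''$ are adjacent if $e=E'\cap E''$ is a side of at least one of them; they are compatible if moreover neither $nv(E')$ nor $nv(E'')$ lies on the line containing $e$. If $\lambda(moe(E))>\Lambda$, the facing element of $E$ is the unique adjacent $\widetilde E\ne E$ with $E\cap\widetilde E=oe(E)$. Chain of $E$: $E_0=E$; given $E_k$: (i) if $\lambda(moe(E_k))\le\Lambda$, stop with $K=k$; (ii) if $\lambda(moe(E_k))=\Lambda+1$ and the facing element $\widetilde E_k$ is compatible with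 $E_k$, set $E_{k+1}=\widetilde E_k$ and stop; (iii) if $\lambda(moe(E_k))=\Lambda+1$ and $\widetilde E_k$ is not compatible with $E_k$, set $E_{k+1}=\widetilde E_k$ and continue. CREATE_ADMISSIBLE_CHAIN$(\mathcal T,E)$ traverses the chain from its last element backwards to $E_1$: $E_k$ is bisected once if compatible with $E_{k-1}$, otherwise $E_k$ is bisected and then its child facing $E_{k-1}$ is bisected; finally $E_0=E$ is bisected once. REFINE$(\mathcal T,\mathcal M)$ successively applies this procedure to the elements of $\mathcal M$ that are still in the current mesh. $\lesssim$: up to a constant independent of $\delta$, $A$ and the output mesh (it may depend on $\mathcal T_0$, $\Lambda$, $s,p,c_0$). *)

theory Defs
  imports "HOL-Analysis.Analysis" "HOL-Probability.Essential_Supremum"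
begin

section \<open>Lebesgue and Sobolev spaces on planar sets\<close>

(* Exponents p range over the extended reals, so that p = \<infinity> is admitted;
   real_of_ereal (1 / p) is the number 1/p, with 1/\<infinity> = 0. *)

definition Lp_norm :: "ereal \<Rightarrow> 'a measure \<Rightarrow> ('a \<Rightarrow> 'b::real_normed_vector) \<Rightarrow> ereal" where
  "Lp_norm p M f =
     (if p = \<infinity> then esssup M (\<lambda>x. ereal (norm (f x)))
      else let I = (\<integral>\<^sup>+x. ennreal (norm (f x) powr real_of_ereal p) \<partial>M)
           in if I = \<infinity> then \<infinity> else ereal (enn2real I powr real_of_ereal (1 / p)))"

definition Lp_space :: "ereal \<Rightarrow> 'a measure \<Rightarrow> ('a \<Rightarrow> 'b::real_normed_vector) set" where
  "Lp_space p M = {f \<in> borel_measurable M. Lp_norm p M f < \<infinity>}"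

definition partial :: "2 \<Rightarrow> (real^2 \<Rightarrow> real) \<Rightarrow> real^2 \<Rightarrow> real" where
  "partial i f x = frechet_derivative f (at x) (axis i 1)"

fun C_k :: "nat \<Rightarrow> (real^2 \<Rightarrow> real) \<Rightarrow> bool" where
  "C_k 0 f \<longleftrightarrow> continuous_on UNIV f"
| "C_k (Suc k) f \<longleftrightarrow> (\<forall>x. f differentiable (at x)) \<and> (\<forall>i. C_k k (partial i f))"

definition test_functions :: "(real^2) set \<Rightarrow> (real^2 \<Rightarrow> real) set" where
  "test_functions \<Omega> =
     {\<phi>. (\<forall>k. C_k k \<phi>) \<and> compact (closure {x. \<phi> x \<noteq> 0}) \<and> closure {x. \<phi> x \<noteq> 0} \<subseteq> \<Omega>}"

definition locally_integrable ::
  "(real^2) set \<Rightarrow> (real^2 \<Rightarrow> 'b::{banach,second_countable_topology}) \<Rightarrow> bool" where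
  "locally_integrable \<Omega> f \<longleftrightarrow> (\<forall>K. compact K \<and> K \<subseteq> \<Omega> \<longrightarrow> set_integrable lebesgue K f)"

definition weak_gradient :: "(real^2) set \<Rightarrow> (real^2 \<Rightarrow> real) \<Rightarrow> (real^2 \<Rightarrow> real^2) \<Rightarrow> bool" where
  "weak_gradient \<Omega> f G \<longleftrightarrow>
     locally_integrable \<Omega> f \<and> locally_integrable \<Omega> G \<and>
     (\<forall>\<phi> \<in> test_functions \<Omega>. \<forall>i.
        (LINT x|lebesgue_on \<Omega>. f x * partial i \<phi> x) = - (LINT x|lebesgue_on \<Omega>. G x $ i * \<phi> x))"

(* For p < \<infinity> the p-th power of this is the integral over \<Omega> \<times> \<Omega> of
   |f x - f y|^p / |x - y|^(2 + s p). *)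
definition slobodeckij_seminorm :: "real \<Rightarrow> ereal \<Rightarrow> (real^2) set \<Rightarrow> (real^2 \<Rightarrow> real) \<Rightarrow> ereal" where
  "slobodeckij_seminorm s p \<Omega> f =
     Lp_norm p (lebesgue_on \<Omega> \<Otimes>\<^sub>M lebesgue_on \<Omega>)
       (\<lambda>(x, y). \<bar>f x - f y\<bar> / dist x y powr (s + 2 * real_of_ereal (1 / p)))"

(* Only meant for 0 < s \<le> 1. Weak gradients are unique up to null sets, so the seminorm
   does not depend on the choice made by SOME. *)
definition sobolev_seminorm :: "real \<Rightarrow> ereal \<Rightarrow> (real^2) set \<Rightarrow> (real^2 \<Rightarrow> real) \<Rightarrow> ereal" where
  "sobolev_seminorm s p \<Omega> f =
     (if s = 1 then Lp_norm p (lebesgue_on \<Omega>) (SOME G. weak_gradient \<Omega> f G)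
      else slobodeckij_seminorm s p \<Omega> f)"

definition sobolev_space :: "real \<Rightarrow> ereal \<Rightarrow> (real^2) set \<Rightarrow> (real^2 \<Rightarrow> real) set" where
  "sobolev_space s p \<Omega> =
     {f \<in> Lp_space p (lebesgue_on \<Omega>).
        if s = 1 then \<exists>G. weak_gradient \<Omega> f G \<and> G \<in> Lp_space p (lebesgue_on \<Omega>)
        else slobodeckij_seminorm s p \<Omega> f < \<infinity>}"

type_synonym matrix_field = "real^2 \<Rightarrow> real^2^2"

(* \<open>matrix_space X\<close> is X^(2 x 2). *)
definition matrix_space :: "(real^2 \<Rightarrow> real) set \<Rightarrow> matrix_field set" where
  "matrix_space X = {A. \<forall>i j. (\<lambda>x. A x $ i $ j) \<in> X}"

(* The norm of R^(2 x 2) entering the seminorm and the L^\<infinity> norms below is immaterial,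
   as all choices agree up to constant factors. *)
definition matrix_sobolev_seminorm :: "real \<Rightarrow> ereal \<Rightarrow> (real^2) set \<Rightarrow> matrix_field \<Rightarrow> ereal" where
  "matrix_sobolev_seminorm s p \<Omega> A = (\<Sum>i\<in>UNIV. \<Sum>j\<in>UNIV. sobolev_seminorm s p \<Omega> (\<lambda>x. A x $ i $ j))"


section \<open>Triangles and newest-vertex bisection\<close>

(* \<open>Tri v a b\<close> is the triangle with newest vertex v and opposite side [a,b]. *)
datatype tri = Tri (nv: "real^2") (ov1: "real^2") (ov2: "real^2")

type_synonym mesh = "tri set"

definition verts :: "tri \<Rightarrow> (real^2) set" where
  "verts E = {nv E, ov1 E, ov2 E}"

definition region :: "tri \<Rightarrow> (real^2) set" where
  "region E = convex hull verts E"

definition oe :: "tri \<Rightarrow> (real^2) set" where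
  "oe E = closed_segment (ov1 E) (ov2 E)"

definition moe :: "tri \<Rightarrow> real^2" where
  "moe E = midpoint (ov1 E) (ov2 E)"

definition sides :: "tri \<Rightarrow> (real^2) set set" where
  "sides E = {closed_segment (nv E) (ov1 E), closed_segment (nv E) (ov2 E), oe E}"

definition children :: "tri \<Rightarrow> tri set" where
  "children E = {Tri (moe E) (nv E) (ov1 E), Tri (moe E) (nv E) (ov2 E)}"

definition bisect :: "mesh \<Rightarrow> tri \<Rightarrow> mesh" where
  "bisect T E = (T - {E}) \<union> children E"

inductive_set refinements :: "mesh \<Rightarrow> mesh set" for T0 :: mesh where
  initial: "T0 \<in> refinements T0"
| bisection: "T \<in> refinements T0 \<Longrightarrow> E \<in> T \<Longrightarrow> bisect T E \<in> refinements T0"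

(* The condition \<open>interior (closure \<Omega>) = \<Omega>\<close> excludes domains with slits or punctures, which a
   triangulation of the closure could not resolve. *)
definition polygonal_domain :: "(real^2) set \<Rightarrow> bool" where
  "polygonal_domain \<Omega> \<longleftrightarrow>
     open \<Omega> \<and> connected \<Omega> \<and> bounded \<Omega> \<and> \<Omega> \<noteq> {} \<and> interior (closure \<Omega>) = \<Omega> \<and>
     (\<exists>S. finite S \<and> frontier \<Omega> = (\<Union>(a, b)\<in>S. closed_segment a b))"

(* \<open>triangulation\<close> is the library's notion: any two members meet in a common face,
   which is conformity. *)
definition initial_mesh :: "(real^2) set \<Rightarrow> mesh \<Rightarrow> bool" where
  "initial_mesh \<Omega> T0 \<longleftrightarrow>
     finite T0 \<and> (\<forall>E\<in>T0. \<not> collinear (verts E)) \<and> inj_on region T0 \<and>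
     triangulation (region ` T0) \<and> \<Union>(region ` T0) = closure \<Omega> \<and>
     (\<forall>E\<in>T0. \<forall>E'\<in>T0. \<forall>e \<in> sides E \<inter> sides E'. e = oe E \<longleftrightarrow> e = oe E')"


section \<open>Global index and admissibility\<close>

definition nodes :: "mesh \<Rightarrow> (real^2) set" where
  "nodes T = \<Union>(verts ` T)"

definition proper_node :: "mesh \<Rightarrow> real^2 \<Rightarrow> bool" where
  "proper_node T x \<longleftrightarrow> x \<in> nodes T \<and> (\<forall>E\<in>T. x \<in> region E \<longrightarrow> x \<in> verts E)"

definition hanging_node :: "mesh \<Rightarrow> real^2 \<Rightarrow> bool" where
  "hanging_node T x \<longleftrightarrow> x \<in> nodes T \<and> \<not> proper_node T x"

definition child_rel :: "(tri \<times> tri) set" where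
  "child_rel = {(E, C). C \<in> children E}"

(* The triangles that were bisected in order to obtain T from T0: the inner nodes of the
   binary forest with roots T0 and leaves T. *)
definition bisected :: "mesh \<Rightarrow> mesh \<Rightarrow> tri set" where
  "bisected T0 T = {F. (\<exists>E\<in>T0. (E, F) \<in> child_rel\<^sup>*) \<and> (\<exists>D\<in>T. (F, D) \<in> child_rel\<^sup>+)}"

inductive has_index :: "mesh \<Rightarrow> mesh \<Rightarrow> real^2 \<Rightarrow> nat \<Rightarrow> bool" for T0 T :: mesh where
  proper: "proper_node T x \<Longrightarrow> has_index T0 T x 0"
| hanging: "hanging_node T x \<Longrightarrow> F \<in> bisected T0 T \<Longrightarrow> x = moe F \<Longrightarrow>
    has_index T0 T (ov1 F) i \<Longrightarrow> has_index T0 T (ov2 F) j \<Longrightarrow>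
    has_index T0 T x (max i j + 1)"

(* For a refinement T of T0 and a node x of T there is exactly one such n. *)
definition global_index :: "mesh \<Rightarrow> mesh \<Rightarrow> real^2 \<Rightarrow> nat" where
  "global_index T0 T x = (THE n. has_index T0 T x n)"

definition admissible :: "mesh \<Rightarrow> nat \<Rightarrow> mesh \<Rightarrow> bool" where
  "admissible T0 \<Lambda> T \<longleftrightarrow> (\<forall>x\<in>nodes T. global_index T0 T x \<le> \<Lambda>)"

definition admissible_refinements :: "mesh \<Rightarrow> nat \<Rightarrow> nat \<Rightarrow> mesh set" where
  "admissible_refinements T0 \<Lambda> N = {T \<in> refinements T0. admissible T0 \<Lambda> T \<and> card T \<le> N}"


section \<open>The approximation class\<close>

definition mean :: "tri \<Rightarrow> matrix_field \<Rightarrow> real^2^2" where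
  "mean E A = (1 / measure lebesgue (region E)) *\<^sub>R (LINT x|lebesgue_on (region E). A x)"

(* The values on the skeleton of the mesh, a null set, are irrelevant. *)
definition piecewise_mean :: "mesh \<Rightarrow> matrix_field \<Rightarrow> matrix_field" where
  "piecewise_mean T A x = (\<Sum>E\<in>T. indicator (interior (region E)) x *\<^sub>R mean E A)"

definition local_zeta :: "tri \<Rightarrow> matrix_field \<Rightarrow> ereal" where
  "local_zeta E A = Lp_norm \<infinity> (lebesgue_on (region E)) (\<lambda>x. A x - mean E A)"

definition zeta :: "(real^2) set \<Rightarrow> mesh \<Rightarrow> matrix_field \<Rightarrow> ereal" where
  "zeta \<Omega> T A = Lp_norm \<infinity> (lebesgue_on \<Omega>) (\<lambda>x. A x - piecewise_mean T A x)"

definition approximation_class :: "(real^2) set \<Rightarrow> mesh \<Rightarrow> nat \<Rightarrow> real \<Rightarrow> matrix_field set" where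
  "approximation_class \<Omega> T0 \<Lambda> \<sigma> =
     {A \<in> matrix_space (Lp_space \<infinity> (lebesgue_on \<Omega>)).
        \<exists>C. \<forall>N \<ge> card T0.
          (INF T \<in> admissible_refinements T0 \<Lambda> N. zeta \<Omega> T A) \<le> ereal (C * real N powr (- \<sigma>))}"


section \<open>REFINE and GREEDY\<close>

definition adjacent :: "tri \<Rightarrow> tri \<Rightarrow> bool" where
  "adjacent E F \<longleftrightarrow> region E \<inter> region F \<in> sides E \<union> sides F"

definition compatible :: "tri \<Rightarrow> tri \<Rightarrow> bool" where
  "compatible E F \<longleftrightarrow> adjacent E F \<and>
     nv E \<notin> affine hull (region E \<inter> region F) \<and> nv F \<notin> affine hull (region E \<inter> region F)"

definition index_moe :: "mesh \<Rightarrow> mesh \<Rightarrow> tri \<Rightarrow> nat" where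
  "index_moe T0 T E = global_index T0 (if moe E \<in> nodes T then T else bisect T E) (moe E)"

definition facing :: "mesh \<Rightarrow> tri \<Rightarrow> tri" where
  "facing T E = (THE F. F \<in> T \<and> F \<noteq> E \<and> adjacent E F \<and> region E \<inter> region F = oe E)"

(* The chain [E_0, ..., E_K] of E; None stands for a chain that does not end. *)
partial_function (option) chain :: "mesh \<Rightarrow> nat \<Rightarrow> mesh \<Rightarrow> tri \<Rightarrow> tri list option" where
  "chain T0 \<Lambda> T E =
     (if index_moe T0 T E \<le> \<Lambda> then Some [E]
      else if index_moe T0 T E = \<Lambda> + 1 then
        (if compatible E (facing T E) then Some [E, facing T E]
         else Option.bind (chain T0 \<Lambda> T (facing T E)) (\<lambda>cs. Some (E # cs)))
      else None)"

definition facing_child :: "tri \<Rightarrow> tri \<Rightarrow> tri" where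
  "facing_child F E = (THE C. C \<in> children F \<and> region E \<inter> region C = oe E)"

(* Treats E_K, ..., E_1, in this order; E_0 is left untouched. *)
fun traverse_chain :: "tri list \<Rightarrow> mesh \<Rightarrow> mesh" where
  "traverse_chain (E # F # cs) T =
     (let T' = bisect (traverse_chain (F # cs) T) F
      in if compatible F E then T' else bisect T' (facing_child F E))"
| "traverse_chain [E] T = T"
| "traverse_chain [] T = T"

definition create_admissible_chain :: "mesh \<Rightarrow> nat \<Rightarrow> mesh \<Rightarrow> tri \<Rightarrow> mesh option" where
  "create_admissible_chain T0 \<Lambda> T E =
     map_option (\<lambda>cs. bisect (traverse_chain cs T) E) (chain T0 \<Lambda> T E)"

fun refine :: "mesh \<Rightarrow> nat \<Rightarrow> mesh \<Rightarrow> tri list \<Rightarrow> mesh option" where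
  "refine T0 \<Lambda> T [] = Some T"
| "refine T0 \<Lambda> T (E # Ms) =
     (if E \<in> T then Option.bind (create_admissible_chain T0 \<Lambda> T E) (\<lambda>T'. refine T0 \<Lambda> T' Ms)
      else refine T0 \<Lambda> T Ms)"

definition marked :: "real \<Rightarrow> matrix_field \<Rightarrow> mesh \<Rightarrow> tri set" where
  "marked \<delta> A T = {E \<in> T. local_zeta E A > ereal \<delta>}"

(* REFINE does not fix the order in which marked elements are processed; \<open>ord T M\<close> lists
   the set M marked in the mesh T in the order that is used. *)
definition processing_order :: "(mesh \<Rightarrow> tri set \<Rightarrow> tri list) \<Rightarrow> bool" where
  "processing_order ord \<longleftrightarrow> (\<forall>T M. finite M \<longrightarrow> set (ord T M) = M)"

(* \<open>greedy T0 \<Lambda> ord \<delta> A T\<close> is GREEDY(T, \<delta>), with value None if it does not terminate. *)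
partial_function (option) greedy ::
  "mesh \<Rightarrow> nat \<Rightarrow> (mesh \<Rightarrow> tri set \<Rightarrow> tri list) \<Rightarrow> real \<Rightarrow> matrix_field \<Rightarrow> mesh \<Rightarrow> mesh option" where
  "greedy T0 \<Lambda> ord \<delta> A T =
     (if marked \<delta> A T = {} then Some T
      else Option.bind (refine T0 \<Lambda> T (ord T (marked \<delta> A T))) (greedy T0 \<Lambda> ord \<delta> A))"

end

theory Submission
  imports Defs
begin

text \<open>
  Two independent estimates carry the rate.  Let \<open>w\<close> bound the seminorms of the entries of \<open>A\<close> and
  write \<open>|E|\<close> for the area of a triangle \<open>E\<close>.

  \<^item> Locally, the oscillation of \<open>A\<close> around its mean on \<open>E\<close> is at most a constant times
    \<open>|E|\<^sup>\<alpha> \<nu>(E)\<^sup>1\<^sup>/\<^sup>q\<close>, where \<open>\<alpha> = s/2 - 1/q > 0\<close> and \<open>\<nu>\<close> is an energy that is summable over disjoint triangles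
    with total of order \<open>w\<^sup>q\<close> (\<open>sobolev_control\<close>, \<open>pointwise_bound\<close>).  For finite \<open>p\<close> the exponent \<open>q\<close> is \<open>p\<close>; for
    \<open>p = \<infinity>\<close> any finite \<open>q > 2/s\<close> serves, with a multiple of the area as energy.

  \<^item> Combinatorially, one call of CREATE-ADMISSIBLE-CHAIN bisects at most two triangles of each
    generation, and none of a generation beyond that of the triangle it is called for
    (\<open>create_admissible_chain_props\<close>).

  By the first estimate at most \<open>R 2\<^sup>-\<^sup>i\<^sup>\<beta>\<close> triangles of generation \<open>i\<close> are ever marked, where \<open>\<beta> = \<alpha> q\<close> and \<open>R\<close> is
  of order \<open>(w/\<delta>)\<^sup>q\<close>: an error above \<open>\<delta>\<close> on a triangle of area of order \<open>2\<^sup>-\<^sup>i\<close> costs a definite amount of energy.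
  By the second one the number of bisections in generation \<open>j\<close> is at most twice the number of
  marked triangles of generation at least \<open>j\<close>, hence of order \<open>R 2\<^sup>-\<^sup>j\<^sup>\<beta>\<close>; it is trivially at most \<open>2\<^sup>j #\<T>\<^sub>0\<close>.
  The sum over \<open>j\<close> of the smaller of the two bounds is dominated by the generation in which they
  agree, and is of order \<open>R\<^sup>1\<^sup>/\<^sup>(\<^sup>1\<^sup>+\<^sup>\<beta>\<^sup>) = (w/\<delta>)\<^sup>2\<^sup>/\<^sup>s\<close> (\<open>greedy_cardinality\<close>, \<open>greedy_rate\<close>).  The decay
  in \<open>i\<close> absorbs the growth of the length of a chain with the generation.  Finally, when GREEDY stops the error is at most \<open>\<delta>\<close>, and \<open>\<delta>\<close>
  is expressed by the number of elements.

  All statements about meshes are reduced to the meshes \<open>lev T0 k\<close> that arise by \<open>k\<close> simultaneous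
  bisections of all triangles.  The labelling makes each of them conforming again
  (\<open>conf_bisect_all\<close>).  A refinement is then determined by the set of its bisected triangles; in
  terms of this set, the midpoint of a refinement edge is a proper node if and only if the
  triangles on both sides of the edge have been bisected (\<open>proper_moe\<close>), and the global index
  becomes a recursion on generations.
\<close>

section \<open>Faces of a triangle and of its children\<close>

definition nd :: "tri \<Rightarrow> bool" where
  "nd E \<longleftrightarrow> \<not> collinear (verts E)"

lemma bary_unique:
  fixes v a b :: "real^2"
  assumes "\<not> collinear {v, a, b}" "x + y + z = 1" "x' + y' + z' = 1"
    and eq: "x *\<^sub>R v + y *\<^sub>R a + z *\<^sub>R b = x' *\<^sub>R v + y' *\<^sub>R a + z' *\<^sub>R b"
  shows "x = x' \<and> y = y' \<and> z = z'"
proof -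
  have d: "v \<noteq> a" "v \<noteq> b" "a \<noteq> b" and i: "\<not> affine_dependent {v, a, b}"
    using assms(1) by (auto simp: collinear_3_eq_affine_dependent)
  define u where "u = (\<lambda>p. if p = v then x - x' else if p = a then y - y' else z - z')"
  have "sum u {v, a, b} = 0"
    using d assms(2,3) by (simp add: u_def)
  moreover have "(\<Sum>p\<in>{v, a, b}. u p *\<^sub>R p) = 0"
    using d eq by (simp add: u_def scaleR_diff_left algebra_simps)
  ultimately have "\<forall>p\<in>{v, a, b}. u p = 0"
    using i by (auto simp: affine_dependent_explicit_finite)
  then show ?thesis using d by (auto simp: u_def split: if_splits)
qed

lemma noncollinear_distinct: "\<not> collinear {v, a, b} \<Longrightarrow> v \<noteq> a \<and> v \<noteq> b \<and> a \<noteq> b"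
  by (auto simp: insert_commute)

lemma region_Tri:
  "region (Tri v a b) = {x *\<^sub>R v + y *\<^sub>R a + z *\<^sub>R b | x y z. 0 \<le> x \<and> 0 \<le> y \<and> 0 \<le> z \<and> x + y + z = 1}"
  by (simp add: region_def verts_def convex_hull_3)

lemma region_TriI:
  "0 \<le> x \<Longrightarrow> 0 \<le> y \<Longrightarrow> 0 \<le> z \<Longrightarrow> x + y + z = 1 \<Longrightarrow> p = x *\<^sub>R v + y *\<^sub>R a + z *\<^sub>R b \<Longrightarrow>
    p \<in> region (Tri v a b)"
  unfolding region_Tri by blast

lemma region_TriE:
  assumes "p \<in> region (Tri v a b)"
  obtains x y z where "0 \<le> x" "0 \<le> y" "0 \<le> z" "x + y + z = 1" "p = x *\<^sub>R v + y *\<^sub>R a + z *\<^sub>R b"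
  using assms unfolding region_Tri by blast

lemma verts_Tri [simp]: "verts (Tri v a b) = {v, a, b}"
  by (simp add: verts_def)

lemma moe_Tri [simp]: "moe (Tri v a b) = midpoint a b"
  by (simp add: moe_def)

lemma oe_hull: "oe E = convex hull {ov1 E, ov2 E}"
  by (simp add: oe_def segment_convex_hull)

lemma ov_subset_verts: "{ov1 E, ov2 E} \<subseteq> verts E"
  by (auto simp: verts_def)

lemma oe_eq_iff: "oe E = oe F \<longleftrightarrow> {ov1 E, ov2 E} = {ov1 F, ov2 F}"
  by (simp add: oe_def)

lemma oe_subset_region: "oe E \<subseteq> region E"
  unfolding oe_hull region_def by (intro hull_mono ov_subset_verts)

lemma moe_in_oe: "moe E \<in> oe E"
  by (simp add: moe_def oe_def)

lemma verts_subset_region: "verts E \<subseteq> region E"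
  unfolding region_def by (rule hull_subset)

lemma moe_eq_of_oe_eq: "oe E = oe F \<Longrightarrow> moe E = moe F"
  by (auto simp: oe_eq_iff moe_def doubleton_eq_iff midpoint_sym)

lemma finite_verts [simp]: "finite (verts E)"
  by (simp add: verts_def)

lemma nd_distinct:
  assumes "nd E"
  shows "nv E \<noteq> ov1 E" "nv E \<noteq> ov2 E" "ov1 E \<noteq> ov2 E" "\<not> affine_dependent (verts E)" "card (verts E) = 3"
  using assms by (auto simp: nd_def verts_def collinear_3_eq_affine_dependent)

text \<open>Subsets of the vertices of a nondegenerate triangle are affinely independent, so the hulls of
  such subsets intersect as the subsets do.  Incidences of triangles thereby become statements
  about vertex sets.\<close>

lemma hull_Int_faces:
  assumes "nd E" "S \<subseteq> verts E" "S' \<subseteq> verts E"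
  shows "convex hull S \<inter> convex hull S' = convex hull (S \<inter> S')"
proof -
  have "\<not> affine_dependent (S \<union> S')"
    using nd_distinct(4)[OF assms(1)] affine_independent_subset assms(2,3) by (metis Un_least)
  then show ?thesis by (simp add: convex_hull_Int)
qed

lemma vertex_in_face:
  assumes "nd E" "S \<subseteq> verts E" "x \<in> verts E" "x \<in> convex hull S"
  shows "x \<in> S"
proof -
  have "x \<in> convex hull {x} \<inter> convex hull S" using assms by simp
  also have "\<dots> = convex hull ({x} \<inter> S)" using assms by (intro hull_Int_faces[of E]) auto
  finally show ?thesis by (cases "x \<in> S") auto
qed

text \<open>Both children have the form \<open>Tri (midpoint a b) v a\<close> once the ends of the refinement edge are
  named suitably, which avoids duplicating every argument about children.\<close>

lemma child_cases:
  assumes "C \<in> children D"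
  obtains v a b where "nv D = v" "{ov1 D, ov2 D} = {a, b}" "verts D = {v, a, b}"
    "C = Tri (midpoint a b) v a" "moe D = midpoint a b"
proof -
  from assms consider "C = Tri (moe D) (nv D) (ov1 D)" | "C = Tri (moe D) (nv D) (ov2 D)"
    by (auto simp: children_def)
  then show ?thesis
  proof cases
    case 1
    then show ?thesis using that[of "nv D" "ov1 D" "ov2 D"] by (auto simp: verts_def moe_def)
  next
    case 2
    then show ?thesis using that[of "nv D" "ov2 D" "ov1 D"]
      by (auto simp: verts_def moe_def midpoint_sym insert_commute)
  qed
qed

lemma midpoint_comb:
  fixes v a b :: "real^2"
  shows "\<alpha> *\<^sub>R midpoint a b + \<beta> *\<^sub>R v + \<gamma> *\<^sub>R a = \<beta> *\<^sub>R v + (\<gamma> + \<alpha>/2) *\<^sub>R a + (\<alpha>/2) *\<^sub>R b"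
  by (simp add: midpoint_def vec_eq_iff field_simps)

text \<open>In barycentric coordinates, a child contains the points whose coordinate at the opposite end of
  the refinement edge is the smaller one.  A face that misses one end of this edge is hence
  either contained in the child or meets it in a smaller face.\<close>

lemma child_face:
  fixes v a b :: "real^2"
  assumes nd: "\<not> collinear {v, a, b}" and S: "S \<subseteq> {v, a, b}" "\<not> {a, b} \<subseteq> S"
  shows "region (Tri (midpoint a b) v a) \<inter> convex hull S = convex hull ({midpoint a b, v, a} \<inter> S)"
proof (intro equalityI subsetI)
  fix p assume p: "p \<in> region (Tri (midpoint a b) v a) \<inter> convex hull S"
  have nd': "nd (Tri v a b)" using nd by (simp add: nd_def)
  obtain \<alpha> \<beta> \<gamma> where c: "0 \<le> \<alpha>" "0 \<le> \<beta>" "0 \<le> \<gamma>" "\<alpha> + \<beta> + \<gamma> = 1"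
      "p = \<alpha> *\<^sub>R midpoint a b + \<beta> *\<^sub>R v + \<gamma> *\<^sub>R a"
    using p by (auto simp: region_Tri)
  then have pe: "p = \<beta> *\<^sub>R v + (\<gamma> + \<alpha>/2) *\<^sub>R a + (\<alpha>/2) *\<^sub>R b"
    by (simp add: midpoint_comb)
  have *: "p \<in> convex hull ({midpoint a b, v, a} \<inter> S)"
    if T: "p \<in> convex hull T" "T \<subseteq> {midpoint a b, v, a}" "T \<subseteq> {v, a, b}" for T
  proof -
    have "p \<in> convex hull (T \<inter> S)"
      using hull_Int_faces[OF nd', of T S] T p S by auto
    then show ?thesis
      by (rule set_mp[OF hull_mono, rotated]) (use T in auto)
  qed
  show "p \<in> convex hull ({midpoint a b, v, a} \<inter> S)"
  proof (cases "b \<in> S")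
    case False
    then have "p \<in> convex hull {v, a}"
      using p S by (auto intro: set_mp[OF hull_mono, rotated])
    then obtain x y where "x + y = 1" "p = x *\<^sub>R v + y *\<^sub>R a" "0 \<le> x" "0 \<le> y"
      by (auto simp: convex_hull_2)
    then have "\<alpha>/2 = 0"
      using bary_unique[OF nd, of \<beta> "\<gamma> + \<alpha>/2" "\<alpha>/2" x y 0] pe c(4) by simp
    then have "p \<in> convex hull {v, a}"
      using pe c by (auto simp: convex_hull_2)
    then show ?thesis by (rule *) auto
  next
    case True
    then have "p \<in> convex hull {v, b}"
      using p S by (auto intro: set_mp[OF hull_mono, rotated])
    then obtain x y where "x + y = 1" "p = x *\<^sub>R v + y *\<^sub>R b" "0 \<le> x" "0 \<le> y"
      by (auto simp: convex_hull_2)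
    then have "\<gamma> + \<alpha>/2 = 0"
      using bary_unique[OF nd, of \<beta> "\<gamma> + \<alpha>/2" "\<alpha>/2" x 0 y] pe c(4) by simp
    then have "\<gamma> = 0" "\<alpha> = 0" using c by auto
    then have "p \<in> convex hull {v}"
      using pe c by auto
    then show ?thesis by (rule *) auto
  qed
next
  fix p assume "p \<in> convex hull ({midpoint a b, v, a} \<inter> S)"
  then show "p \<in> region (Tri (midpoint a b) v a) \<inter> convex hull S"
    unfolding region_def by (auto intro: set_mp[OF hull_mono, rotated])
qed

lemma child_edge:
  fixes v a b :: "real^2"
  assumes nd: "\<not> collinear {v, a, b}"
  shows "region (Tri (midpoint a b) v a) \<inter> convex hull {a, b} = convex hull {midpoint a b, a}"
proof (intro equalityI subsetI)
  fix p assume p: "p \<in> region (Tri (midpoint a b) v a) \<inter> convex hull {a, b}"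
  obtain \<alpha> \<beta> \<gamma> where c: "0 \<le> \<alpha>" "0 \<le> \<beta>" "0 \<le> \<gamma>" "\<alpha> + \<beta> + \<gamma> = 1"
      "p = \<alpha> *\<^sub>R midpoint a b + \<beta> *\<^sub>R v + \<gamma> *\<^sub>R a"
    using p by (auto simp: region_Tri)
  then have pe: "p = \<beta> *\<^sub>R v + (\<gamma> + \<alpha>/2) *\<^sub>R a + (\<alpha>/2) *\<^sub>R b"
    by (simp add: midpoint_comb)
  from p obtain x y where "x + y = 1" "p = x *\<^sub>R a + y *\<^sub>R b"
    by (auto simp: convex_hull_2)
  then have "\<beta> = 0"
    using bary_unique[OF nd, of \<beta> "\<gamma> + \<alpha>/2" "\<alpha>/2" 0 x y] pe c(4) by simp
  then show "p \<in> convex hull {midpoint a b, a}"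
    using c by (auto simp: convex_hull_2)
next
  fix p assume p: "p \<in> convex hull {midpoint a b, a}"
  have "midpoint a b \<in> convex hull {a, b}"
    by (metis midpoint_in_closed_segment segment_convex_hull)
  then have "convex hull {midpoint a b, a} \<subseteq> convex hull {a, b}"
    by (intro hull_minimal) (auto intro: hull_inc)
  then show "p \<in> region (Tri (midpoint a b) v a) \<inter> convex hull {a, b}"
    using p unfolding region_def by (auto intro: set_mp[OF hull_mono, rotated])
qed

lemma midpoint_in_face:
  fixes v a b :: "real^2"
  assumes nd: "\<not> collinear {v, a, b}" and S: "S \<subseteq> {v, a, b}" and m: "midpoint a b \<in> convex hull S"
  shows "{a, b} \<subseteq> S"
proof -
  have me: "midpoint a b = 0 *\<^sub>R v + (1/2) *\<^sub>R a + (1/2) *\<^sub>R b"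
    by (simp add: midpoint_def scaleR_add_right)
  have "a \<in> S"
  proof (rule ccontr)
    assume "a \<notin> S"
    then have "midpoint a b \<in> convex hull {v, b}"
      using m S by (auto intro: set_mp[OF hull_mono, rotated])
    then obtain x y where "x + y = 1" "midpoint a b = x *\<^sub>R v + y *\<^sub>R b"
      by (auto simp: convex_hull_2)
    then show False
      using bary_unique[OF nd, of 0 "1/2" "1/2" x 0 y] me by simp
  qed
  moreover have "b \<in> S"
  proof (rule ccontr)
    assume "b \<notin> S"
    then have "midpoint a b \<in> convex hull {v, a}"
      using m S by (auto intro: set_mp[OF hull_mono, rotated])
    then obtain x y where "x + y = 1" "midpoint a b = x *\<^sub>R v + y *\<^sub>R a"
      by (auto simp: convex_hull_2)
    then show False
      using bary_unique[OF nd, of 0 "1/2" "1/2" x y 0] me by simp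
  qed
  ultimately show ?thesis by simp
qed

lemma moe_in_face:
  assumes "nd E" "S \<subseteq> verts E" "moe E \<in> convex hull S"
  shows "{ov1 E, ov2 E} \<subseteq> S"
  using midpoint_in_face[of "nv E" "ov1 E" "ov2 E" S] assms by (simp add: nd_def verts_def moe_def)

lemma moe_notin_verts: "nd E \<Longrightarrow> moe E \<notin> verts E"
  using moe_in_face[of E "{moe E}"] nd_distinct[of E] by auto

lemma nd_child:
  assumes "nd D" "C \<in> children D"
  shows "nd C"
  using assms(2)
proof (rule child_cases)
  fix v a b assume h: "verts D = {v, a, b}" "C = Tri (midpoint a b) v a"
  have nc: "\<not> collinear {v, a, b}" using assms h by (simp add: nd_def)
  have d: "v \<noteq> a" "v \<noteq> b" "a \<noteq> b" using noncollinear_distinct[OF nc] by auto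
  have m: "midpoint a b \<notin> affine hull {v, a}"
  proof
    assume "midpoint a b \<in> affine hull {v, a}"
    then obtain x y where "x + y = 1" "midpoint a b = x *\<^sub>R v + y *\<^sub>R a"
      by (auto simp: affine_hull_2)
    then show False
      using bary_unique[OF nc, of 0 "1/2" "1/2" x y 0]
      by (simp add: midpoint_def scaleR_add_right)
  qed
  have "\<not> collinear {midpoint a b, v, a}"
    using m d(1) by (metis collinear_3_affine_hull insert_commute)
  then show "nd C" by (simp add: h nd_def)
qed

lemma region_children: "region D = (\<Union>C\<in>children D. region C)"
proof -
  obtain v a b where D: "D = Tri v a b" by (cases D)
  have *: "region (Tri (midpoint a b) v a) \<subseteq> region (Tri v a b)" for v a b
    unfolding region_def verts_Tri
    by (intro hull_minimal convex_convex_hull)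
       (auto intro: hull_inc set_mp[OF hull_mono[of "{a,b}"]] simp: midpoint_in_closed_segment
          simp flip: segment_convex_hull)
  have sw: "region (Tri v a b) = region (Tri v b a)" for v a b
    by (simp add: region_def insert_commute)
  have "p \<in> region (Tri (midpoint a b) v a) \<union> region (Tri (midpoint a b) v b)" 
    if p: "p \<in> region (Tri v a b)" for p
  proof -
    obtain x y z where c: "0 \<le> x" "0 \<le> y" "0 \<le> z" "x + y + z = 1" "p = x *\<^sub>R v + y *\<^sub>R a + z *\<^sub>R b"
      using p by (rule region_TriE)
    show ?thesis
    proof (cases "z \<le> y")
      case True
      have "p = (2*z) *\<^sub>R midpoint a b + x *\<^sub>R v + (y - z) *\<^sub>R a"
        unfolding midpoint_comb c(5) by simp
      moreover have "0 \<le> 2*z" "0 \<le> y - z" "2*z + x + (y - z) = 1" using True c by auto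
      ultimately have "p \<in> region (Tri (midpoint a b) v a)" using c by (intro region_TriI[of "2*z" x "y - z"])
      then show ?thesis by simp
    next
      case False
      have "p = (2*y) *\<^sub>R midpoint b a + x *\<^sub>R v + (z - y) *\<^sub>R b"
        unfolding midpoint_comb c(5) by (simp add: algebra_simps)
      moreover have "0 \<le> 2*y" "0 \<le> z - y" "2*y + x + (z - y) = 1" using False c by auto
      ultimately have "p \<in> region (Tri (midpoint b a) v b)" using c by (intro region_TriI[of "2*y" x "z - y"])
      then show ?thesis by (simp add: midpoint_sym)
    qed
  qed
  then show ?thesis
    using *[of a b v] *[of b a v] sw[of v a b] unfolding D children_def
    by (auto simp: midpoint_sym)
qed

section \<open>Conforming labelled triangulations\<close>

text \<open>Conformity in terms of vertex sets.  The last clause is the compatibility of the labelling: an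
  edge that is opposite to the newest vertex of one triangle is so for every triangle that has
  this edge.\<close>

definition conf :: "mesh \<Rightarrow> bool" where
  "conf U \<longleftrightarrow> finite U \<and> (\<forall>E\<in>U. nd E) \<and>
     (\<forall>D\<in>U. \<forall>F\<in>U. region D \<inter> region F = convex hull (verts D \<inter> verts F)) \<and>
     (\<forall>D\<in>U. \<forall>F\<in>U. verts D = verts F \<longrightarrow> D = F) \<and>
     (\<forall>D\<in>U. \<forall>F\<in>U. {ov1 D, ov2 D} \<subseteq> verts F \<longrightarrow> {ov1 F, ov2 F} = {ov1 D, ov2 D})"

lemma confD:
  assumes "conf U" "D \<in> U"
  shows conf_nd: "nd D"
    and conf_Int: "F \<in> U \<Longrightarrow> region D \<inter> region F = convex hull (verts D \<inter> verts F)"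
    and conf_inj: "F \<in> U \<Longrightarrow> verts D = verts F \<Longrightarrow> D = F"
    and conf_lab: "F \<in> U \<Longrightarrow> {ov1 D, ov2 D} \<subseteq> verts F \<Longrightarrow> {ov1 F, ov2 F} = {ov1 D, ov2 D}"
  using assms by (auto simp: conf_def)

definition bisect_all :: "mesh \<Rightarrow> mesh" where
  "bisect_all U = (\<Union>E\<in>U. children E)"

lemma common_verts_collinear:
  assumes "conf U" "D \<in> U" "F \<in> U" "D \<noteq> F"
  shows "collinear (verts D \<inter> verts F)" "card (verts D \<inter> verts F) \<le> 2"
proof -
  have "verts D \<noteq> verts F" using assms conf_inj by metis
  moreover have c3: "card (verts D) = 3" "card (verts F) = 3"
    using assms conf_nd nd_distinct by blast+
  ultimately have "verts D \<inter> verts F \<noteq> verts D"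
    by (metis card_subset_eq finite_verts inf.absorb_iff1)
  then have "card (verts D \<inter> verts F) < 3"
    by (metis c3(1) finite_verts inf_le1 psubsetI psubset_card_mono)
  then show "card (verts D \<inter> verts F) \<le> 2" by simp
  then show "collinear (verts D \<inter> verts F)"
    by (intro collinear_small) auto
qed

text \<open>Two different members of a conforming mesh share at most two vertices, hence only a
  degenerate set.\<close>

lemma no_common_triangle:
  assumes "conf U" "D \<in> U" "F \<in> U" "D \<noteq> F" "nd C" "verts C \<subseteq> region D" "verts C \<subseteq> region F"
  shows False
proof -
  have "verts C \<subseteq> convex hull (verts D \<inter> verts F)"
    using assms conf_Int[of U D F] by auto
  then have "collinear (verts C)"
    using common_verts_collinear(1)[OF assms(1-4)]
    by (meson collinear_affine_hull_collinear collinear_subset convex_hull_subset_affine_hull subset_trans)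
  then show False using assms by (simp add: nd_def)
qed

lemma parent_unique_conf:
  assumes "conf U" "D \<in> U" "F \<in> U" "C \<in> children D" "C \<in> children F"
  shows "D = F"
proof (rule ccontr)
  assume "D \<noteq> F"
  have "nd C" using assms conf_nd nd_child by blast
  moreover have "verts C \<subseteq> region D" "verts C \<subseteq> region F"
    using assms region_children verts_subset_region by blast+
  ultimately show False using no_common_triangle[OF assms(1-3) \<open>D \<noteq> F\<close>] by blast
qed

lemma siblings:
  assumes nd: "nd D" and C: "C \<in> children D" "C' \<in> children D"
  shows "region C \<inter> region C' = convex hull (verts C \<inter> verts C')" "verts C = verts C' \<Longrightarrow> C = C'"
proof -
  obtain v a b where h: "nv D = v" "{ov1 D, ov2 D} = {a, b}" "verts D = {v, a, b}"
    "C = Tri (midpoint a b) v a" "moe D = midpoint a b" using C(1) by (rule child_cases)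
  have nc: "\<not> collinear {v, a, b}" using nd h by (simp add: nd_def)
  have d: "v \<noteq> a" "v \<noteq> b" "a \<noteq> b" using noncollinear_distinct[OF nc] by auto
  have m: "midpoint a b \<noteq> v" "midpoint a b \<noteq> a" "midpoint a b \<noteq> b"
    using moe_notin_verts[OF nd] h by auto
  have "C' = C \<or> C' = Tri (midpoint a b) v b"
    using C(2) h by (auto simp: children_def doubleton_eq_iff)
  then consider "C' = C" | "C' = Tri (midpoint a b) v b" by blast
  then have "region C \<inter> region C' = convex hull (verts C \<inter> verts C') \<and> (verts C = verts C' \<longrightarrow> C = C')"
  proof cases
    case 1
    then show ?thesis by (simp add: region_def)
  next
    case 2
    have i: "verts C \<inter> verts C' = {midpoint a b, v}" using 2 h d m by auto
    have "p \<in> convex hull {midpoint a b, v}" if p: "p \<in> region C" "p \<in> region C'" for p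
    proof -
      obtain x y z where c: "0 \<le> x" "0 \<le> y" "0 \<le> z" "x + y + z = 1"
          "p = x *\<^sub>R midpoint a b + y *\<^sub>R v + z *\<^sub>R a"
        using p(1) unfolding h by (rule region_TriE)
      obtain x' y' z' where c': "0 \<le> x'" "0 \<le> y'" "0 \<le> z'" "x' + y' + z' = 1"
          "p = x' *\<^sub>R midpoint a b + y' *\<^sub>R v + z' *\<^sub>R b"
        using p(2) unfolding 2 by (rule region_TriE)
      have e1: "p = y *\<^sub>R v + (z + x/2) *\<^sub>R a + (x/2) *\<^sub>R b"
        using c(5) by (simp add: midpoint_comb)
      have e2: "p = y' *\<^sub>R v + (x'/2) *\<^sub>R a + (z' + x'/2) *\<^sub>R b"
        using c'(5) midpoint_comb[of x' b a y' v z'] by (simp add: midpoint_sym algebra_simps)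
      have "y = y' \<and> z + x/2 = x'/2 \<and> x/2 = z' + x'/2"
        by (rule bary_unique[OF nc _ _ trans[OF e1[symmetric] e2]]) (use c(4) c'(4) in simp_all)
      then have "z = 0" using c c' by auto
      then show ?thesis using c by (auto simp: convex_hull_2)
    qed
    moreover have "convex hull {midpoint a b, v} \<subseteq> region C \<inter> region C'"
      unfolding region_def using i by (intro Int_greatest hull_mono) auto
    ultimately have "region C \<inter> region C' = convex hull (verts C \<inter> verts C')"
      unfolding i by blast
    moreover have "a \<in> verts C" "a \<notin> verts C'" using d m(2)[symmetric] by (simp_all add: h(4) 2)
    ultimately show ?thesis by metis
  qed
  then show "region C \<inter> region C' = convex hull (verts C \<inter> verts C')"
    "verts C = verts C' \<Longrightarrow> C = C'" by auto
qed

text \<open>An edge common to two triangles is the refinement edge of both or of neither.  In the first case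
  both are bisected at the same midpoint, and the children meet in half of the edge or in this
  midpoint; in the second case the edge is not subdivided and becomes the refinement edge of the
  two children adjacent to it, so that the labelling is compatible again.\<close>

lemma conf_bisect_all:
  assumes U: "conf U"
  shows "conf (bisect_all U)"
proof -
  have fin: "finite (bisect_all U)"
    using U by (auto simp: bisect_all_def conf_def children_def)
  have nd: "nd C" if "C \<in> bisect_all U" for C
    using that U nd_child conf_nd by (auto simp: bisect_all_def)
  have main: "region C \<inter> region C' = convex hull (verts C \<inter> verts C') \<and> (verts C = verts C' \<longrightarrow> C = C')"
    if D: "D \<in> U" "C \<in> children D" and F: "F \<in> U" "C' \<in> children F" for C C' D F
  proof (cases "D = F")
    case True
    then show ?thesis using siblings[of D C C'] conf_nd[OF U D(1)] D F by blast
  next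
    case DF: False
    obtain v a b where h: "nv D = v" "{ov1 D, ov2 D} = {a, b}" "verts D = {v, a, b}"
      "C = Tri (midpoint a b) v a" "moe D = midpoint a b" using D(2) by (rule child_cases)
    obtain v' a' b' where h': "nv F = v'" "{ov1 F, ov2 F} = {a', b'}" "verts F = {v', a', b'}"
      "C' = Tri (midpoint a' b') v' a'" "moe F = midpoint a' b'" using F(2) by (rule child_cases)
    define S where "S = verts D \<inter> verts F"
    have ndD: "nd D" and ndF: "nd F" using U D F conf_nd by auto
    have nc: "\<not> collinear {v, a, b}" "\<not> collinear {v', a', b'}"
      using ndD ndF h h' by (simp_all add: nd_def)
    have SD: "S \<subseteq> {v, a, b}" and SF: "S \<subseteq> {v', a', b'}" using h h' by (auto simp: S_def)
    have card_S: "card S \<le> 2" using common_verts_collinear(2)[OF U D(1) F(1) DF] by (simp add: S_def)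
    have RS: "region D \<inter> region F = convex hull S" using conf_Int U D F by (simp add: S_def)
    have CD: "region C \<subseteq> region D" "region C' \<subseteq> region F"
      using region_children D F by blast+
    have RC: "region C \<inter> region C' = (region C \<inter> convex hull S) \<inter> (region C' \<inter> convex hull S)"
      using CD RS by blast
    have vC: "verts C \<inter> verts C' \<subseteq> convex hull S"
      using RS CD verts_subset_region by blast
    have inj: "verts C \<noteq> verts C'"
    proof
      assume "verts C = verts C'"
      then have "verts C \<subseteq> region D" "verts C \<subseteq> region F"
        using CD verts_subset_region by blast+
      then show False
        using no_common_triangle[OF U D(1) F(1) DF, of C] nd_child[OF ndD D(2)] by blast
    qed
    have "region C \<inter> region C' = convex hull (verts C \<inter> verts C')"
    proof (cases "{a, b} \<subseteq> S")
      case False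
      have F': "\<not> {a', b'} \<subseteq> S"
      proof
        assume "{a', b'} \<subseteq> S"
        then have "{ov1 D, ov2 D} = {a', b'}"
          using conf_lab[OF U F(1) D(1)] h' by (auto simp: S_def)
        then show False using False \<open>{a', b'} \<subseteq> S\<close> h by simp
      qed
      have "midpoint a b \<notin> convex hull S" "midpoint a' b' \<notin> convex hull S"
        using midpoint_in_face nc SD SF False F' by blast+
      then have "verts C \<inter> verts C' \<subseteq> S"
        using vC vertex_in_face[OF ndD, of S] SD unfolding h(3,4) h'(3,4) verts_Tri by auto
      then have "verts C \<inter> verts C' = (verts C \<inter> S) \<inter> (verts C' \<inter> S)" by blast
      moreover have "region C \<inter> convex hull S = convex hull (verts C \<inter> S)"
        using child_face[OF nc(1) SD False] h by simp
      moreover have "region C' \<inter> convex hull S = convex hull (verts C' \<inter> S)"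
        using child_face[OF nc(2) SF F'] h' by simp
      ultimately show ?thesis
        unfolding RC using hull_Int_faces[OF ndD, of "verts C \<inter> S" "verts C' \<inter> S"] SD h by auto
    next
      case True
      have d: "a \<noteq> b" "v \<noteq> a" "v \<noteq> b" using noncollinear_distinct[OF nc(1)] by auto
      have Seq: "S = {a, b}"
        using True card_S d by (metis card_2_iff card_seteq SD finite.emptyI finite_insert finite_subset)
      have ab': "{a', b'} = {a, b}"
        using conf_lab[OF U D(1) F(1)] h h' True by (auto simp: S_def)
      have m': "midpoint a' b' = midpoint a b"
        using ab' by (auto simp: doubleton_eq_iff midpoint_sym)
      have e: "region C \<inter> convex hull S = convex hull {midpoint a b, a}"
        using child_edge[OF nc(1)] h Seq by simp
      have e': "region C' \<inter> convex hull S = convex hull {midpoint a b, a'}"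
        using child_edge[OF nc(2)] h' Seq ab' m' by simp
      have vv: "v \<noteq> v'" "v \<notin> S" "v' \<notin> S"
        using inj h h' ab' nc noncollinear_distinct[OF nc(1)] noncollinear_distinct[OF nc(2)] Seq SD by (auto simp: S_def doubleton_eq_iff)
      have mv: "midpoint a b \<notin> {v, a, b}" "midpoint a b \<notin> {v', a', b'}"
        using moe_notin_verts ndD ndF h h' m' by metis+
      show ?thesis
      proof (cases "a = a'")
        case True
        have "verts C \<inter> verts C' = {midpoint a b, a}"
          using h h' m' mv vv True Seq by auto
        then show ?thesis unfolding RC e e' using True by simp
      next
        case False
        then have a': "a' = b" using ab' by (auto simp: doubleton_eq_iff)
        have "verts C \<inter> verts C' = {midpoint a b}"
          using h h' m' mv vv a' d Seq by auto
        moreover have "convex hull {midpoint a b, a} \<inter> convex hull {midpoint a b, b} = {midpoint a b}"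
        proof -
          have "convex hull {midpoint a b, a} \<inter> convex hull {midpoint a b, b} \<subseteq> {midpoint a b}"
          proof
            fix p assume "p \<in> convex hull {midpoint a b, a} \<inter> convex hull {midpoint a b, b}"
            then obtain x y x' y' where c: "x + y = 1" "0 \<le> x" "0 \<le> y" "p = x *\<^sub>R midpoint a b + y *\<^sub>R a"
               "x' + y' = 1" "0 \<le> x'" "0 \<le> y'" "p = x' *\<^sub>R midpoint a b + y' *\<^sub>R b"
              by (auto simp: convex_hull_2)
            have e1: "p = 0 *\<^sub>R v + (y + x/2) *\<^sub>R a + (x/2) *\<^sub>R b"
              using c(4) midpoint_comb[of x a b 0 v y] by simp
            have e2: "p = 0 *\<^sub>R v + (x'/2) *\<^sub>R a + (y' + x'/2) *\<^sub>R b"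
              using c(8) midpoint_comb[of x' b a 0 v y'] by (simp add: midpoint_sym[of b a] add.commute)
            have "0 = (0::real) \<and> y + x/2 = x'/2 \<and> x/2 = y' + x'/2"
              by (rule bary_unique[OF nc(1) _ _ trans[OF e1[symmetric] e2]]) (use c in simp_all)
            then have "y = 0" using c by auto
            then show "p \<in> {midpoint a b}" using c by simp
          qed
          then show ?thesis by (auto intro: hull_inc)
        qed
        ultimately show ?thesis unfolding RC e e' a' by simp
      qed
    qed
    then show ?thesis using inj by simp
  qed
  have lab: "{ov1 C', ov2 C'} = {ov1 C, ov2 C}"
    if D: "D \<in> U" "C \<in> children D" and F: "F \<in> U" "C' \<in> children F"
      and s: "{ov1 C, ov2 C} \<subseteq> verts C'" for C C' D F
  proof -
    obtain v a b where h: "nv D = v" "{ov1 D, ov2 D} = {a, b}" "verts D = {v, a, b}"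
      "C = Tri (midpoint a b) v a" "moe D = midpoint a b" using D(2) by (rule child_cases)
    obtain v' a' b' where h': "nv F = v'" "{ov1 F, ov2 F} = {a', b'}" "verts F = {v', a', b'}"
      "C' = Tri (midpoint a' b') v' a'" "moe F = midpoint a' b'" using F(2) by (rule child_cases)
    have nn: "moe F \<notin> verts D"
    proof
      assume m: "moe F \<in> verts D"
      then have "moe F \<in> convex hull (verts F \<inter> verts D)"
        using conf_Int[OF U F(1) D(1)] moe_in_oe oe_subset_region verts_subset_region by blast
      then have "{ov1 F, ov2 F} \<subseteq> verts F \<inter> verts D"
        using moe_in_face[of F "verts F \<inter> verts D"] conf_nd[OF U F(1)] by blast
      then have e: "{ov1 D, ov2 D} = {ov1 F, ov2 F}"
        using conf_lab[OF U F(1) D(1)] by auto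
      then have "moe D = moe F" using moe_eq_of_oe_eq oe_eq_iff by metis
      then show False using m moe_notin_verts conf_nd[OF U D(1)] by metis
    qed
    have "v \<noteq> a" using conf_nd[OF U D(1)] h by (auto simp: nd_def)
    moreover have "midpoint a' b' \<noteq> v" "midpoint a' b' \<noteq> a" using nn h h' by auto
    ultimately show ?thesis using s h h' by auto
  qed
  show ?thesis
    unfolding conf_def
  proof (intro conjI ballI impI fin nd)
    fix C C' assume "C \<in> bisect_all U" "C' \<in> bisect_all U"
    then obtain D F where DF: "D \<in> U" "C \<in> children D" "F \<in> U" "C' \<in> children F"
      by (auto simp: bisect_all_def)
    show "region C \<inter> region C' = convex hull (verts C \<inter> verts C')" using main[OF DF] by simp
    show "verts C = verts C' \<Longrightarrow> C = C'" using main[OF DF] by simp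
    show "{ov1 C, ov2 C} \<subseteq> verts C' \<Longrightarrow> {ov1 C', ov2 C'} = {ov1 C, ov2 C}" using lab[OF DF] .
  qed
qed

text \<open>A face of a simplex is the hull of some of its vertices; equality of the two descriptions of
  the common face identifies these vertices, because they are its extreme points.\<close>

lemma conf_initial:
  assumes "initial_mesh \<Omega> T0"
  shows "conf T0"
proof -
  note im = assms[unfolded initial_mesh_def]
  have oes: "e = oe E \<longleftrightarrow> e = oe F" if "E \<in> T0" "F \<in> T0" "e \<in> sides E" "e \<in> sides F" for E F e
  proof -
    have L: "\<forall>E\<in>T0. \<forall>E'\<in>T0. \<forall>e \<in> sides E \<inter> sides E'. e = oe E \<longleftrightarrow> e = oe E'"
      using im by (elim conjE)
    show ?thesis by (rule L[rule_format, OF that(1,2) IntI[OF that(3,4)]])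
  qed
  have nd: "nd E" if "E \<in> T0" for E using im that by (auto simp: nd_def)
  have face: "\<exists>S\<subseteq>verts D. region D \<inter> region F = convex hull S"
    if "D \<in> T0" "region D \<inter> region F face_of region D" for D F
    using that(2) face_of_convex_hull_affine_independent[OF nd_distinct(4)[OF nd[OF that(1)]]]
    by (auto simp: region_def)
  have fo: "region D \<inter> region F face_of region D" if "D \<in> T0" "F \<in> T0" for D F
  proof -
    have "triangulation (region ` T0)" using im by simp
    then have "\<forall>T T'. T \<in> region ` T0 \<and> T' \<in> region ` T0 \<longrightarrow> (T \<inter> T') face_of T"
      unfolding triangulation_def by simp
    then show ?thesis using that by simp
  qed
  have int: "region D \<inter> region F = convex hull (verts D \<inter> verts F)" if DF: "D \<in> T0" "F \<in> T0" for D F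
  proof -
    have "region D \<inter> region F face_of region D" "region D \<inter> region F face_of region F"
      using fo[OF DF] fo[OF DF(2,1)] by (simp_all add: inf_commute)
    then obtain S S' where S: "S \<subseteq> verts D" "region D \<inter> region F = convex hull S"
       "S' \<subseteq> verts F" "region D \<inter> region F = convex hull S'"
      using face DF by (metis inf_commute)
    have i: "\<not> affine_dependent S" "\<not> affine_dependent S'"
      using S nd DF nd_distinct(4) affine_independent_subset by metis+
    have "S = S'"
      using S extreme_point_of_convex_hull_affine_independent[OF i(1)]
        extreme_point_of_convex_hull_affine_independent[OF i(2)] by auto
    then have "S \<subseteq> verts D \<inter> verts F" using S by auto
    then have "region D \<inter> region F \<subseteq> convex hull (verts D \<inter> verts F)" using S hull_mono by metis
    moreover have "convex hull (verts D \<inter> verts F) \<subseteq> region D \<inter> region F"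
      unfolding region_def by (simp add: hull_mono)
    ultimately show ?thesis by blast
  qed
  have inj: "D = F" if "D \<in> T0" "F \<in> T0" "verts D = verts F" for D F
    using im that by (auto simp: inj_on_def region_def)
  have lab: "{ov1 F, ov2 F} = {ov1 D, ov2 D}" 
    if DF: "D \<in> T0" "F \<in> T0" "{ov1 D, ov2 D} \<subseteq> verts F" for D F
  proof -
    have "oe D \<in> sides F"
      using DF(3) nd_distinct[OF nd[OF DF(1)]]
      by (auto simp: sides_def oe_def verts_def closed_segment_commute)
    moreover have "oe D \<in> sides D" by (simp add: sides_def)
    ultimately have "oe D = oe F" using oes[OF DF(1,2)] by metis
    then show ?thesis by (simp add: oe_eq_iff)
  qed
  show ?thesis
    unfolding conf_def
  proof (intro conjI ballI impI)
    show "finite T0" using im by simp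
  qed (fact nd int inj lab)+
qed

section \<open>The bisection forest\<close>

primrec lev :: "mesh \<Rightarrow> nat \<Rightarrow> mesh" where
  "lev T0 0 = T0"
| "lev T0 (Suc k) = bisect_all (lev T0 k)"

declare lev.simps(2) [simp del]

text \<open>Cramer's rule for the vector from the midpoint of the base to a second apex, in the basis formed
  by the base and the median from the first apex.\<close>

lemma bary_line:
  fixes a b v1 v2 :: "real^2"
  defines "e \<equiv> b - a" and "u \<equiv> v1 - midpoint a b"
  assumes s: "e$1 * u$2 - e$2 * u$1 \<noteq> 0"
  obtains \<alpha> where "v2 - midpoint a b = \<alpha> *\<^sub>R e
    + ((e$1 * (v2 - midpoint a b)$2 - e$2 * (v2 - midpoint a b)$1) / (e$1 * u$2 - e$2 * u$1)) *\<^sub>R u"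
proof
  define w where "w = v2 - midpoint a b"
  define d where "d = e$1 * u$2 - e$2 * u$1"
  have d: "d \<noteq> 0" using s by (simp add: d_def)
  have "(w$1 * u$2 - w$2 * u$1) * e$i + (e$1 * w$2 - e$2 * w$1) * u$i = d * w$i" for i
    using exhaust_2[of i] by (auto simp: d_def algebra_simps)
  then have "w = ((w$1 * u$2 - w$2 * u$1) / d) *\<^sub>R e + ((e$1 * w$2 - e$2 * w$1) / d) *\<^sub>R u"
    using d by (simp add: vec_eq_iff add_divide_distrib[symmetric])
  then have "w = ((w$1 * u$2 - w$2 * u$1) / (e$1 * u$2 - e$2 * u$1)) *\<^sub>R e
    + ((e$1 * w$2 - e$2 * w$1) / (e$1 * u$2 - e$2 * u$1)) *\<^sub>R u"
    by (simp only: d_def)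
  then show "v2 - midpoint a b = ((w$1 * u$2 - w$2 * u$1) / (e$1 * u$2 - e$2 * u$1)) *\<^sub>R e
    + ((e$1 * (v2 - midpoint a b)$2 - e$2 * (v2 - midpoint a b)$1) / (e$1 * u$2 - e$2 * u$1)) *\<^sub>R u"
    unfolding w_def .
qed

lemma collinear_if_det_0:
  fixes a b v :: "real^2"
  assumes "(b - a)$1 * (v - midpoint a b)$2 - (b - a)$2 * (v - midpoint a b)$1 = 0"
  shows "collinear {v, a, b}"
proof (cases "b = a")
  case False
  define e w where "e = b - a" and "w = v - a"
  have d: "e$1 * w$2 = e$2 * w$1"
    using assms by (simp add: e_def w_def midpoint_def field_simps)
  have "e \<noteq> 0" using False by (simp add: e_def)
  have "\<exists>c. w = c *\<^sub>R e"
  proof (cases "e$1 = 0")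
    case True
    then have "e$2 \<noteq> 0" using \<open>e \<noteq> 0\<close> by (simp add: vec_eq_iff forall_2)
    then show ?thesis using d True
      by (intro exI[of _ "w$2 / e$2"]) (simp add: vec_eq_iff forall_2 field_simps)
  next
    case False
    then show ?thesis using d
      by (intro exI[of _ "w$1 / e$1"]) (simp add: vec_eq_iff forall_2 field_simps)
  qed
  then have "collinear {0, e, w}" by (auto simp: collinear_lemma)
  then have "collinear {b, a, v}" by (simp add: e_def w_def collinear_3[of b a v])
  then show ?thesis by (simp add: insert_commute)
qed simp

text \<open>If two apices lie on the same side of a common base, both triangles contain a short initial
  piece of the median of the second one.\<close>

lemma same_side_overlap:
  fixes a b v1 v2 :: "real^2"
  assumes nc: "\<not> collinear {v1, a, b}" "\<not> collinear {v2, a, b}"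
    and sgn: "0 < ((b - a)$1 * (v1 - midpoint a b)$2 - (b - a)$2 * (v1 - midpoint a b)$1) *
        ((b - a)$1 * (v2 - midpoint a b)$2 - (b - a)$2 * (v2 - midpoint a b)$1)"
  shows "\<exists>p. p \<in> convex hull {v1, a, b} \<and> p \<in> convex hull {v2, a, b} \<and> p \<notin> convex hull {a, b}"
proof -
  define m where "m = midpoint a b"
  define s where "s = (\<lambda>v. (b - a)$1 * (v - m)$2 - (b - a)$2 * (v - m)$1)"
  have s1: "s v1 \<noteq> 0" and pos: "0 < s v1 * s v2"
    using collinear_if_det_0 nc(1) sgn by (auto simp: s_def m_def)
  then obtain \<alpha> where *: "v2 - m = \<alpha> *\<^sub>R (b - a) + (s v2 / s v1) *\<^sub>R (v1 - m)"
    using bary_line[of b a v1 v2] by (auto simp: s_def m_def)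
  define \<beta> where "\<beta> = s v2 / s v1"
  have b: "\<beta> > 0" using pos by (auto simp: \<beta>_def zero_less_mult_iff divide_pos_pos divide_neg_neg)
  \<comment> \<open>Small enough for the coordinates of \<open>p\<close> below, which start at one half, to stay nonnegative.\<close>
  define \<epsilon> where "\<epsilon> = 1 / (2 * (1 + \<bar>\<alpha>\<bar> + \<beta>))"
  have e: "0 < \<epsilon>" "\<epsilon> \<le> 1" "\<epsilon> * (1 + \<bar>\<alpha>\<bar> + \<beta>) = 1/2"
    using b by (auto simp: \<epsilon>_def field_simps)
  have ea: "\<epsilon> * \<bar>\<alpha>\<bar> + \<epsilon> * \<beta> \<le> 1/2" using e by (simp add: algebra_simps)
  have ea': "\<bar>\<epsilon> * \<alpha>\<bar> = \<epsilon> * \<bar>\<alpha>\<bar>" using e by (simp add: abs_mult)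
  have eb: "0 < \<epsilon> * \<beta>" using e b by simp
  define p where "p = m + \<epsilon> *\<^sub>R (v2 - m)"
  have p2: "p = \<epsilon> *\<^sub>R v2 + ((1 - \<epsilon>)/2) *\<^sub>R a + ((1 - \<epsilon>)/2) *\<^sub>R b"
    by (simp add: p_def m_def midpoint_def vec_eq_iff field_simps)
  have p1: "p = (\<epsilon> * \<beta>) *\<^sub>R v1 + (1/2 - \<epsilon> * \<alpha> - \<epsilon> * \<beta> / 2) *\<^sub>R a + (1/2 + \<epsilon> * \<alpha> - \<epsilon> * \<beta> / 2) *\<^sub>R b"
    unfolding p_def * \<beta>_def[symmetric]
    by (simp add: m_def midpoint_def vec_eq_iff field_simps)
  have "p \<in> convex hull {v1, a, b}"
  proof -
    have "0 \<le> 1/2 - \<epsilon> * \<alpha> - \<epsilon> * \<beta> / 2" "0 \<le> 1/2 + \<epsilon> * \<alpha> - \<epsilon> * \<beta> / 2"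
      using ea ea' eb by linarith+
    then show ?thesis
      using region_TriI[of "\<epsilon> * \<beta>" "1/2 - \<epsilon> * \<alpha> - \<epsilon> * \<beta> / 2" "1/2 + \<epsilon> * \<alpha> - \<epsilon> * \<beta> / 2" p v1 a b] eb p1
      by (simp add: region_def)
  qed
  moreover have "p \<in> convex hull {v2, a, b}"
    using region_TriI[of \<epsilon> "(1 - \<epsilon>)/2" "(1 - \<epsilon>)/2" p v2 a b] e p2
    by (simp add: region_def field_simps)
  moreover have "p \<notin> convex hull {a, b}"
  proof
    assume "p \<in> convex hull {a, b}"
    then obtain x y where xy: "x + y = 1" "p = 0 *\<^sub>R v2 + x *\<^sub>R a + y *\<^sub>R b"
      by (auto simp: convex_hull_2)
    have "\<epsilon> = 0 \<and> (1 - \<epsilon>)/2 = x \<and> (1 - \<epsilon>)/2 = y"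
      by (rule bary_unique[OF nc(2) _ _ trans[OF p2[symmetric] xy(2)]]) (use xy in \<open>simp_all add: field_simps\<close>)
    then show False using e by simp
  qed
  ultimately show ?thesis by blast
qed

lemma verts_ov: "verts D = insert (nv D) {ov1 D, ov2 D}"
  by (simp add: verts_def)

text \<open>Of three triangles with a common edge two lie on the same side of it, and these overlap.\<close>

lemma at_most_two_conf:
  assumes U: "conf U" and D: "D1 \<in> U" "D2 \<in> U" "D3 \<in> U" and oe: "oe D1 = oe D2" "oe D2 = oe D3"
  shows "D1 = D2 \<or> D1 = D3 \<or> D2 = D3"
proof -
  obtain a b where ab: "{ov1 D1, ov2 D1} = {a, b}" by blast
  have V: "verts D1 = {nv D1, a, b}" "verts D2 = {nv D2, a, b}" "verts D3 = {nv D3, a, b}"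
    using oe ab unfolding oe_eq_iff verts_ov by simp_all
  define s where "s = (\<lambda>v. (b - a)$1 * (v - midpoint a b)$2 - (b - a)$2 * (v - midpoint a b)$1)"
  have eq: "D = F" if DF: "D \<in> U" "F \<in> U" "verts D = {nv D, a, b}" "verts F = {nv F, a, b}"
      "0 < s (nv D) * s (nv F)" for D F
  proof (rule ccontr)
    assume ne: "D \<noteq> F"
    have nc: "\<not> collinear {nv D, a, b}" "\<not> collinear {nv F, a, b}"
      using DF(3,4) conf_nd[OF U DF(1)] conf_nd[OF U DF(2)] by (simp_all add: nd_def)
    obtain p where p: "p \<in> region D" "p \<in> region F" "p \<notin> convex hull {a, b}"
      using same_side_overlap[OF nc] DF(3-5) by (auto simp: region_def s_def)
    have "nv D \<noteq> nv F" using conf_inj[OF U DF(1,2)] DF(3,4) ne by auto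
    then have "verts D \<inter> verts F = {a, b}"
      unfolding DF(3,4) using noncollinear_distinct[OF nc(1)] noncollinear_distinct[OF nc(2)] by auto
    then show False using conf_Int[OF U DF(1,2)] p by auto
  qed
  have nz: "s (nv D) \<noteq> 0" if "D \<in> U" "verts D = {nv D, a, b}" for D
    using collinear_if_det_0[of b a "nv D"] conf_nd[OF U that(1)] that(2) by (auto simp: nd_def s_def)
  have "0 < s (nv D1) * s (nv D2) \<or> 0 < s (nv D1) * s (nv D3) \<or> 0 < s (nv D2) * s (nv D3)"
    using nz[OF D(1) V(1)] nz[OF D(2) V(2)] nz[OF D(3) V(3)]
    by (auto simp: zero_less_mult_iff)
  then show ?thesis using eq D V by blast
qed

lemma child_verts:
  assumes "C \<in> children D"
  shows "verts C \<subseteq> insert (moe D) (verts D)" "nv C = moe D" "{ov1 C, ov2 C} \<subseteq> verts D" "nv D \<in> {ov1 C, ov2 C}"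
  using assms by (auto simp: children_def verts_def)

lemma verts_children: "\<Union>(verts ` children D) = insert (moe D) (verts D)"
  by (auto simp: children_def verts_def)

locale labelled =
  fixes T0 :: mesh
  assumes conf0: "conf T0"
begin

abbreviation "U \<equiv> lev T0"

lemma conf_U: "conf (U k)"
  by (induction k) (auto simp: conf0 conf_bisect_all lev.simps(2))

definition forest :: mesh where "forest = (\<Union>k. U k)"

lemma in_forest: "E \<in> U k \<Longrightarrow> E \<in> forest"
  by (auto simp: forest_def)

lemma children_lev: "E \<in> U k \<Longrightarrow> C \<in> children E \<Longrightarrow> C \<in> U (Suc k)"
  by (auto simp: bisect_all_def lev.simps(2))

lemma lev_SucE:
  assumes "C \<in> U (Suc k)" obtains P where "P \<in> U k" "C \<in> children P"
  using assms by (auto simp: bisect_all_def lev.simps(2))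

lemma nodes_Suc: "nodes (U k) \<subseteq> nodes (U (Suc k))"
  using verts_children by (fastforce simp: nodes_def bisect_all_def lev.simps(2))

lemma nodes_mono: "j \<le> k \<Longrightarrow> nodes (U j) \<subseteq> nodes (U k)"
  by (rule lift_Suc_mono_le[of "\<lambda>k. nodes (U k)"]) (rule nodes_Suc)

lemma verts_nodes: "E \<in> U k \<Longrightarrow> verts E \<subseteq> nodes (U k)"
  by (auto simp: nodes_def)

lemma moe_in_nodes: "E \<in> U k \<Longrightarrow> moe E \<in> nodes (U (Suc k))"
  using verts_children[of E] by (fastforce simp: nodes_def bisect_all_def lev.simps(2))

lemma node_vertex:
  assumes "x \<in> nodes (U k)" "G \<in> U k" "x \<in> region G"
  shows "x \<in> verts G"
proof -
  obtain D where D: "D \<in> U k" "x \<in> verts D" using assms by (auto simp: nodes_def)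
  then have "x \<in> convex hull (verts D \<inter> verts G)"
    using conf_Int[OF conf_U D(1) assms(2)] assms(3) verts_subset_region by auto
  then show ?thesis
    using vertex_in_face[OF conf_nd[OF conf_U D(1)], of "verts D \<inter> verts G" x] D by auto
qed

lemma moe_new: "E \<in> U k \<Longrightarrow> moe E \<notin> nodes (U k)"
  using node_vertex moe_notin_verts conf_nd[OF conf_U] moe_in_oe oe_subset_region by blast

text \<open>The midpoint lies in the common face, and only faces containing the whole refinement edge
  contain its midpoint; the labelling then applies.\<close>

lemma contains_moe:
  assumes "E \<in> U k" "D \<in> U k" "moe E \<in> region D"
  shows "oe D = oe E"
proof -
  have "moe E \<in> convex hull (verts E \<inter> verts D)"
    using conf_Int[OF conf_U assms(1,2)] assms(3) moe_in_oe[of E] oe_subset_region[of E] by auto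
  then have "{ov1 E, ov2 E} \<subseteq> verts E \<inter> verts D"
    using moe_in_face[OF conf_nd[OF conf_U assms(1)]] by blast
  then show ?thesis using conf_lab[OF conf_U assms(1,2)] by (simp add: oe_eq_iff)
qed

text \<open>The level at which a midpoint first occurs as a node determines the generation of the triangle
  that it bisects.\<close>

lemma moe_eq:
  assumes "E \<in> U j" "F \<in> U k" "moe E = moe F"
  shows "j = k \<and> oe E = oe F"
proof -
  have "\<not> j < k" if "E \<in> U j" "F \<in> U k" "moe E = moe F" for E F j k
  proof
    assume "j < k"
    then have "moe E \<in> nodes (U k)" using moe_in_nodes[OF that(1)] nodes_mono[of "Suc j" k] by auto
    then show False using moe_new that by metis
  qed
  then have "j = k" using assms by (metis linorder_neqE_nat)
  then show ?thesis
    using contains_moe[of F k E] assms moe_in_oe[of E] oe_subset_region[of E] by auto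
qed

lemma lev_unique: "E \<in> U j \<Longrightarrow> E \<in> U k \<Longrightarrow> j = k"
  using moe_eq by blast

definition gen :: "tri \<Rightarrow> nat" where "gen E = (THE k. E \<in> U k)"

lemma gen_eq: "E \<in> U k \<Longrightarrow> gen E = k"
  unfolding gen_def using lev_unique by blast

lemma lev_gen: "E \<in> forest \<Longrightarrow> E \<in> U (gen E)"
  by (auto simp: forest_def gen_eq)

lemma children_forest: "E \<in> forest \<Longrightarrow> C \<in> children E \<Longrightarrow> C \<in> forest"
  using children_lev in_forest lev_gen by blast

lemma gen_child: "E \<in> forest \<Longrightarrow> C \<in> children E \<Longrightarrow> gen C = Suc (gen E)"
  using children_lev gen_eq lev_gen by blast

lemma parent_unique:
  assumes "D \<in> forest" "F \<in> forest" "C \<in> children D" "C \<in> children F"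
  shows "D = F"
  using parent_unique_conf[OF conf_U, of D "gen D" F C] assms gen_child[of D C] gen_child[of F C] lev_gen
  by (metis Suc_inject)

lemma nv_new: "E \<in> U (Suc k) \<Longrightarrow> nv E \<notin> nodes (U k)"
  by (metis lev_SucE child_verts(2) moe_new)

lemma ov_old: "E \<in> U (Suc k) \<Longrightarrow> {ov1 E, ov2 E} \<subseteq> nodes (U k)"
  by (meson lev_SucE child_verts(3) verts_nodes subset_trans)

lemma at_most_two:
  assumes "D1 \<in> U k" "D2 \<in> U k" "D3 \<in> U k" "oe D1 = oe D2" "oe D2 = oe D3"
  shows "D1 = D2 \<or> D1 = D3 \<or> D2 = D3"
  using at_most_two_conf[OF conf_U assms] .

abbreviation anc :: "tri \<Rightarrow> tri \<Rightarrow> bool" where "anc E D \<equiv> (E, D) \<in> child_rel\<^sup>*"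
abbreviation sanc :: "tri \<Rightarrow> tri \<Rightarrow> bool" where "sanc E D \<equiv> (E, D) \<in> child_rel\<^sup>+"

lemma desc_props:
  assumes "anc E D" "E \<in> forest"
  shows "D \<in> forest" "gen E \<le> gen D" "region D \<subseteq> region E" "E \<noteq> D \<Longrightarrow> gen E < gen D"
proof -
  have "D \<in> forest \<and> gen E \<le> gen D \<and> region D \<subseteq> region E \<and> (E \<noteq> D \<longrightarrow> gen E < gen D)"
    using assms(1)
  proof (induction rule: rtrancl_induct)
    case base then show ?case using assms by auto
  next
    case (step P D)
    then have C: "D \<in> children P" "P \<in> forest" by (auto simp: child_rel_def)
    then show ?case
      using step gen_child[of P D] children_forest[of P D] region_children[of P] by auto
  qed
  then show "D \<in> forest" "gen E \<le> gen D" "region D \<subseteq> region E" "E \<noteq> D \<Longrightarrow> gen E < gen D" by auto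
qed

lemma sanc_gen: "sanc E D \<Longrightarrow> E \<in> forest \<Longrightarrow> gen E < gen D"
proof -
  assume a: "sanc E D" "E \<in> forest"
  then obtain C where "C \<in> children E" "anc C D"
    by (metis (no_types, lifting) case_prodD child_rel_def mem_Collect_eq tranclD)
  then show ?thesis using desc_props(2)[of C D] gen_child[OF a(2)] children_forest[OF a(2)] by force
qed

lemma anc_sanc: "anc E D \<longleftrightarrow> E = D \<or> sanc E D"
  by (auto simp: rtrancl_eq_or_trancl)

lemma anc_step: "anc E D \<Longrightarrow> C \<in> children D \<Longrightarrow> sanc E C"
  by (auto simp: child_rel_def intro: rtrancl_into_trancl1)

lemma sanc_parent:
  assumes "sanc E C" "C \<in> children D" "D \<in> forest" "E \<in> forest"
  shows "anc E D"
proof -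
  from assms(1) obtain P where P: "anc E P" "C \<in> children P"
    by (metis (no_types, lifting) case_prodD child_rel_def mem_Collect_eq tranclD2)
  then have "P = D" using parent_unique assms desc_props(1)[OF P(1) assms(4)] by blast
  then show ?thesis using P by simp
qed

lemma forest_iff: "F \<in> forest \<longleftrightarrow> (\<exists>E\<in>T0. anc E F)"
proof
  have "F \<in> U k \<Longrightarrow> \<exists>E\<in>T0. anc E F" for k
  proof (induction k arbitrary: F)
    case (Suc k)
    then obtain P where P: "P \<in> U k" "F \<in> children P" by (auto elim: lev_SucE)
    then obtain E where "E \<in> T0" "anc E P" using Suc by blast
    then show ?case using anc_step[OF _ P(2)] anc_sanc by blast
  qed auto
  then show "F \<in> forest \<Longrightarrow> \<exists>E\<in>T0. anc E F" by (auto simp: forest_def)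
next
  show "\<exists>E\<in>T0. anc E F \<Longrightarrow> F \<in> forest"
    using desc_props(1) in_forest[of _ 0] by auto
qed

lemma ancestor_at:
  assumes "D \<in> U k" "j \<le> k" obtains A where "A \<in> U j" "anc A D"
proof -
  have "D \<in> U (j + n) \<Longrightarrow> \<exists>A\<in>U j. anc A D" for n
  proof (induction n arbitrary: D)
    case (Suc n)
    then obtain P where P: "P \<in> U (j + n)" "D \<in> children P" by (auto elim: lev_SucE)
    then show ?case using Suc(1)[OF P(1)] anc_step anc_sanc by blast
  qed auto
  then show ?thesis using that assms by (metis le_add_diff_inverse)
qed

text \<open>The forest is a tree order: parents are unique, so the ancestors of a triangle form a chain.\<close>

lemma anc_comparable:
  assumes "anc A' D" "anc A D" "A \<in> forest" "A' \<in> forest" "gen A \<le> gen A'"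
  shows "anc A A'"
  using assms(1,2)
proof (induction rule: rtrancl_induct)
  case (step P D)
  then have P: "D \<in> children P" "P \<in> forest" "gen A' \<le> gen P"
    using desc_props assms(4) by (auto simp: child_rel_def)
  then have "A \<noteq> D" using assms(5) gen_child by fastforce
  then have "sanc A D" using step anc_sanc by blast
  then show ?case using sanc_parent P step assms by blast
qed auto

lemma cover_desc:
  assumes "p \<in> region E" "E \<in> U k" obtains D where "D \<in> U (k + n)" "anc E D" "p \<in> region D"
proof -
  have "\<exists>D\<in>U (k + n). anc E D \<and> p \<in> region D"
  proof (induction n)
    case (Suc n)
    then obtain D where D: "D \<in> U (k + n)" "anc E D" "p \<in> region D" by blast
    then obtain C where "C \<in> children D" "p \<in> region C" using region_children[of D] by blast
    then show ?case using D children_lev[of D "k + n" C] anc_step anc_sanc by (metis add_Suc_right)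
  qed (use assms in auto)
  then show ?thesis using that by blast
qed

section \<open>Refinements\<close>

abbreviation "B \<equiv> bisected T0"

lemma B_iff: "F \<in> B T \<longleftrightarrow> F \<in> forest \<and> (\<exists>D\<in>T. sanc F D)"
  by (auto simp: bisected_def forest_iff)

lemma B_forest: "F \<in> B T \<Longrightarrow> F \<in> forest"
  by (simp add: B_iff)

lemma B_parent: "F \<in> B T \<Longrightarrow> sanc P F \<Longrightarrow> P \<in> forest \<Longrightarrow> P \<in> B T"
  by (auto simp: B_iff intro: trancl_trans)

lemma B_bisect:
  assumes "T \<subseteq> forest" "E \<in> T"
  shows "B (bisect T E) = insert E (B T)"
proof (intro equalityI subsetI)
  fix F assume F: "F \<in> B (bisect T E)"
  then obtain D where D: "F \<in> forest" "D \<in> bisect T E" "sanc F D" by (auto simp: B_iff)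
  show "F \<in> insert E (B T)"
  proof (cases "D \<in> children E")
    case True
    then have "anc F E" using sanc_parent D assms by blast
    then show ?thesis using anc_sanc D(1) assms(2) by (auto simp: B_iff)
  next
    case False
    then show ?thesis using D by (auto simp: B_iff bisect_def)
  qed
next
  fix F assume F: "F \<in> insert E (B T)"
  have C: "Tri (moe E) (nv E) (ov1 E) \<in> children E" by (simp add: children_def)
  have up: "F \<in> B (bisect T E)" if "anc F E" "F \<in> forest"
    using anc_step[OF that(1) C] that C by (auto simp: B_iff bisect_def)
  show "F \<in> B (bisect T E)"
  proof (cases "F = E")
    case True
    then show ?thesis using up assms by auto
  next
    case False
    then obtain D where D: "F \<in> forest" "D \<in> T" "sanc F D" using F by (auto simp: B_iff)
    show ?thesis
    proof (cases "D = E")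
      case True
      then show ?thesis using up D anc_sanc by blast
    next
      case False
      then show ?thesis using D by (auto simp: B_iff bisect_def)
    qed
  qed
qed

text \<open>The leaves of the subforest with inner nodes \<open>X\<close>.\<close>

definition leaves :: "tri set \<Rightarrow> mesh" where
  "leaves X = {L\<in>forest. L \<notin> X \<and> (L \<in> T0 \<or> (\<exists>P\<in>X. L \<in> children P))}"

abbreviation "refs \<equiv> refinements T0"

text \<open>A refinement is recovered from the set of its bisected triangles: its elements are the leaves,
  its nodes are the initial ones and the midpoints, and every bisection adds one element.\<close>

lemma ref_induct_facts:
  assumes "T \<in> refs"
  shows "finite T \<and> T \<subseteq> forest \<and> finite (B T) \<and> card T = card T0 + card (B T) \<and> T = leaves (B T) \<and>
    nodes T = nodes T0 \<union> moe ` B T"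
  using assms
proof (induction rule: refinements.induct)
  case initial
  have "B T0 = {}"
  proof -
    have False if "F \<in> forest" "D \<in> T0" "sanc F D" for F D
      using sanc_gen[OF that(3,1)] gen_eq[of D 0] that(2) by simp
    then show ?thesis by (auto simp: B_iff)
  qed
  moreover have "T0 \<subseteq> forest" using in_forest[of _ 0] by auto
  ultimately show ?case using conf0 by (auto simp: conf_def leaves_def)
next
  case (bisection T E)
  then have fin: "finite T" "T \<subseteq> forest" "finite (B T)" "card T = card T0 + card (B T)"
    and L: "T = leaves (B T)" and N: "nodes T = nodes T0 \<union> moe ` B T" by auto
  have E: "E \<in> forest" "E \<notin> B T" using bisection(2) L by (auto simp: leaves_def)
  have BB: "B (bisect T E) = insert E (B T)" using B_bisect fin(2) bisection(2) by blast
  have gC: "gen C \<noteq> 0" if "C \<in> children E" for C using gen_child E that by simp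
  have g0: "gen C = 0" if "C \<in> T0" for C using that gen_eq[of C 0] by simp
  have CT: "children E \<inter> T = {}"
  proof -
    have False if c: "C \<in> children E" "C \<in> T" for C
    proof -
      have "C \<in> T0 \<or> (\<exists>P\<in>B T. C \<in> children P)" using c(2) L by (auto simp: leaves_def)
      moreover have "C \<notin> T0" using gC[OF c(1)] g0[of C] by auto
      ultimately obtain P where "P \<in> B T" "C \<in> children P" by blast
      then have "P = E" using parent_unique c(1) E B_forest by blast
      then show False using E \<open>P \<in> B T\<close> by simp
    qed
    then show ?thesis by blast
  qed
  have fc: "finite (children E)" and c2: "card (children E) = 2"
    using nd_distinct[OF conf_nd[OF conf_U lev_gen[OF E(1)]]] by (auto simp: children_def)
  have "card (bisect T E) = card (T - {E}) + card (children E)"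
    unfolding bisect_def using fin fc CT by (intro card_Un_disjoint) auto
  also have "\<dots> = card T + 1"
    using c2 bisection(2) fin(1) card_Suc_Diff1[OF fin(1) bisection(2)] by simp
  finally have card: "card (bisect T E) = card T0 + card (B (bisect T E))"
    using BB fin E by simp
  have "L' \<in> leaves (insert E (B T))" if "L' \<in> bisect T E" for L'
  proof (cases "L' \<in> children E")
    case True
    have "L' \<notin> B T" using B_parent[of L' T E] anc_step[of E E L'] True E by auto
    moreover have "L' \<noteq> E" using True gen_child E by fastforce
    ultimately show ?thesis using True E children_forest by (auto simp: leaves_def)
  next
    case False
    then have "L' \<in> leaves (B T)" "L' \<noteq> E" using that L by (auto simp: bisect_def)
    then show ?thesis by (auto simp: leaves_def)
  qed
  moreover have "L' \<in> bisect T E" if "L' \<in> leaves (insert E (B T))" for L'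
    using that L by (auto simp: leaves_def bisect_def)
  ultimately have leaf: "bisect T E = leaves (B (bisect T E))" unfolding BB by blast
  have "nodes (bisect T E) = nodes T \<union> {moe E}"
    using verts_children[of E] bisection(2) by (auto simp: nodes_def bisect_def)
  then have "nodes (bisect T E) = nodes T0 \<union> moe ` B (bisect T E)" unfolding BB N by auto
  moreover have "bisect T E \<subseteq> forest" using fin E children_forest by (auto simp: bisect_def)
  moreover have "finite (bisect T E)" using fin fc by (simp add: bisect_def)
  ultimately show ?case using card leaf fin BB by simp
qed

lemma ref_facts:
  assumes "T \<in> refs"
  shows ref_finite: "finite T" and ref_forest: "E \<in> T \<Longrightarrow> E \<in> forest" and ref_finite_B: "finite (B T)"
    and ref_card: "card T = card T0 + card (B T)"
    and ref_leaf: "E \<in> T \<longleftrightarrow> E \<in> forest \<and> E \<notin> B T \<and> (E \<in> T0 \<or> (\<exists>P\<in>B T. E \<in> children P))"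
    and ref_nodes: "nodes T = nodes T0 \<union> moe ` B T"
    and ref_B_bisect: "E \<in> T \<Longrightarrow> B (bisect T E) = insert E (B T)"
  using ref_induct_facts[OF assms] B_bisect by (auto simp: leaves_def)

lemma leaf_above:
  assumes T: "T \<in> refs" and D: "D \<in> forest" "D \<notin> B T"
  obtains L where "L \<in> T" "anc L D"
proof -
  have "D \<in> U k \<Longrightarrow> D \<notin> B T \<Longrightarrow> \<exists>L\<in>T. anc L D" for k
  proof (induction k arbitrary: D)
    case 0
    then show ?case using ref_leaf[OF T, of D] in_forest[of D 0] by auto
  next
    case (Suc k)
    then obtain P where P: "P \<in> U k" "D \<in> children P" by (auto elim: lev_SucE)
    show ?case
    proof (cases "P \<in> B T")
      case True
      then show ?thesis using ref_leaf[OF T, of D] Suc P in_forest by blast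
    next
      case False
      then show ?thesis using Suc(1)[OF P(1) False] anc_step[OF _ P(2)] anc_sanc by blast
    qed
  qed
  then show ?thesis using that D lev_gen by blast
qed

lemma sanc_leaf: "T \<in> refs \<Longrightarrow> L \<in> T \<Longrightarrow> L' \<in> forest \<Longrightarrow> sanc L' L \<Longrightarrow> L' \<in> B T"
  by (auto simp: B_iff)

lemma leaf_unique:
  assumes T: "T \<in> refs" and L: "L \<in> T" "L' \<in> T" "anc L D" "anc L' D"
  shows "L = L'"
proof -
  have *: "L = L'" if "gen L \<le> gen L'" "L \<in> T" "L' \<in> T" "anc L D" "anc L' D" for L L'
  proof -
    have "anc L L'" using anc_comparable that ref_forest[OF T] by blast
    then show ?thesis using anc_sanc sanc_leaf[OF T, of L' L] ref_leaf[OF T, of L] that by auto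
  qed
  show ?thesis using *[of L L'] *[of L' L] L by (metis nat_le_linear)
qed

lemma below_leaf: "T \<in> refs \<Longrightarrow> L \<in> T \<Longrightarrow> anc L D \<Longrightarrow> D \<notin> B T"
proof
  assume a: "T \<in> refs" "L \<in> T" "anc L D" "D \<in> B T"
  then have "L \<in> B T" using anc_sanc[of L D] B_parent[of D T L] ref_forest[of T L] by auto
  then show False using a ref_leaf[of T L] by auto
qed

section \<open>Proper nodes and the global index\<close>

lemma proper_T0:
  assumes T: "T \<in> refs" and x: "x \<in> nodes T0"
  shows "proper_node T x"
proof -
  have "x \<in> verts G" if "G \<in> T" "x \<in> region G" for G
  proof -
    have "G \<in> U (gen G)" using that ref_forest[OF T] lev_gen by blast
    moreover have "x \<in> nodes (U (gen G))" using x nodes_mono[of 0 "gen G"] by auto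
    ultimately show ?thesis using node_vertex that by blast
  qed
  then show ?thesis using x ref_nodes[OF T] by (auto simp: proper_node_def)
qed

lemma moe_node_iff:
  assumes T: "T \<in> refs" and F: "F \<in> U k"
  shows "moe F \<in> nodes T \<longleftrightarrow> (\<exists>D\<in>U k. oe D = oe F \<and> D \<in> B T)"
proof
  assume "moe F \<in> nodes T"
  moreover have "moe F \<notin> nodes T0" using moe_new[OF F] nodes_mono[of 0 k] by auto
  ultimately obtain D where D: "D \<in> B T" "moe D = moe F" using ref_nodes[OF T] by auto
  then show "\<exists>D\<in>U k. oe D = oe F \<and> D \<in> B T"
    using moe_eq[OF lev_gen F D(2)] B_forest lev_gen by blast
next
  assume "\<exists>D\<in>U k. oe D = oe F \<and> D \<in> B T"
  then show "moe F \<in> nodes T" using ref_nodes[OF T] moe_eq_of_oe_eq by (metis UnCI imageI)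
qed

text \<open>If a triangle \<open>D\<close> at the edge has not been bisected, the element above \<open>D\<close> contains the midpoint,
  but its vertices belong to earlier levels.  Conversely, an element containing the midpoint is
  either finer than the edge, and conformity of its level makes the midpoint a vertex, or it has a
  descendant at the edge, which has not been bisected.\<close>

lemma proper_moe:
  assumes T: "T \<in> refs" and F: "F \<in> U k" "F \<in> B T"
  shows "proper_node T (moe F) \<longleftrightarrow> (\<forall>D\<in>U k. oe D = oe F \<longrightarrow> D \<in> B T)"
proof
  assume p: "proper_node T (moe F)"
  show "\<forall>D\<in>U k. oe D = oe F \<longrightarrow> D \<in> B T"
  proof (intro ballI impI, rule ccontr)
    fix D assume D: "D \<in> U k" "oe D = oe F" "D \<notin> B T"
    then obtain L where L: "L \<in> T" "anc L D" using leaf_above[OF T] in_forest by blast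
    have fL: "L \<in> forest" using ref_forest[OF T] L by blast
    have "moe F \<in> region L"
      using desc_props(3)[OF L(2) fL] moe_in_oe[of F] oe_subset_region[of D] D by auto
    then have "moe F \<in> verts L" using p L by (auto simp: proper_node_def)
    moreover have "gen L \<le> k" using desc_props(2)[OF L(2) fL] gen_eq D by auto
    ultimately have "moe F \<in> nodes (U k)"
      using verts_nodes[OF lev_gen[OF fL]] nodes_mono[of "gen L" k] by auto
    then show False using moe_new F by blast
  qed
next
  assume all: "\<forall>D\<in>U k. oe D = oe F \<longrightarrow> D \<in> B T"
  have "moe F \<in> verts G" if G: "G \<in> T" "moe F \<in> region G" for G
  proof (cases "gen G \<le> k")
    case False
    then have "moe F \<in> nodes (U (gen G))"
      using moe_in_nodes[OF F(1)] nodes_mono[of "Suc k" "gen G"] by auto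
    then show ?thesis using node_vertex G lev_gen ref_forest[OF T] by blast
  next
    case True
    then obtain D where D: "D \<in> U k" "anc G D" "moe F \<in> region D"
      using cover_desc[OF G(2) lev_gen, of "k - gen G"] ref_forest[OF T G(1)] by auto
    then have "D \<in> B T" using contains_moe[OF F(1)] all by blast
    then show ?thesis using below_leaf[OF T G(1) D(2)] by blast
  qed
  then show "proper_node T (moe F)" using F ref_nodes[OF T] by (auto simp: proper_node_def)
qed

lemma B_verts_nodes:
  assumes T: "T \<in> refs" and F: "F \<in> B T"
  shows "verts F \<subseteq> nodes T"
proof (cases "gen F")
  case 0
  then show ?thesis using lev_gen[OF B_forest[OF F]] verts_nodes[of F 0] ref_nodes[OF T] by auto
next
  case (Suc k)
  have "F \<in> U k \<Longrightarrow> F \<in> B T \<Longrightarrow> verts F \<subseteq> nodes T" for F k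
  proof (induction k arbitrary: F)
    case 0
    then show ?case using verts_nodes[of F 0] ref_nodes[OF T] by auto
  next
    case (Suc k)
    then obtain P where P: "P \<in> U k" "F \<in> children P" by (auto elim: lev_SucE)
    then have "P \<in> B T" using B_parent[OF Suc(3)] anc_step[of P P F] in_forest by blast
    then have "verts P \<subseteq> nodes T" "moe P \<in> nodes T" using Suc P ref_nodes[OF T] by auto
    then show ?case using child_verts(1)[OF P(2)] by auto
  qed
  then show ?thesis using F lev_gen B_forest by blast
qed

lemma ov_in_nodes: "T \<in> refs \<Longrightarrow> F \<in> B T \<or> F \<in> T \<Longrightarrow> ov1 F \<in> nodes T \<and> ov2 F \<in> nodes T"
  using B_verts_nodes[of T F] ov_subset_verts[of F] by (auto simp: nodes_def)

lemma node_cases: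
  assumes "T \<in> refs" "x \<in> nodes T"
  obtains "x \<in> nodes T0" | F where "F \<in> B T" "x = moe F"
  using assms ref_nodes by blast

text \<open>The ends of a refinement edge are older than its midpoint, which makes the recursion for the
  global index well-founded.\<close>

lemma node_induct [consumes 2, case_names old moe]:
  assumes T: "T \<in> refs" and x: "x \<in> nodes T"
    and old: "\<And>x. x \<in> nodes T0 \<Longrightarrow> P x"
    and moe: "\<And>F. F \<in> B T \<Longrightarrow> P (ov1 F) \<Longrightarrow> P (ov2 F) \<Longrightarrow> P (moe F)"
  shows "P x"
proof -
  have "x \<in> nodes T \<Longrightarrow> x \<in> nodes (U k) \<Longrightarrow> P x" for k
  proof (induction k arbitrary: x rule: less_induct)
    case (less k)
    from T less(2) show ?case
    proof (cases rule: node_cases)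
      case (2 F)
      have F: "F \<in> U (gen F)" using 2 B_forest lev_gen by blast
      have "gen F < k"
        using moe_new[OF F] nodes_mono[of k "gen F"] less(3) 2(2) by (metis not_less subsetD)
      moreover have "ov1 F \<in> nodes (U (gen F))" "ov2 F \<in> nodes (U (gen F))"
        using verts_nodes[OF F] ov_subset_verts[of F] by auto
      ultimately show ?thesis using moe[OF 2(1)] less(1) ov_in_nodes[OF T] 2 by blast
    qed (use old in blast)
  qed
  moreover have "\<exists>k. x \<in> nodes (U k)"
    using T x
  proof (cases rule: node_cases)
    case 1 then show ?thesis by (intro exI[of _ 0]) simp
  next
    case (2 F) then show ?thesis using moe_in_nodes[OF lev_gen[OF B_forest]] by blast
  qed
  ultimately show ?thesis using x by blast
qed

text \<open>Different triangles with the same midpoint have the same refinement edge, so the parents of a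
  hanging node are unambiguous.\<close>

lemma has_index_unique:
  assumes T: "T \<in> refs"
  shows "has_index T0 T x n \<Longrightarrow> has_index T0 T x m \<Longrightarrow> n = m"
proof (induction arbitrary: m rule: has_index.induct)
  case (proper x)
  from proper(2,1) show ?case by cases (auto simp: hanging_node_def)
next
  case (hanging x F i j)
  note hyp = hanging.hyps and IH = hanging.IH
  from hanging.prems show ?case
  proof cases
    case proper
    then show ?thesis using hyp(1) by (simp add: hanging_node_def)
  next
    case inner: (hanging F' i' j')
    have "oe F = oe F'"
      using moe_eq[OF lev_gen[OF B_forest[OF hyp(2)]] lev_gen[OF B_forest[OF inner(3)]]] hyp(3) inner(4) by simp
    then have "(ov1 F' = ov1 F \<and> ov2 F' = ov2 F) \<or> (ov1 F' = ov2 F \<and> ov2 F' = ov1 F)"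
      by (auto simp: oe_eq_iff doubleton_eq_iff)
    then have "max i j = max i' j'"
    proof
      assume "ov1 F' = ov1 F \<and> ov2 F' = ov2 F"
      then have "i = i'" "j = j'" using IH(1)[of i'] IH(2)[of j'] inner by auto
      then show ?thesis by simp
    next
      assume "ov1 F' = ov2 F \<and> ov2 F' = ov1 F"
      then have "i = j'" "j = i'" using IH(1)[of j'] IH(2)[of i'] inner by auto
      then show ?thesis by (simp add: max.commute)
    qed
    then show ?thesis using inner by simp
  qed
qed

lemma has_index_exists:
  assumes T: "T \<in> refs" and "x \<in> nodes T"
  shows "\<exists>n. has_index T0 T x n"
  using assms
proof (induction rule: node_induct)
  case (old x)
  then show ?case using proper_T0[OF T] has_index.proper by blast
next
  case (moe F)
  show ?case
  proof (cases "proper_node T (moe F)")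
    case True then show ?thesis using has_index.proper by blast
  next
    case False
    then have "hanging_node T (moe F)" using moe ref_nodes[OF T] by (auto simp: hanging_node_def)
    then show ?thesis using has_index.hanging moe by blast
  qed
qed

abbreviation "lam \<equiv> global_index T0"

lemma lam_eq: "T \<in> refs \<Longrightarrow> has_index T0 T x n \<Longrightarrow> lam T x = n"
  unfolding global_index_def using has_index_unique by blast

lemma lam_proper: "T \<in> refs \<Longrightarrow> proper_node T x \<Longrightarrow> lam T x = 0"
  using lam_eq has_index.proper by blast

lemma lam_hanging:
  assumes T: "T \<in> refs" and F: "F \<in> B T" "\<not> proper_node T (moe F)"
  shows "lam T (moe F) = max (lam T (ov1 F)) (lam T (ov2 F)) + 1"
proof -
  obtain i j where ij: "has_index T0 T (ov1 F) i" "has_index T0 T (ov2 F) j"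
    using has_index_exists[OF T] ov_in_nodes[OF T] F by blast
  have "hanging_node T (moe F)" using F ref_nodes[OF T] by (auto simp: hanging_node_def)
  then show ?thesis using has_index.hanging[OF _ F(1) refl ij] lam_eq[OF T] ij by simp
qed

lemma lam_moe_le:
  assumes "T \<in> refs" "F \<in> B T"
  shows "lam T (moe F) \<le> max (lam T (ov1 F)) (lam T (ov2 F)) + 1"
  using assms lam_proper lam_hanging by (cases "proper_node T (moe F)") auto

text \<open>Further bisections make nodes proper but never the converse, so indices cannot grow.\<close>

lemma lam_mono:
  assumes T: "T \<in> refs" "T' \<in> refs" and sub: "B T \<subseteq> B T'" and "x \<in> nodes T"
  shows "lam T' x \<le> lam T x"
  using T(1) \<open>x \<in> nodes T\<close>
proof (induction rule: node_induct)
  case (old x)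
  then show ?case using proper_T0 lam_proper T by simp
next
  case (moe F)
  show ?case
  proof (cases "proper_node T' (moe F)")
    case True then show ?thesis using lam_proper T by simp
  next
    case False
    have F: "F \<in> U (gen F)" using moe B_forest lev_gen by blast
    have "\<not> proper_node T (moe F)"
      using False proper_moe[OF T(1) F] proper_moe[OF T(2) F] moe sub by blast
    then show ?thesis using moe lam_hanging[OF T(1)] lam_hanging[OF T(2)] False sub by fastforce
  qed
qed

end

section \<open>Facing elements\<close>

text \<open>Halving a refinement edge takes two bisections; this relates a triangle to the grandchild whose
  refinement edge is one half of its own.\<close>

inductive_set half :: "(tri \<times> tri) set" where
  half1: "(Tri v a b, Tri (midpoint v a) (midpoint a b) a) \<in> half"
| half2: "(Tri v a b, Tri (midpoint v b) (midpoint a b) b) \<in> half"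

context labelled
begin

lemma half_anc: "(Q, X) \<in> half \<Longrightarrow> \<exists>C\<in>children Q. X \<in> children C"
  by (induction rule: half.induct) (auto simp: children_def)

lemma half_oe: "(Q, X) \<in> half \<Longrightarrow> oe X \<subseteq> oe Q"
proof (induction rule: half.induct)
  case (half1 v a b)
  then show ?case by (simp add: oe_def closed_segment_subset midpoint_in_closed_segment)
next
  case (half2 v a b)
  then show ?case by (simp add: oe_def closed_segment_subset midpoint_in_closed_segment)
qed

lemma half_ends:
  assumes "(Q, X) \<in> half"
  shows "ov1 X = moe Q \<and> ov2 X \<in> {ov1 Q, ov2 Q}"
  using assms by (induction rule: half.induct) auto

lemma halves_anc: "(Q, X) \<in> half\<^sup>* \<Longrightarrow> anc Q X"
proof (induction rule: rtrancl_induct)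
  case (step X Y)
  then obtain C where "C \<in> children X" "Y \<in> children C" using half_anc by blast
  then have "(X, C) \<in> child_rel" "(C, Y) \<in> child_rel" by (auto simp: child_rel_def)
  then show ?case using step by (meson rtrancl.rtrancl_into_rtrancl)
qed auto

lemma halves_oe: "(Q, X) \<in> half\<^sup>* \<Longrightarrow> oe X \<subseteq> oe Q"
  by (induction rule: rtrancl_induct) (use half_oe in blast)+

lemma child_nv_oe: "C \<in> children G \<Longrightarrow> nv G \<in> oe C"
  using child_verts(4)[of C G] by (auto simp: oe_def)

text \<open>Let \<open>E\<close> and \<open>E'\<close> lie on the two sides of an edge, and let \<open>G\<close> be an ancestor of \<open>E'\<close> only.  If \<open>G\<close> is
  neither \<open>E'\<close> nor its parent, the newest vertices of both parents are the same midpoint, so the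
  edge is half of the refinement edge of both grandparents, and the argument repeats two
  generations above.  It ends with a pair \<open>Q\<close>, \<open>Q'\<close> at a common refinement edge such that \<open>Q'\<close> is \<open>G\<close> or
  a child of \<open>G\<close>; these are the compatible and the incompatible case of a chain.\<close>

lemma face_structure:
  assumes "E \<in> U k" "E' \<in> U k" "E \<noteq> E'" "oe E = oe E'" "anc G E'" "G \<in> forest" "\<not> anc G E"
  shows "\<exists>Q Q' j. Q \<in> U j \<and> Q' \<in> U j \<and> Q \<noteq> Q' \<and> oe Q = oe Q' \<and> (Q, E) \<in> half\<^sup>* \<and>
    (Q' = G \<or> Q' \<in> children G)"
  using assms(1-5,7)
proof (induction k arbitrary: E E' rule: less_induct)
  case (less k)
  note E = less(2) and E' = less(3) and ne = less(4) and oe = less(5) and GE' = less(6) and nG = less(7)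
  show ?case
  proof (cases "G = E'")
    case True
    then show ?thesis using E E' ne oe by blast
  next
    case False
    then have s: "sanc G E'" using GE' anc_sanc by auto
    then have "gen G < k" using sanc_gen[OF _ assms(6)] gen_eq[OF E'] by auto
    then obtain l where k: "k = Suc l" by (cases k) auto
    obtain P' where P': "P' \<in> U l" "E' \<in> children P'" using E' k by (blast elim: lev_SucE)
    obtain P where P: "P \<in> U l" "E \<in> children P" using E k by (blast elim: lev_SucE)
    have GP': "anc G P'" using sanc_parent[OF s P'(2) in_forest[OF P'(1)] assms(6)] .
    show ?thesis
    proof (cases "G = P'")
      case True
      then show ?thesis using E E' ne oe P' by blast
    next
      case False
      then have s: "sanc G P'" using GP' anc_sanc by auto
      then have "gen G < l" using sanc_gen[OF _ assms(6)] gen_eq[OF P'(1)] by auto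
      then obtain i where l: "l = Suc i" by (cases l) auto
      obtain Q' where Q': "Q' \<in> U i" "P' \<in> children Q'" using P' l by (blast elim: lev_SucE)
      obtain Q where Q: "Q \<in> U i" "P \<in> children Q" using P l by (blast elim: lev_SucE)
      have GQ': "anc G Q'" using sanc_parent[OF s Q'(2) in_forest[OF Q'(1)] assms(6)] .
      have eq: "{ov1 E, ov2 E} = {ov1 E', ov2 E'}" using oe by (simp add: oe_eq_iff)
      obtain v a b where h: "nv P = v" "{ov1 P, ov2 P} = {a, b}" "E = Tri (midpoint a b) v a"
        using P(2) by (rule child_cases)
      obtain v' a' b' where h': "nv P' = v'" "{ov1 P', ov2 P'} = {a', b'}" "E' = Tri (midpoint a' b') v' a'"
        using P'(2) by (rule child_cases)
      have "{v, a} = {v', a'}" using eq h h' by simp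
      moreover have "v \<notin> nodes (U i)" using nv_new P(1) l h(1) by blast
      moreover have "a' \<in> nodes (U i)" using ov_old P'(1) l h'(2) by blast
      ultimately have va: "v = v'" "a = a'" by (auto simp: doubleton_eq_iff)
      have "moe Q = v" "moe Q' = v'" using Q Q' h h' child_verts(2) by metis+
      then have oeQ: "oe Q = oe Q'" using moe_eq[OF Q(1) Q'(1)] va by simp
      have nGQ: "\<not> anc G Q"
      proof
        assume "anc G Q"
        then have "anc G P" using anc_step Q(2) anc_sanc by blast
        then show False using anc_step P(2) anc_sanc nG by blast
      qed
      then have QQ: "Q \<noteq> Q'" using GQ' by blast
      obtain u o1 o2 where q: "nv Q = u" "{ov1 Q, ov2 Q} = {o1, o2}" "verts Q = {u, o1, o2}"
          "P = Tri (midpoint o1 o2) u o1" using Q(2) by (rule child_cases)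
      have aQ: "a \<in> {u, o1}" using h(2) q(4) by (auto simp: doubleton_eq_iff)
      have "a \<in> verts Q'" using h'(2) va child_verts(3)[OF Q'(2)] by blast
      have "a \<noteq> u"
      proof
        assume "a = u"
        then have "verts Q \<subseteq> verts Q'"
          using \<open>a \<in> verts Q'\<close> q oeQ ov_subset_verts[of Q'] by (auto simp: oe_eq_iff)
        moreover have "card (verts Q) = card (verts Q')"
          using nd_distinct(5) conf_nd[OF conf_U Q(1)] conf_nd[OF conf_U Q'(1)] by simp
        ultimately have "verts Q = verts Q'" by (simp add: card_subset_eq)
        then show False using conf_inj[OF conf_U Q(1) Q'(1)] QQ by blast
      qed
      then have a: "a = o1" "b = u" using aQ h(2) q(4) by (auto simp: doubleton_eq_iff)
      have "E = Tri (midpoint u o1) (midpoint o1 o2) o1"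
        using h(3) a h(1) q(4) by (simp add: midpoint_sym)
      moreover have "Q = Tri u o1 o2 \<or> Q = Tri u o2 o1"
        using q(1,2) by (cases Q) (auto simp: doubleton_eq_iff)
      ultimately have "(Q, E) \<in> half"
        using half1[of u o1 o2] half2[of u o2 o1] by (auto simp: midpoint_sym)
      moreover obtain R R' j where R: "R \<in> U j" "R' \<in> U j" "R \<noteq> R'" "oe R = oe R'" "(R, Q) \<in> half\<^sup>*"
          "R' = G \<or> R' \<in> children G"
        using less(1)[of i Q Q'] k l Q(1) Q'(1) QQ oeQ GQ' nGQ by auto
      ultimately have "(R, E) \<in> half\<^sup>*" by simp
      then show ?thesis using R by blast
    qed
  qed
qed

lemma nv_notin_line: "nd E \<Longrightarrow> nv E \<notin> affine hull (oe E)"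
proof
  assume nd: "nd E" and "nv E \<in> affine hull (oe E)"
  then have "nv E \<in> affine hull {ov1 E, ov2 E}" by (simp add: oe_hull)
  then have "collinear {ov1 E, ov2 E, nv E}" by (rule affine_hull_3_imp_collinear)
  then show False using nd by (simp add: nd_def verts_def insert_commute)
qed

lemma region_Int_line:
  assumes nd: "nd E" shows "region E \<inter> affine hull (oe E) = oe E"
proof (intro equalityI subsetI)
  fix p assume p: "p \<in> region E \<inter> affine hull (oe E)"
  obtain v a b where E: "E = Tri v a b" by (cases E)
  have nc: "\<not> collinear {v, a, b}" using nd E by (simp add: nd_def)
  obtain x y z where c: "0 \<le> x" "0 \<le> y" "0 \<le> z" "x + y + z = 1" "p = x *\<^sub>R v + y *\<^sub>R a + z *\<^sub>R b"
    using p unfolding E by (auto elim: region_TriE)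
  have "p \<in> affine hull {a, b}" using p by (simp add: E oe_hull)
  then obtain r t where rt: "r + t = 1" "p = 0 *\<^sub>R v + r *\<^sub>R a + t *\<^sub>R b"
    by (auto simp: affine_hull_2)
  have "x = 0 \<and> y = r \<and> z = t"
    by (rule bary_unique[OF nc _ _ trans[OF c(5)[symmetric] rt(2)]]) (use c(4) rt(1) in simp_all)
  then show "p \<in> oe E" using c by (auto simp: E oe_hull convex_hull_2)
next
  show "p \<in> region E \<inter> affine hull (oe E)" if "p \<in> oe E" for p
    using that oe_subset_region[of E] hull_inc[of p "oe E" affine] by auto
qed

lemma oe_same_line:
  assumes "oe E \<subseteq> oe Q" "ov1 E \<noteq> ov2 E" 
  shows "affine hull (oe E) = affine hull (oe Q)"
proof -
  have "ov1 E \<in> affine hull {ov1 Q, ov2 Q}" "ov2 E \<in> affine hull {ov1 Q, ov2 Q}"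
    using assms(1) convex_hull_subset_affine_hull[of "{ov1 Q, ov2 Q}"]
    by (auto simp: oe_def segment_convex_hull hull_inc subset_iff)
  then have sub: "affine hull {ov1 E, ov2 E} \<subseteq> affine hull {ov1 Q, ov2 Q}"
    by (simp add: hull_minimal)
  have "aff_dim {ov1 Q, ov2 Q} \<le> aff_dim {ov1 E, ov2 E}"
    using assms(2) by (simp add: aff_dim_2)
  then have "affine hull {ov1 E, ov2 E} = affine hull {ov1 Q, ov2 Q}"
    using sub aff_dim_psubset[of "{ov1 E, ov2 E}" "{ov1 Q, ov2 Q}"] by force
  then show ?thesis by (simp add: oe_hull)
qed

lemma shared_face:
  assumes D: "D \<in> U k" "F \<in> U k" "D \<noteq> F" and Q: "Q \<in> forest" "{ov1 Q, ov2 Q} \<subseteq> verts D \<inter> verts F"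
  shows "region D \<inter> region F = oe Q"
proof -
  have "card {ov1 Q, ov2 Q} = 2"
    using nd_distinct[OF conf_nd[OF conf_U lev_gen[OF Q(1)]]] by simp
  then have "{ov1 Q, ov2 Q} = verts D \<inter> verts F"
    using common_verts_collinear(2)[OF conf_U D] Q(2) by (intro card_seteq) auto
  then show ?thesis using conf_Int[OF conf_U D(1,2)] by (simp add: oe_hull)
qed

lemma compatible_sym: "compatible E F \<longleftrightarrow> compatible F E"
  unfolding compatible_def adjacent_def by (metis Int_commute Un_commute)

text \<open>The facing element is the element above the triangle on the other side of the edge, since this
  triangle is not bisected as long as the midpoint is not a node.  All edges involved lie on one
  line, which decides about compatibility.\<close>

lemma facing_props:
  assumes T: "T \<in> refs" and E: "E \<in> T" "moe E \<notin> nodes T" and E': "E' \<in> U (gen E)" "E' \<noteq> E" "oe E' = oe E"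
  obtains G Q Q' j where "facing T E = G" "G \<in> T" "G \<noteq> E" "Q \<in> U j" "Q' \<in> U j" "Q \<noteq> Q'" "oe Q = oe Q'"
    "(Q, E) \<in> half\<^sup>*" "\<not> anc G E"
    "(Q' = G \<and> compatible E G) \<or> (Q' \<in> children G \<and> \<not> compatible E G \<and> facing_child G E = Q')"
proof -
  have fE: "E \<in> forest" using E ref_forest[OF T] by blast
  have Ek: "E \<in> U (gen E)" using fE lev_gen by blast
  have E'B: "E' \<notin> B T" using moe_node_iff[OF T Ek] E(2) E' by blast
  obtain G where G: "G \<in> T" "anc G E'" using leaf_above[OF T in_forest[OF E'(1)] E'B] .
  have fG: "G \<in> forest" using ref_forest[OF T G(1)] .
  have nG: "\<not> anc G E"
  proof
    assume "anc G E"
    then have "G = E" using leaf_unique[OF T G(1) E(1)] by blast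
    then show False using desc_props(4)[OF G(2)] fE E' gen_eq[OF E'(1)] by force
  qed
  obtain Q Q' j where Q: "Q \<in> U j" "Q' \<in> U j" "Q \<noteq> Q'" "oe Q = oe Q'" "(Q, E) \<in> half\<^sup>*"
      and Q': "Q' = G \<or> Q' \<in> children G"
    using face_structure[OF Ek E'(1) E'(2)[symmetric] E'(3)[symmetric] G(2) fG nG] by blast
  have ndE: "nd E" and ndG: "nd G" and ndQ': "nd Q'"
    using conf_nd[OF conf_U] Ek lev_gen[OF fG] Q(2) by blast+
  have QE: "anc Q E" using halves_anc Q by blast
  have fQ: "Q \<in> forest" using in_forest[OF Q(1)] .
  have RE: "region E \<subseteq> region Q" using desc_props(3)[OF QE fQ] .
  have oeE: "oe E \<subseteq> oe Q" using halves_oe Q by blast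
  have line: "affine hull (oe E) = affine hull (oe Q)"
    using oe_same_line[OF oeE] nd_distinct[OF ndE] by blast
  have oeQ: "{ov1 Q, ov2 Q} = {ov1 Q', ov2 Q'}" using Q(4) oe_eq_iff by blast
  have RG: "region Q' \<subseteq> region G" using Q' region_children[of G] by blast
  obtain R where R: "region E \<subseteq> region R" "region R \<inter> region G = oe Q"
  proof (cases "Q' = G")
    case True
    then have "region Q \<inter> region G = oe Q"
      using shared_face[OF Q(1,2,3) fQ] ov_subset_verts[of Q] ov_subset_verts[of Q'] oeQ by auto
    then show ?thesis using that RE by blast
  next
    case False
    then have c: "Q' \<in> children G" using Q' by blast
    have j: "j = Suc (gen G)" using gen_child[OF fG c] gen_eq[OF Q(2)] by simp
    obtain P where P: "P \<in> U (gen G)" "Q \<in> children P" using Q(1) unfolding j by (rule lev_SucE)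
    have "P \<noteq> G"
    proof
      assume "P = G"
      then have "anc G Q" using P anc_step[of G G Q] anc_sanc by blast
      then show False using QE nG by (meson rtrancl_trans)
    qed
    moreover have "{ov1 Q, ov2 Q} \<subseteq> verts P \<inter> verts G"
      using child_verts(3)[OF P(2)] child_verts(3)[OF c] oeQ by simp
    ultimately have "region P \<inter> region G = oe Q"
      using shared_face[OF P(1) lev_gen[OF fG] _ fQ] by blast
    moreover have "region E \<subseteq> region P" using RE region_children[of P] P(2) by blast
    ultimately show ?thesis using that by blast
  qed
  have EG: "region E \<inter> region G = oe E"
  proof (intro equalityI subsetI)
    fix p assume p: "p \<in> region E \<inter> region G"
    then have "p \<in> oe Q" using R by blast
    then have "p \<in> affine hull (oe E)" using line hull_inc by metis
    then show "p \<in> oe E" using region_Int_line[OF ndE] p by blast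
  next
    fix p assume "p \<in> oe E"
    then show "p \<in> region E \<inter> region G"
      using oe_subset_region[of E] oeE Q(4) oe_subset_region[of Q'] RG by blast
  qed
  have GE: "G \<noteq> E" using nG by blast
  have adj: "adjacent E G" using EG by (simp add: adjacent_def sides_def)
  have fac: "facing T E = G"
    unfolding facing_def
  proof (rule the_equality)
    show "G \<in> T \<and> G \<noteq> E \<and> adjacent E G \<and> region E \<inter> region G = oe E" using G GE adj EG by blast
  next
    fix F assume F: "F \<in> T \<and> F \<noteq> E \<and> adjacent E F \<and> region E \<inter> region F = oe E"
    have fF: "F \<in> forest" using F ref_forest[OF T] by blast
    have m: "moe E \<in> region F" using F moe_in_oe[of E] by blast
    have part: "D = E \<or> D = E'" if "D \<in> U (gen E)" "moe E \<in> region D" for D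
    proof -
      have "oe D = oe E" using contains_moe[OF Ek that] .
      then have "D = E \<or> D = E' \<or> E = E'"
        by (intro at_most_two[OF that(1) Ek E'(1)]) (simp_all add: E'(3))
      then show ?thesis using E'(2) by blast
    qed
    show "F = G"
    proof (cases "gen F \<le> gen E")
      case True
      obtain D where D: "D \<in> U (gen F + (gen E - gen F))" "anc F D" "moe E \<in> region D"
        using m lev_gen[OF fF] by (rule cover_desc)
      then have "D = E \<or> D = E'" using part True by simp
      moreover have "D \<noteq> E" using leaf_unique[OF T _ E(1), of F E] D F by auto
      ultimately show ?thesis using leaf_unique[OF T, of F G E'] D F G by auto
    next
      case False
      obtain D where D: "D \<in> U (gen E)" "anc D F"
        using ancestor_at[OF lev_gen[OF fF], of "gen E"] False by auto
      then have "D = E \<or> D = E'"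
        using part[OF D(1)] desc_props(3)[OF D(2) in_forest[OF D(1)]] m by blast
      moreover have "sanc D F" using D False gen_eq anc_sanc by (metis nat_le_linear)
      then have "D \<in> B T" using sanc_leaf[OF T, of F D] F in_forest[OF D(1)] by blast
      ultimately show ?thesis using E'B ref_leaf[OF T, of E] E by blast
    qed
  qed
  show ?thesis
  proof (cases "Q' = G")
    case True
    have "nv G \<notin> affine hull (oe E)" using nv_notin_line[OF ndG] line Q(4) True by simp
    then have "compatible E G"
      unfolding compatible_def EG using adj nv_notin_line[OF ndE] by blast
    then show ?thesis using that[OF fac G(1) GE Q nG] True by blast
  next
    case False
    then have c: "Q' \<in> children G" using Q' by blast
    have "nv G \<in> affine hull (oe E)"
      using child_nv_oe[OF c] line Q(4) hull_inc by metis
    then have nc: "\<not> compatible E G" unfolding compatible_def EG by blast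
    have "facing_child G E = Q'"
      unfolding facing_child_def
    proof (rule the_equality)
      have "oe E \<subseteq> region Q'" using oeE Q(4) oe_subset_region[of Q'] by blast
      then have "region E \<inter> region Q' = oe E" using EG RG oe_subset_region[of E] by auto
      then show "Q' \<in> children G \<and> region E \<inter> region Q' = oe E" using c by simp
    next
      fix C assume C: "C \<in> children G \<and> region E \<inter> region C = oe E"
      show "C = Q'"
      proof (rule ccontr)
        assume ne: "C \<noteq> Q'"
        have j: "j = Suc (gen G)" using gen_child[OF fG c] gen_eq[OF Q(2)] by simp
        have Cj: "C \<in> U j" using children_lev[OF lev_gen[OF fG]] C j by blast
        have "\<not> {ov1 Q', ov2 Q'} \<subseteq> verts C"
        proof
          assume "{ov1 Q', ov2 Q'} \<subseteq> verts C"
          then have "oe C = oe Q'" using conf_lab[OF conf_U Q(2) Cj] by (simp add: oe_eq_iff)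
          then have "C = Q' \<or> C = Q \<or> Q' = Q"
            by (rule at_most_two[OF Cj Q(2) Q(1) _ Q(4)[symmetric]])
          then have "C = Q" using Q(3) ne by blast
          then have "anc G Q" using C anc_step[of G G Q] anc_sanc by blast
          then show False using QE nG by (meson rtrancl_trans)
        qed
        then obtain x where x: "verts C \<inter> {ov1 Q', ov2 Q'} \<subseteq> {x}" by auto
        have "oe E \<subseteq> region Q' \<inter> region C \<inter> oe Q'"
          using oeE Q(4) oe_subset_region[of Q'] C by blast
        also have "\<dots> = convex hull (verts Q' \<inter> verts C) \<inter> convex hull {ov1 Q', ov2 Q'}"
          using conf_Int[OF conf_U Q(2) Cj] by (simp add: oe_hull)
        also have "\<dots> = convex hull (verts Q' \<inter> verts C \<inter> {ov1 Q', ov2 Q'})"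
          by (rule hull_Int_faces[OF ndQ']) (use ov_subset_verts in auto)
        also have "\<dots> \<subseteq> convex hull {x}" using x by (intro hull_mono) auto
        finally have "oe E \<subseteq> {x}" by simp
        then have "ov1 E = ov2 E" unfolding oe_def by (metis ends_in_segment singletonD subsetD)
        then show False using nd_distinct[OF ndE] by blast
      qed
    qed
    then show ?thesis using that[OF fac G(1) GE Q nG] c nc by blast
  qed
qed

section \<open>Chains preserve admissibility\<close>

text \<open>The midpoint of the refinement edge of \<open>X\<close>, if hanging, has index \<open>mu T X + 1\<close>.\<close>

definition mu :: "mesh \<Rightarrow> tri \<Rightarrow> nat" where
  "mu T X = max (lam T (ov1 X)) (lam T (ov2 X))"

text \<open>The midpoints of the edges in a chain of halvings lie on a side of the undivided triangle \<open>G\<close> and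
  are hanging, each with an index one larger than that of the preceding midpoint.  When the midpoint of the
  longest edge becomes proper, its index drops to zero, and the counting restarts
  one step later.\<close>

lemma mu_drop:
  assumes T: "T \<in> refs" and X: "X \<in> refs" "B T \<subseteq> B X" and E: "E \<in> T"
    and Q: "Q \<in> U j" "(Q, E) \<in> half\<^sup>+" and G: "G \<in> T" "oe Q \<subseteq> region G" "gen G \<le> j"
    and pr: "proper_node X (moe Q)"
  shows "mu X E + 1 \<le> mu T E"
proof -
  have fQ: "Q \<in> forest" using in_forest[OF Q(1)] .
  have hang: "Y \<in> B T \<and> \<not> proper_node T (moe Y)" if Y: "(Q, Y) \<in> half\<^sup>*" "sanc Y E" for Y
  proof -
    have QY: "anc Q Y" using halves_anc Y by blast
    have fY: "Y \<in> forest" "j \<le> gen Y" using desc_props[OF QY fQ] gen_eq[OF Q(1)] by auto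
    have "moe Y \<in> region G" using halves_oe[OF Y(1)] moe_in_oe[of Y] G by blast
    moreover have "moe Y \<notin> verts G"
      using moe_new[OF lev_gen[OF fY(1)]] verts_nodes[OF lev_gen[OF ref_forest[OF T G(1)]]]
        nodes_mono[of "gen G" "gen Y"] G(3) fY(2) by auto
    ultimately have "\<not> proper_node T (moe Y)" using G(1) by (auto simp: proper_node_def)
    then show ?thesis using sanc_leaf[OF T E fY(1) Y(2)] by blast
  qed
  have lamT: "lam T (moe Y) = mu T Y + 1" if "(Q, Y) \<in> half\<^sup>*" "sanc Y E" for Y
    using lam_hanging[OF T] hang[OF that] by (simp add: mu_def)
  have mono: "lam X x \<le> lam T x" if "x \<in> nodes T" for x using lam_mono[OF T X that] .
  have sanc_half: "sanc Y E" if "(Y, Z) \<in> half" "anc Z E" for Y Z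
  proof -
    obtain C where "C \<in> children Y" "Z \<in> children C" using half_anc \<open>(Y, Z) \<in> half\<close> by blast
    then have "sanc Y Z" by (auto simp: child_rel_def intro: trancl.intros)
    then show ?thesis using that(2) by simp
  qed
  have "anc Z E \<longrightarrow> mu X Z + 1 \<le> mu T Z" if "(Q, Z) \<in> half\<^sup>+" for Z
    using that
  proof (induction rule: trancl_induct)
    case (base Y)
    show ?case
    proof
      assume "anc Y E"
      then have s: "sanc Q E" using sanc_half base by blast
      have e: "ov1 Y = moe Q" "ov2 Y = ov1 Q \<or> ov2 Y = ov2 Q" using half_ends[OF base] by auto
      have "lam X (ov2 Y) \<le> mu T Q"
        using mono ov_in_nodes[OF T, of Q] hang[OF _ s] e(2) unfolding mu_def
        by (metis le_max_iff_disj rtrancl.rtrancl_refl)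
      moreover have "lam X (ov1 Y) = 0" using e pr lam_proper[OF X(1)] by simp
      moreover have "mu T Q + 1 \<le> mu T Y" using lamT[OF _ s] e(1) by (simp add: mu_def)
      ultimately show "mu X Y + 1 \<le> mu T Y" by (simp add: mu_def)
    qed
  next
    case (step Y Z)
    show ?case
    proof
      assume Z: "anc Z E"
      have s: "sanc Y E" using sanc_half step(2) Z .
      have IH: "mu X Y + 1 \<le> mu T Y" using step s anc_sanc by blast
      have qY: "(Q, Y) \<in> half\<^sup>*" using step by simp
      have e: "ov1 Z = moe Y" "ov2 Z = ov1 Y \<or> ov2 Z = ov2 Y" using half_ends[OF step(2)] by auto
      have "Y \<in> B X" using hang[OF qY s] X by blast
      then have "lam X (moe Y) \<le> mu X Y + 1" using lam_moe_le[OF X(1)] by (simp add: mu_def)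
      moreover have "lam X (ov2 Z) \<le> mu X Y" using e by (auto simp: mu_def)
      moreover have "mu T Y + 1 \<le> mu T Z" using lamT[OF qY s] e(1) by (simp add: mu_def)
      ultimately show "mu X Z + 1 \<le> mu T Z" using IH e(1) by (simp add: mu_def)
    qed
  qed
  then show ?thesis using Q(2) by blast
qed

lemma bisect_ref: "X \<in> refs \<Longrightarrow> E \<in> X \<Longrightarrow> bisect X E \<in> refs"
  by (rule refinements.bisection)

lemma nodes_bisect: "X \<in> refs \<Longrightarrow> E \<in> X \<Longrightarrow> nodes (bisect X E) = insert (moe E) (nodes X)"
  using ref_nodes[of X] ref_nodes[OF bisect_ref[of X E]] ref_B_bisect[of X E] by auto

lemma lam_bisect_moe:
  assumes "X \<in> refs" "E \<in> X"
  shows "lam (bisect X E) (moe E) \<le> mu X E + 1"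
proof -
  have B: "B (bisect X E) = insert E (B X)" using ref_B_bisect assms by blast
  have "lam (bisect X E) (moe E) \<le> max (lam (bisect X E) (ov1 E)) (lam (bisect X E) (ov2 E)) + 1"
    using lam_moe_le[OF bisect_ref[OF assms]] B by blast
  moreover have "lam (bisect X E) (ov1 E) \<le> lam X (ov1 E)" "lam (bisect X E) (ov2 E) \<le> lam X (ov2 E)"
    using lam_mono[OF assms(1) bisect_ref[OF assms]] B ov_in_nodes[OF assms(1)] assms by auto
  ultimately show ?thesis by (simp add: mu_def)
qed

lemma admissible_bisect:
  assumes X: "X \<in> refs" "E \<in> X" and old: "\<And>x. x \<in> nodes X \<Longrightarrow> x \<noteq> moe E \<Longrightarrow> lam X x \<le> \<Lambda>"
    and new: "lam (bisect X E) (moe E) \<le> \<Lambda>"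
  shows "admissible T0 \<Lambda> (bisect X E)"
  unfolding admissible_def
proof
  fix x assume x: "x \<in> nodes (bisect X E)"
  show "lam (bisect X E) x \<le> \<Lambda>"
  proof (cases "x = moe E")
    case False
    then have "x \<in> nodes X" using x nodes_bisect[OF X] by blast
    then show ?thesis
      using lam_mono[OF X(1) bisect_ref[OF X] _ \<open>x \<in> nodes X\<close>] ref_B_bisect[OF X]
        old[OF \<open>x \<in> nodes X\<close> False] subset_insertI[of "B X" E] by simp
  qed (use new in simp)
qed

lemma chain_hd: "chain T0 \<Lambda> T E = Some cs \<Longrightarrow> \<exists>cs'. cs = E # cs'"
  by (subst (asm) chain.simps) (auto split: if_splits bind_splits)

lemma cac_leaf:
  assumes "index_moe T0 T E \<le> \<Lambda>"
  shows "create_admissible_chain T0 \<Lambda> T E = Some (bisect T E)"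
  using assms by (simp add: create_admissible_chain_def chain.simps[of T0 \<Lambda> T E])

lemma cac_compatible:
  assumes "index_moe T0 T E = \<Lambda> + 1" "facing T E = G" "compatible E G"
  shows "create_admissible_chain T0 \<Lambda> T E = Some (bisect (bisect T G) E)"
  using assms compatible_sym[of E G]
  by (simp add: create_admissible_chain_def chain.simps[of T0 \<Lambda> T E])

lemma cac_incompatible:
  assumes "index_moe T0 T E = \<Lambda> + 1" "facing T E = G" "\<not> compatible E G"
    "create_admissible_chain T0 \<Lambda> T G = Some X"
  shows "create_admissible_chain T0 \<Lambda> T E = Some (bisect (bisect X (facing_child G E)) E)"
proof -
  obtain cs where cs: "chain T0 \<Lambda> T G = Some cs" "X = bisect (traverse_chain cs T) G"
    using assms(4) by (auto simp: create_admissible_chain_def)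
  then obtain cs' where "cs = G # cs'" using chain_hd by blast
  then show ?thesis
    using assms cs compatible_sym[of E G]
    by (simp add: create_admissible_chain_def chain.simps[of T0 \<Lambda> T E])
qed

lemma index_moe_le:
  assumes T: "T \<in> refs" "admissible T0 \<Lambda> T" and E: "E \<in> T"
  shows "index_moe T0 T E \<le> \<Lambda> + 1"
proof (cases "moe E \<in> nodes T")
  case True
  then show ?thesis using T by (auto simp: index_moe_def admissible_def intro: le_SucI)
next
  case False
  have "mu T E \<le> \<Lambda>" using T ov_in_nodes[OF T(1)] E by (auto simp: mu_def admissible_def)
  then show ?thesis using lam_bisect_moe[OF T(1) E] False by (simp add: index_moe_def)
qed

lemma index_large:
  assumes T: "T \<in> refs" "admissible T0 \<Lambda> T" and E: "E \<in> T" and large: "\<not> index_moe T0 T E \<le> \<Lambda>"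
  obtains E' where "moe E \<notin> nodes T" "E' \<in> U (gen E)" "E' \<noteq> E" "oe E' = oe E"
proof -
  have n: "moe E \<notin> nodes T" using large T by (auto simp: index_moe_def admissible_def)
  then have "lam (bisect T E) (moe E) \<noteq> 0" using large by (simp add: index_moe_def)
  then have "\<not> proper_node (bisect T E) (moe E)" using lam_proper[OF bisect_ref[OF T(1) E], of "moe E"] by auto
  moreover have EB: "E \<in> B (bisect T E)" using ref_B_bisect[OF T(1) E] by simp
  ultimately have "\<not> (\<forall>D\<in>U (gen E). oe D = oe E \<longrightarrow> D \<in> B (bisect T E))"
    using proper_moe[OF bisect_ref[OF T(1) E] lev_gen[OF ref_forest[OF T(1) E]] EB] by simp
  then obtain D where D: "D \<in> U (gen E)" "oe D = oe E" "D \<notin> B (bisect T E)" by blast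
  then have "D \<noteq> E" using EB by metis
  then show ?thesis using that[OF n D(1) _ D(2)] by simp
qed

lemma proper_pair:
  assumes X: "X \<in> refs" and Q: "Q \<in> U j" "Q' \<in> U j" "Q \<noteq> Q'" "oe Q = oe Q'" "Q \<in> B X" "Q' \<in> B X"
  shows "proper_node X (moe Q)"
proof -
  have "D \<in> B X" if "D \<in> U j" "oe D = oe Q" for D
    using at_most_two[OF that(1) Q(1) Q(2) that(2) Q(4)] Q(3,5,6) by blast
  then show ?thesis using proper_moe[OF X Q(1) Q(5)] by blast
qed

text \<open>Along a chain the generations decrease strictly until its last step, and the second bisection of
  an incompatible facing element is of the generation following it.  This yields the bounds on the
  generations.  For admissibility, bisecting the triangle \<open>Q'\<close> across the edge either puts the
  midpoint of the edge of \<open>E\<close> itself on both sides or, by the preceding lemma, lowers the indices of the ends of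
  this edge; in both cases the bisection of \<open>E\<close> becomes admissible.\<close>

theorem create_admissible_chain_props:
  assumes T: "T \<in> refs" "admissible T0 \<Lambda> T" and "E \<in> T"
  shows "\<exists>T' N. create_admissible_chain T0 \<Lambda> T E = Some T' \<and> T' \<in> refs \<and> admissible T0 \<Lambda> T' \<and>
    B T' = B T \<union> N \<and> finite N \<and> E \<in> N \<and> (\<forall>F\<in>N. gen F \<le> gen E) \<and> (\<forall>j. card (N \<inter> U j) \<le> 2)"
  using \<open>E \<in> T\<close>
proof (induction "gen E" arbitrary: E rule: less_induct)
  case less
  note E = less(2)
  have fE: "E \<in> forest" using ref_forest[OF T(1) E] .
  show ?case
  proof (cases "index_moe T0 T E \<le> \<Lambda>")
    case True
    have "lam (bisect T E) (moe E) \<le> \<Lambda>"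
    proof (cases "moe E \<in> nodes T")
      case True
      then have "lam (bisect T E) (moe E) \<le> lam T (moe E)"
        using lam_mono[OF T(1) bisect_ref[OF T(1) E]] ref_B_bisect[OF T(1) E] by blast
      then show ?thesis using \<open>index_moe T0 T E \<le> \<Lambda>\<close> True by (simp add: index_moe_def)
    next
      case False
      then show ?thesis using True by (simp add: index_moe_def)
    qed
    then have "admissible T0 \<Lambda> (bisect T E)"
      using T E by (intro admissible_bisect) (auto simp: admissible_def)
    moreover have "card ({E} \<inter> U j) \<le> 2" for j
      using card_mono[of "{E}" "{E} \<inter> U j"] by simp
    ultimately show ?thesis
      using cac_leaf[OF True] bisect_ref[OF T(1) E] ref_B_bisect[OF T(1) E]
      by (intro exI[of _ "bisect T E"] exI[of _ "{E}"]) auto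
  next
    case False
    then have idx: "index_moe T0 T E = \<Lambda> + 1" using index_moe_le[OF T E] by simp
    obtain E' where E': "moe E \<notin> nodes T" "E' \<in> U (gen E)" "E' \<noteq> E" "oe E' = oe E"
      using index_large[OF T E False] .
    obtain G Q Q' j where fac: "facing T E = G" and G: "G \<in> T" "G \<noteq> E"
      and Q: "Q \<in> U j" "Q' \<in> U j" "Q \<noteq> Q'" "oe Q = oe Q'" "(Q, E) \<in> half\<^sup>*" "\<not> anc G E"
      and alt: "(Q' = G \<and> compatible E G) \<or> (Q' \<in> children G \<and> \<not> compatible E G \<and> facing_child G E = Q')"
      using facing_props[OF T(1) E E'] .
    have fG: "G \<in> forest" using ref_forest[OF T(1) G(1)] .
    have QE: "anc Q E" using halves_anc Q by blast
    have jE: "j \<le> gen E" using desc_props(2)[OF QE in_forest[OF Q(1)]] gen_eq[OF Q(1)] by simp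
    have RG: "region Q' \<subseteq> region G" using alt region_children[of G] by blast
    have gGj: "gen G \<le> j" using alt gen_child[OF fG] gen_eq[OF Q(2)] by fastforce
    have gQ': "gen Q' = j" using gen_eq[OF Q(2)] .
    \<comment> \<open>\<open>X\<close> is the mesh when \<open>Q'\<close> is about to be bisected: \<open>T\<close> itself if \<open>G\<close> is compatible, the result of the
      call for \<open>G\<close> otherwise.\<close>
    have finish: "admissible T0 \<Lambda> (bisect (bisect X Q') E)"
      if X: "X \<in> refs" "B T \<subseteq> B X" "E \<in> bisect X Q'" "Q' \<in> X" "admissible T0 \<Lambda> X" for X
    proof -
      define Y where "Y = bisect X Q'"
      have Y: "Y \<in> refs" "B Y = insert Q' (B X)" "E \<in> Y" "B T \<subseteq> B Y"
        using bisect_ref[OF X(1,4)] ref_B_bisect[OF X(1,4)] X by (auto simp: Y_def)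
      have nY: "nodes Y = insert (moe Q') (nodes X)" using nodes_bisect[OF X(1,4)] by (simp add: Y_def)
      have mQ: "moe Q' = moe Q" using moe_eq_of_oe_eq Q(4) by metis
      have old: "lam Y x \<le> \<Lambda>" if "x \<in> nodes X" for x
        using lam_mono[OF X(1) Y(1) _ that] Y(2) X(5) that by (fastforce simp: admissible_def)
      have "(\<forall>x\<in>nodes Y. x \<noteq> moe E \<longrightarrow> lam Y x \<le> \<Lambda>) \<and> lam (bisect Y E) (moe E) \<le> \<Lambda>"
      proof (cases "Q = E")
        case True
        have "proper_node (bisect Y E) (moe Q)"
          using proper_pair[OF bisect_ref[OF Y(1,3)] Q(1,2,3,4)] ref_B_bisect[OF Y(1,3)] Y(2) True by blast
        then have "lam (bisect Y E) (moe E) = 0" using lam_proper[OF bisect_ref[OF Y(1,3)]] True by blast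
        then show ?thesis using nY mQ True old by auto
      next
        case False
        then have h: "(Q, E) \<in> half\<^sup>+" using Q(5) by (metis rtranclD)
        have "sanc Q E" using QE False anc_sanc by blast
        then have QB: "Q \<in> B T" using sanc_leaf[OF T(1) E in_forest[OF Q(1)]] by blast
        then have pr: "proper_node Y (moe Q)" using proper_pair[OF Y(1) Q(1,2,3,4)] Y by blast
        have "oe Q \<subseteq> region G" using Q(4) oe_subset_region[of Q'] RG by blast
        then have "mu Y E + 1 \<le> mu T E"
          using mu_drop[OF T(1) Y(1,4) E Q(1) h G(1) _ gGj pr] by blast
        also have "mu T E \<le> \<Lambda>" using T ov_in_nodes[OF T(1)] E by (auto simp: mu_def admissible_def)
        finally have "lam (bisect Y E) (moe E) \<le> \<Lambda>" using lam_bisect_moe[OF Y(1,3)] by linarith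
        moreover have "moe Q' \<in> nodes X" using QB X ref_nodes[OF X(1)] mQ by auto
        ultimately show ?thesis using nY old by auto
      qed
      then show ?thesis using admissible_bisect[OF Y(1,3)] unfolding Y_def by blast
    qed
    show ?thesis
    proof (cases "compatible E G")
      case True
      then have Q'G: "Q' = G" using alt by blast
      have EX: "E \<in> bisect T G" using E G by (auto simp: bisect_def)
      have "admissible T0 \<Lambda> (bisect (bisect T G) E)"
        using finish[of T] T EX G Q'G by blast
      moreover have "B (bisect (bisect T G) E) = B T \<union> {G, E}"
        using ref_B_bisect[OF bisect_ref[OF T(1) G(1)] EX] ref_B_bisect[OF T(1) G(1)] by auto
      moreover have "card ({G, E} \<inter> U i) \<le> 2" for i
        using card_mono[of "{G, E}" "{G, E} \<inter> U i"] card_2_iff[of "{G, E}"] G(2) by auto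
      ultimately show ?thesis
        using cac_compatible[OF idx fac True] bisect_ref[OF bisect_ref[OF T(1) G(1)] EX] gGj jE
        by (intro exI[of _ "bisect (bisect T G) E"] exI[of _ "{G, E}"]) auto
    next
      case False
      then have c: "Q' \<in> children G" "facing_child G E = Q'" using alt by blast+
      have gG: "gen G < j" using gen_child[OF fG c(1)] gQ' by simp
      then have "gen G < gen E" using jE by simp
      then obtain X N where X: "create_admissible_chain T0 \<Lambda> T G = Some X" "X \<in> refs" "admissible T0 \<Lambda> X"
          "B X = B T \<union> N" and N: "finite N" "G \<in> N" "\<forall>F\<in>N. gen F \<le> gen G" "\<forall>j. card (N \<inter> U j) \<le> 2"
        using less(1)[of G] G(1) by auto
      have Q'B: "Q' \<notin> B X"
      proof
        assume "Q' \<in> B X"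
        then have "Q' \<in> B T" using X(4) N(3) gQ' gG by auto
        then show False using below_leaf[OF T(1) G(1)] anc_step[of G G Q'] c(1) anc_sanc by blast
      qed
      then have Q'X: "Q' \<in> X"
        using ref_leaf[OF X(2), of Q'] c(1) X(4) N(2) in_forest[OF Q(2)] by blast
      have "E \<notin> B T" "E \<in> T0 \<or> (\<exists>P\<in>B T. E \<in> children P)" using ref_leaf[OF T(1), of E] E by auto
      then have EX: "E \<in> X"
        using ref_leaf[OF X(2), of E] X(4) N(3) \<open>gen G < gen E\<close> fE by fastforce
      have "E \<noteq> Q'" using c(1) Q(6) anc_step[of G G Q'] anc_sanc by blast
      then have EY: "E \<in> bisect X Q'" using EX by (auto simp: bisect_def)
      have "admissible T0 \<Lambda> (bisect (bisect X Q') E)"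
        using finish[of X] X EY Q'X by blast
      moreover have BY: "B (bisect (bisect X Q') E) = B T \<union> (N \<union> {Q', E})"
        using ref_B_bisect[OF bisect_ref[OF X(2) Q'X] EY] ref_B_bisect[OF X(2) Q'X] X(4) by auto
      moreover have "card ((N \<union> {Q', E}) \<inter> U i) \<le> 2" for i
      proof (cases "i \<le> gen G")
        case True
        then have "(N \<union> {Q', E}) \<inter> U i = N \<inter> U i"
          using gQ' gG jE gen_eq[of _ i] by auto
        then show ?thesis using N(4) by simp
      next
        case False
        then have "N \<inter> U i = {}" using N(3) gen_eq by fastforce
        then have "(N \<union> {Q', E}) \<inter> U i \<subseteq> {Q', E}" by blast
        then have "card ((N \<union> {Q', E}) \<inter> U i) \<le> card {Q', E}" by (intro card_mono) auto
        also have "\<dots> \<le> 2" by (simp add: card_insert_if)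
        finally show ?thesis .
      qed
      moreover have "gen F \<le> gen E" if "F \<in> N \<union> {Q', E}" for F
        using that N(3) \<open>gen G < gen E\<close> gQ' jE by fastforce
      ultimately show ?thesis
        using cac_incompatible[OF idx fac False X(1)] bisect_ref[OF bisect_ref[OF X(2) Q'X] EY] N c(2)
        by (intro exI[of _ "bisect (bisect X Q') E"] exI[of _ "N \<union> {Q', E}"]) auto
    qed
  qed
qed

end

section \<open>Termination and cardinality of GREEDY\<close>

text \<open>Up to the generation at which the two bounds agree the first, from there on the second one is
  summed as a geometric series.\<close>

lemma two_regime_sum:
  fixes N :: "nat \<Rightarrow> real" and n0 R \<beta> :: real
  assumes \<beta>: "0 < \<beta>" and R: "0 \<le> R" and n0: "0 \<le> n0"
    and N: "\<And>j. N j \<le> n0 * 2 ^ j" "\<And>j. N j \<le> R * (2 powr - \<beta>) ^ j"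
  shows "(\<Sum>j<n. N j) \<le> (2 * n0 + 1 / (1 - 2 powr - \<beta>)) * R powr (1 / (1 + \<beta>))"
proof (cases "R = 0")
  case True
  have "(\<Sum>j<n. N j) \<le> 0" by (rule sum_nonpos) (use N(2) True in simp)
  then show ?thesis using True by simp
next
  case False
  define r :: real where "r = 2 powr - \<beta>"
  have r: "0 < r" "r < 1" using \<beta> by (auto simp: r_def powr_less_one)
  define Y where "Y = R powr (1 / (1 + \<beta>))"
  have Y: "0 < Y" using False R by (simp add: Y_def)
  have YR: "R * Y powr - \<beta> = Y"
  proof -
    have "R = Y powr (1 + \<beta>)" using \<beta> R False by (simp add: Y_def powr_powr)
    then have "R * Y powr - \<beta> = Y powr (1 + \<beta> - \<beta>)" by (simp add: powr_add[symmetric])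
    then show ?thesis using Y by simp
  qed
  have ex: "\<exists>J::nat. Y \<le> 2 ^ J" using real_arch_pow[of 2 Y] by (auto intro: less_imp_le)
  define J where "J = (LEAST J::nat. Y \<le> 2 ^ J)"
  have J: "Y \<le> 2 ^ J" unfolding J_def using ex by (rule LeastI_ex)
  have J': "(2::real) ^ J - 1 \<le> 2 * Y"
  proof (cases J)
    case 0 then show ?thesis using Y by simp
  next
    case (Suc i)
    then have "\<not> Y \<le> 2 ^ i" using not_less_Least[of i "\<lambda>J. Y \<le> 2 ^ J"] by (simp add: J_def)
    then show ?thesis using Suc by simp
  qed
  have "(\<Sum>j<n. N j) \<le> (\<Sum>j<n. (if j < J then n0 * 2 ^ j else 0) + (if j < J then 0 else R * r ^ j))"
    by (rule sum_mono) (use N in \<open>auto simp: r_def\<close>)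
  also have "\<dots> = (\<Sum>j<n. if j < J then n0 * 2 ^ j else 0) + (\<Sum>j<n. if j < J then 0 else R * r ^ j)"
    by (rule sum.distrib)
  also have "(\<Sum>j<n. if j < J then n0 * 2 ^ j else 0) = (\<Sum>j\<in>{..<n} \<inter> {..<J}. n0 * 2 ^ j)"
    by (simp add: sum.inter_restrict lessThan_def)
  also have "\<dots> \<le> (\<Sum>j<J. n0 * 2 ^ j)" using n0 by (intro sum_mono2) auto
  also have "\<dots> = n0 * (2 ^ J - 1)"
    using geometric_sum[of "2::real" J] by (simp add: sum_distrib_left[symmetric])
  also have "\<dots> \<le> n0 * (2 * Y)" using J' n0 by (intro mult_left_mono)
  also have "(\<Sum>j<n. if j < J then 0 else R * r ^ j) \<le> (\<Sum>j<n. R * r ^ J * r ^ (j - J) * (if j < J then 0 else 1))"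
    by (rule sum_mono) (auto simp: mult.assoc power_add[symmetric])
  also have "\<dots> = R * r ^ J * (\<Sum>j\<in>{..<n} \<inter> {J..}. r ^ (j - J))"
    by (simp add: sum_distrib_left sum.inter_restrict if_distrib mult.assoc not_less cong: if_cong)
      (auto intro!: sum.cong)
  also have "(\<Sum>j\<in>{..<n} \<inter> {J..}. r ^ (j - J)) = (\<Sum>i<n - J. r ^ i)"
    by (rule sum.reindex_bij_witness[of _ "\<lambda>i. i + J" "\<lambda>j. j - J"]) auto
  also have "R * r ^ J * (\<Sum>i<n - J. r ^ i) \<le> R * r ^ J * (1 / (1 - r))"
    using r R by (intro mult_left_mono) (simp_all add: sum_gp_strict divide_right_mono)
  also have "R * r ^ J * (1 / (1 - r)) \<le> Y * (1 / (1 - r))"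
  proof -
    have "r ^ J = (2 ^ J) powr - \<beta>"
      by (simp add: r_def powr_realpow[symmetric] powr_powr mult.commute)
    also have "\<dots> \<le> Y powr - \<beta>" using J Y \<beta> by (intro powr_mono2') auto
    finally have "R * r ^ J \<le> Y" using R YR by (metis mult_left_mono)
    then show ?thesis using r by (intro mult_right_mono) auto
  qed
  finally show ?thesis using R r by (simp add: Y_def r_def algebra_simps mult_left_mono)
qed

context labelled
begin

lemma finite_lev: "finite (U j)"
  using conf_U[of j] by (simp add: conf_def)

lemma card_lev: "card (U j) \<le> card T0 * 2 ^ j"
proof (induction j)
  case (Suc j)
  have "card (U (Suc j)) \<le> (\<Sum>E\<in>U j. card (children E))"
    unfolding lev.simps bisect_all_def by (rule card_UN_le[OF finite_lev])
  also have "\<dots> \<le> (\<Sum>E\<in>U j. 2)"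
    by (rule sum_mono) (simp add: children_def card_insert_if)
  finally show ?case using Suc by simp
qed simp

text \<open>The bisected triangles \<open>X\<close> are paid for by marked triangles among them, each of which pays for two
  bisections in every generation up to its own.\<close>

definition charged :: "(tri \<Rightarrow> bool) \<Rightarrow> tri set \<Rightarrow> bool" where
  "charged mk X \<longleftrightarrow> (\<exists>M\<subseteq>X. (\<forall>E\<in>M. mk E) \<and> (\<forall>j. card (X \<inter> U j) \<le> 2 * card {E\<in>M. j \<le> gen E}))"

lemma refine_props:
  assumes "T \<in> refs" "admissible T0 \<Lambda> T" "charged mk (B T)" "\<forall>E\<in>set Ms. mk E"
  shows "\<exists>T'. refine T0 \<Lambda> T Ms = Some T' \<and> T' \<in> refs \<and> admissible T0 \<Lambda> T' \<and> B T \<subseteq> B T' \<and>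
    charged mk (B T') \<and> set Ms \<inter> T \<subseteq> B T'"
  using assms
proof (induction Ms arbitrary: T)
  case (Cons E Ms)
  note T = Cons.prems(1,2)
  show ?case
  proof (cases "E \<in> T")
    case False
    then show ?thesis using Cons by auto
  next
    case True
    obtain T1 N where T1: "create_admissible_chain T0 \<Lambda> T E = Some T1" "T1 \<in> refs" "admissible T0 \<Lambda> T1"
      "B T1 = B T \<union> N" and N: "finite N" "E \<in> N" "\<forall>F\<in>N. gen F \<le> gen E" "\<forall>j. card (N \<inter> U j) \<le> 2"
      using create_admissible_chain_props[OF T True] by blast
    obtain M where M: "M \<subseteq> B T" "\<forall>E\<in>M. mk E" "\<forall>j. card (B T \<inter> U j) \<le> 2 * card {E\<in>M. j \<le> gen E}"
      using Cons.prems(3) by (auto simp: charged_def)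
    have "E \<notin> M" using M(1) ref_leaf[OF T(1), of E] True by blast
    have finM: "finite M" using M(1) ref_finite_B[OF T(1)] finite_subset by blast
    have "card (B T1 \<inter> U j) \<le> 2 * card {F\<in>insert E M. j \<le> gen F}" for j
    proof -
      have "card (B T1 \<inter> U j) \<le> card (B T \<inter> U j) + card (N \<inter> U j)"
        unfolding T1(4) Int_Un_distrib2 by (rule card_Un_le)
      also have "card (N \<inter> U j) \<le> (if j \<le> gen E then 2 else 0)"
      proof (cases "j \<le> gen E")
        case False
        then have "N \<inter> U j = {}" using N(3) gen_eq by fastforce
        then show ?thesis by simp
      qed (use N(4) in simp)
      also have "card (B T \<inter> U j) + (if j \<le> gen E then 2 else 0) \<le>
          2 * card {F\<in>M. j \<le> gen F} + (if j \<le> gen E then 2 else 0)" using M(3) by simp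
      also have "\<dots> = 2 * card {F\<in>insert E M. j \<le> gen F}"
      proof (cases "j \<le> gen E")
        case True
        then have "{F\<in>insert E M. j \<le> gen F} = insert E {F\<in>M. j \<le> gen F}" by auto
        then show ?thesis using True finM \<open>E \<notin> M\<close> by simp
      next
        case False
        then have "{F\<in>insert E M. j \<le> gen F} = {F\<in>M. j \<le> gen F}" by auto
        then show ?thesis using False by simp
      qed
      finally show ?thesis by simp
    qed
    then have "charged mk (B T1)"
      unfolding charged_def using M(1,2) Cons.prems(4) T1(4) N(2) by (intro exI[of _ "insert E M"]) auto
    then obtain T' where T': "refine T0 \<Lambda> T1 Ms = Some T'" "T' \<in> refs" "admissible T0 \<Lambda> T'" "B T1 \<subseteq> B T'"
      "charged mk (B T')" "set Ms \<inter> T1 \<subseteq> B T'" using Cons.IH[OF T1(2,3)] Cons.prems(4) by auto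
    have "F \<in> B T'" if "F \<in> set Ms" "F \<in> T" for F
    proof (cases "F \<in> T1")
      case False
      then have "F \<in> B T1" using ref_leaf[OF T1(2), of F] ref_leaf[OF T(1), of F] that(2) T1(4) by blast
      then show ?thesis using T' by blast
    qed (use that T' in blast)
    then show ?thesis using T1 T' True N(2) by auto
  qed
qed auto

text \<open>The generations of bisected triangles never exceed those of the triangles with large error.
  Only finitely many triangles can hence be bisected, and each pass bisects a new one.\<close>

lemma greedy_terminates:
  assumes ord: "processing_order ord" and fin: "finite {E\<in>forest. ereal \<delta> < local_zeta E A}"
    and T: "T \<in> refs" "admissible T0 \<Lambda> T" "charged (\<lambda>E. ereal \<delta> < local_zeta E A) (B T)"
  shows "\<exists>T'. greedy T0 \<Lambda> ord \<delta> A T = Some T' \<and> T' \<in> refs \<and> admissible T0 \<Lambda> T' \<and>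
    charged (\<lambda>E. ereal \<delta> < local_zeta E A) (B T') \<and> marked \<delta> A T' = {}"
proof -
  define mk where "mk = (\<lambda>E. ereal \<delta> < local_zeta E A)"
  define MK where "MK = {E\<in>forest. mk E}"
  have finMK: "finite MK" using fin by (simp add: MK_def mk_def)
  obtain g where g: "\<And>E. E \<in> MK \<Longrightarrow> gen E \<le> g"
    using finite_nat_set_iff_bounded_le[of "gen ` MK"] finMK by auto
  define W where "W = (\<Union>j\<le>g. U j)"
  have finW: "finite W" by (auto simp: W_def finite_lev)
  have BW: "B T \<subseteq> W" if T: "T \<in> refs" "charged mk (B T)" for T
  proof
    fix F assume F: "F \<in> B T"
    obtain M where M: "M \<subseteq> B T" "\<forall>E\<in>M. mk E" "\<forall>j. card (B T \<inter> U j) \<le> 2 * card {E\<in>M. j \<le> gen E}"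
      using T(2) by (auto simp: charged_def)
    have Fj: "F \<in> U (gen F)" using F B_forest lev_gen by blast
    have "card (B T \<inter> U (gen F)) \<noteq> 0" using F Fj ref_finite_B[OF T(1)] by auto
    then have "{E\<in>M. gen F \<le> gen E} \<noteq> {}" using M(3) by (metis card.empty le_zero_eq mult_0_right)
    then obtain E where "E \<in> M" "gen F \<le> gen E" by blast
    moreover have "E \<in> MK" using calculation M B_forest by (auto simp: MK_def)
    ultimately have "gen F \<le> g" using g le_trans by blast
    then show "F \<in> W" using Fj by (auto simp: W_def)
  qed
  have "\<exists>T'. greedy T0 \<Lambda> ord \<delta> A T = Some T' \<and> T' \<in> refs \<and> admissible T0 \<Lambda> T' \<and>
    charged mk (B T') \<and> marked \<delta> A T' = {}"
    if "T \<in> refs" "admissible T0 \<Lambda> T" "charged mk (B T)" for T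
    using that
  proof (induction "card (W - B T)" arbitrary: T rule: less_induct)
    case less
    show ?case
    proof (cases "marked \<delta> A T = {}")
      case True
      then show ?thesis using less(2-4) by (simp add: greedy.simps[of T0 \<Lambda> ord \<delta> A T])
    next
      case False
      have "finite (marked \<delta> A T)" using ref_finite[OF less(2)] by (simp add: marked_def)
      then have set: "set (ord T (marked \<delta> A T)) = marked \<delta> A T"
        using ord by (simp add: processing_order_def)
      have mkd: "marked \<delta> A T = {E\<in>T. mk E}" by (simp add: marked_def mk_def)
      obtain T1 where T1: "refine T0 \<Lambda> T (ord T (marked \<delta> A T)) = Some T1" "T1 \<in> refs" "admissible T0 \<Lambda> T1"
        "B T \<subseteq> B T1" "charged mk (B T1)" "set (ord T (marked \<delta> A T)) \<inter> T \<subseteq> B T1"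
        using refine_props[OF less(2-4), of "ord T (marked \<delta> A T)"] set mkd by auto
      have sub: "marked \<delta> A T \<subseteq> B T1" using T1(6) set mkd by blast
      obtain E where E: "E \<in> marked \<delta> A T" using False by blast
      have "E \<notin> B T" using E ref_leaf[OF less(2), of E] by (auto simp: marked_def)
      then have "W - B T1 \<subset> W - B T" using sub T1(4) E BW[OF T1(2,5)] by blast
      then have "card (W - B T1) < card (W - B T)" using finW by (intro psubset_card_mono) auto
      then show ?thesis
        using less(1)[OF _ T1(2,3,5)] T1(1) False by (simp add: greedy.simps[of T0 \<Lambda> ord \<delta> A T])
    qed
  qed
  then show ?thesis using T unfolding mk_def by blast
qed

lemma B_T0: "B T0 = {}"
  using ref_card[OF refinements.initial] ref_finite_B[OF refinements.initial] by simp

lemma admissible_T0: "admissible T0 \<Lambda> T0"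
  using proper_T0[OF refinements.initial] lam_proper[OF refinements.initial]
  by (simp add: admissible_def)

text \<open>Bisections of generation \<open>j\<close> are limited by the number of triangles of that generation and by
  twice the number of marked triangles of generation at least \<open>j\<close>.\<close>

theorem greedy_cardinality:
  fixes \<beta> R \<delta> :: real
  assumes ord: "processing_order ord" and \<beta>: "0 < \<beta>" and R: "0 \<le> R"
    and cnt: "\<And>i. real (card {E\<in>U i. ereal \<delta> < local_zeta E A}) \<le> R * (2 powr - \<beta>) ^ i"
  shows "\<exists>T. greedy T0 \<Lambda> ord \<delta> A T0 = Some T \<and> T \<in> refs \<and> admissible T0 \<Lambda> T \<and> marked \<delta> A T = {} \<and>
    real (card T) \<le> real (card T0) + (2 * real (card T0) + 1 / (1 - 2 powr - \<beta>)) *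
      (2 * R / (1 - 2 powr - \<beta>)) powr (1 / (1 + \<beta>))"
proof -
  define r :: real where "r = 2 powr - \<beta>"
  have r: "0 < r" "r < 1" using \<beta> by (auto simp: r_def powr_less_one)
  define mk where "mk = (\<lambda>E. ereal \<delta> < local_zeta E A)"
  have cnt': "real (card {E\<in>U i. mk E}) \<le> R * r ^ i" for i using cnt by (simp add: mk_def r_def)
  have "(\<lambda>i. R * r ^ i) \<longlonglongrightarrow> R * 0" using r by (intro tendsto_mult tendsto_const LIMSEQ_power_zero) simp
  then have "\<forall>\<^sub>F i in sequentially. R * r ^ i < 1" by (rule order_tendstoD) simp
  then obtain g where g: "\<And>i. g \<le> i \<Longrightarrow> R * r ^ i < 1" by (auto simp: eventually_sequentially)
  have none: "{E\<in>U i. mk E} = {}" if "g \<le> i" for i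
  proof -
    have "real (card {E\<in>U i. mk E}) < 1" using cnt'[of i] g[OF that] by linarith
    then have "card {E\<in>U i. mk E} = 0" by linarith
    then show ?thesis using finite_lev by simp
  qed
  have MK: "{E\<in>forest. mk E} = (\<Union>i<g. {E\<in>U i. mk E})"
  proof (intro equalityI subsetI)
    fix E assume "E \<in> {E\<in>forest. mk E}"
    then have "E \<in> {E\<in>U (gen E). mk E}" using lev_gen by blast
    then show "E \<in> (\<Union>i<g. {E\<in>U i. mk E})" using none[of "gen E"] by (intro UN_I[of "gen E"]) (auto simp: not_less[symmetric])
  qed (auto intro: in_forest)
  have finMK: "finite {E\<in>forest. mk E}" unfolding MK using finite_lev by auto
  have "charged mk {}" by (auto simp: charged_def)
  then obtain T where T: "greedy T0 \<Lambda> ord \<delta> A T0 = Some T" "T \<in> refs" "admissible T0 \<Lambda> T"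
    "charged mk (B T)" "marked \<delta> A T = {}"
    using greedy_terminates[OF ord, of \<delta> A T0 \<Lambda>] finMK admissible_T0 refinements.initial B_T0
    unfolding mk_def by auto
  obtain M where M: "M \<subseteq> B T" "\<forall>E\<in>M. mk E" "\<forall>j. card (B T \<inter> U j) \<le> 2 * card {E\<in>M. j \<le> gen E}"
    using T(4) by (auto simp: charged_def)
  have MK': "M \<subseteq> {E\<in>forest. mk E}" using M B_forest by auto
  have b2: "real (card (B T \<inter> U j)) \<le> 2 * R / (1 - r) * r ^ j" for j
  proof -
    have "{E\<in>M. j \<le> gen E} \<subseteq> (\<Union>i<g. {E\<in>U (j + i). mk E})"
    proof
      fix E assume E: "E \<in> {E\<in>M. j \<le> gen E}"
      then have "E \<in> U (gen E)" "mk E" using MK' lev_gen by auto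
      then have "E \<in> U (j + (gen E - j))" "gen E < g"
        using E none[of "gen E"] by (auto simp: not_less[symmetric])
      then show "E \<in> (\<Union>i<g. {E\<in>U (j + i). mk E})" using \<open>mk E\<close> by (intro UN_I[of "gen E - j"]) auto
    qed
    then have "card {E\<in>M. j \<le> gen E} \<le> card (\<Union>i<g. {E\<in>U (j + i). mk E})"
      using finite_lev by (intro card_mono) auto
    also have "\<dots> \<le> (\<Sum>i<g. card {E\<in>U (j + i). mk E})" by (rule card_UN_le) simp
    finally have "real (card {E\<in>M. j \<le> gen E}) \<le> (\<Sum>i<g. real (card {E\<in>U (j + i). mk E}))"
      unfolding of_nat_sum[symmetric] of_nat_le_iff .
    also have "\<dots> \<le> (\<Sum>i<g. R * r ^ j * r ^ i)"
    proof (rule sum_mono)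
      show "real (card {E\<in>U (j + i). mk E}) \<le> R * r ^ j * r ^ i" for i
        using cnt'[of "j + i"] by (simp add: power_add mult.assoc)
    qed
    also have "\<dots> = R * r ^ j * (\<Sum>i<g. r ^ i)" by (simp add: sum_distrib_left)
    also have "\<dots> \<le> R * r ^ j * (1 / (1 - r))"
      using r R by (intro mult_left_mono) (simp_all add: sum_gp_strict divide_right_mono)
    finally have "real (card {E\<in>M. j \<le> gen E}) \<le> R * r ^ j / (1 - r)" by simp
    moreover have "real (card (B T \<inter> U j)) \<le> 2 * real (card {E\<in>M. j \<le> gen E})"
      using M(3)[rule_format, of j] by linarith
    moreover have "2 * R / (1 - r) * r ^ j = 2 * (R * r ^ j / (1 - r))" by simp
    ultimately show ?thesis by linarith
  qed
  have b1: "real (card (B T \<inter> U j)) \<le> real (card T0) * 2 ^ j" for j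
  proof -
    have "card (B T \<inter> U j) \<le> card (U j)" using finite_lev by (intro card_mono) auto
    then have "card (B T \<inter> U j) \<le> card T0 * 2 ^ j" using card_lev le_trans by blast
    then have "real (card (B T \<inter> U j)) \<le> real (card T0 * 2 ^ j)" by (simp only: of_nat_le_iff)
    then show ?thesis by simp
  qed
  obtain n where n: "\<And>F. F \<in> B T \<Longrightarrow> gen F < n"
    using finite_nat_set_iff_bounded[of "gen ` B T"] ref_finite_B[OF T(2)] by auto
  have "B T = (\<Union>j<n. B T \<inter> U j)" using n B_forest lev_gen by fastforce
  then have "card (B T) \<le> (\<Sum>j<n. card (B T \<inter> U j))" using card_UN_le[of "{..<n}" "\<lambda>j. B T \<inter> U j"] by simp
  then have "real (card (B T)) \<le> (\<Sum>j<n. real (card (B T \<inter> U j)))"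
    unfolding of_nat_sum[symmetric] of_nat_le_iff .
  also have "\<dots> \<le> (2 * real (card T0) + 1 / (1 - 2 powr - \<beta>)) * (2 * R / (1 - r)) powr (1 / (1 + \<beta>))"
    using two_regime_sum[OF \<beta> _ _ b1 b2[unfolded r_def]] R r by (simp add: r_def)
  finally show ?thesis using T ref_card[OF T(2)] by (auto simp: r_def)
qed

end

section \<open>Smooth bump functions\<close>

text \<open>The family is closed under differentiation up to linear combinations, with all derivatives
  vanishing at the origin.\<close>

definition psi :: "nat \<Rightarrow> real \<Rightarrow> real" where
  "psi j t = (if t > 0 then exp (- inverse t) * inverse t ^ j else 0)"

lemma psi_deriv: "(psi j has_real_derivative (psi (j + 2) t - real j * psi (Suc j) t)) (at t)"
proof -
  consider "t > 0" | "t < 0" | "t = 0" by linarith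
  then show ?thesis
  proof cases
    case 1
    have "((\<lambda>t. exp (- inverse t) * inverse t ^ j) has_real_derivative
        (psi (j + 2) t - real j * psi (Suc j) t)) (at t)"
    proof -
      have d: "((\<lambda>u. exp (- u) * u ^ j) has_real_derivative
          (- exp (- u) * u ^ j + exp (- u) * (real j * u ^ (j - Suc 0)))) (at u)" for u :: real
        by (rule derivative_eq_intros refl | simp)+
      have "((\<lambda>t. exp (- inverse t) * inverse t ^ j) has_real_derivative
          (- exp (- inverse t) * inverse t ^ j + exp (- inverse t) * (real j * inverse t ^ (j - Suc 0))) *
          (- (inverse t ^ Suc (Suc 0)))) (at t)"
        using DERIV_chain2[OF d DERIV_inverse[of t]] 1 by simp
      moreover have "(- exp (- inverse t) * inverse t ^ j + exp (- inverse t) * (real j * inverse t ^ (j - Suc 0))) *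
          (- (inverse t ^ Suc (Suc 0))) = psi (j + 2) t - real j * psi (Suc j) t"
        using 1 by (cases j) (simp_all add: psi_def algebra_simps)
      ultimately show ?thesis by simp
    qed
    then show ?thesis
      by (rule has_field_derivative_transform_within_open[of _ _ _ "{0<..}"]) (use 1 in \<open>auto simp: psi_def\<close>)
  next
    case 2
    have "((\<lambda>t. 0) has_real_derivative (psi (j + 2) t - real j * psi (Suc j) t)) (at t)"
      using 2 by (simp add: psi_def)
    then show ?thesis
      by (rule has_field_derivative_transform_within_open[of _ _ _ "{..<0}"]) (use 2 in \<open>auto simp: psi_def\<close>)
  next
    case 3
    have "((\<lambda>h. psi j h / h) \<longlongrightarrow> 0) (at_right 0)"
    proof -
      have "((\<lambda>h::real. inverse h ^ Suc j / exp (inverse h)) \<longlongrightarrow> 0) (at_right 0)"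
        by (rule filterlim_compose[OF tendsto_power_div_exp_0 filterlim_inverse_at_top_right])
      then show ?thesis
        by (rule Lim_transform_eventually)
          (auto simp: eventually_at_filter psi_def exp_minus field_simps intro!: always_eventually)
    qed
    moreover have "((\<lambda>h. psi j h / h) \<longlongrightarrow> 0) (at_left 0)"
      by (rule Lim_transform_eventually[OF tendsto_const])
         (auto simp: eventually_at_filter psi_def intro!: always_eventually)
    ultimately have "((\<lambda>h. psi j h / h) \<longlongrightarrow> 0) (at 0)" by (intro filterlim_split_at)
    then show ?thesis using 3 by (simp add: DERIV_def psi_def)
  qed
qed

lemma psi_nonneg: "0 \<le> psi j t"
  by (simp add: psi_def)

lemma psi_le: "psi j t \<le> fact j"
proof (cases "t > 0")
  case True
  define u where "u = inverse t"
  have u: "0 < u" using True by (simp add: u_def)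
  have "(\<Sum>n\<in>{j}. u ^ n /\<^sub>R fact n) \<le> (\<Sum>n. u ^ n /\<^sub>R fact n)"
    by (rule sum_le_suminf) (use u summable_exp_generic[of u] in auto)
  then have "u ^ j / fact j \<le> exp u" by (simp add: exp_def field_simps)
  then have "u ^ j * exp (- u) \<le> fact j" by (simp add: exp_minus field_simps)
  then show ?thesis using True by (simp add: psi_def u_def mult.commute)
qed (simp add: psi_def)

text \<open>A class of functions that is closed under partial derivatives by construction; membership
  therefore gives derivatives of all orders.\<close>

inductive smooth :: "(real^2 \<Rightarrow> real) \<Rightarrow> bool" where
  const: "smooth (\<lambda>x. c)"
| psi: "smooth (\<lambda>x. psi j (a * x $ i + b))"
| add: "smooth f \<Longrightarrow> smooth g \<Longrightarrow> smooth (\<lambda>x. f x + g x)"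
| mult: "smooth f \<Longrightarrow> smooth g \<Longrightarrow> smooth (\<lambda>x. f x * g x)"

lemma smooth_derivative:
  assumes "smooth f"
  shows "\<exists>g. (\<forall>i. smooth (g i)) \<and> (\<forall>x. (f has_derivative (\<lambda>h. \<Sum>i\<in>UNIV. g i x * h $ i)) (at x))"
  using assms
proof (induction rule: smooth.induct)
  case (const c)
  then show ?case by (intro exI[of _ "\<lambda>i x. 0"]) (auto intro: smooth.const)
next
  case (psi j a i b)
  define g where "g = (\<lambda>k x. (psi (j + 2) (a * x $ i + b) + (- real j) * psi (Suc j) (a * x $ i + b)) *
    (a * (if k = i then 1 else 0)))"
  have "smooth (g k)" for k
    unfolding g_def by (intro smooth.intros)
  moreover have "((\<lambda>x. psi j (a * x $ i + b)) has_derivative (\<lambda>h. \<Sum>k\<in>UNIV. g k x * h $ k)) (at x)" for x :: "real^2"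
  proof -
    have "((\<lambda>x::real^2. a * x $ i + b) has_derivative (\<lambda>h. a * h $ i)) (at x)"
      by (auto intro!: derivative_eq_intros bounded_linear.has_derivative[OF bounded_linear_vec_nth])
    then have "((\<lambda>x. psi j (a * x $ i + b)) has_derivative
       (\<lambda>h. a * h $ i * (psi (j + 2) (a * x $ i + b) - real j * psi (Suc j) (a * x $ i + b)))) (at x)"
      by (rule DERIV_compose_FDERIV[OF psi_deriv])
    moreover have "(\<Sum>k\<in>UNIV. g k x * h $ k) =
       a * h $ i * (psi (j + 2) (a * x $ i + b) - real j * psi (Suc j) (a * x $ i + b))" for h
      by (simp add: g_def if_distrib[of "\<lambda>c. _ * c"] if_distrib[of "\<lambda>c. c * _"] cong: if_cong)
    ultimately show ?thesis by presburger
  qed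
  ultimately show ?case by (intro exI[of _ g]) blast
next
  case (add f1 f2)
  then obtain g1 g2 where g: "\<forall>i. smooth (g1 i)" "\<forall>i. smooth (g2 i)"
    "\<forall>x. (f1 has_derivative (\<lambda>h. \<Sum>i\<in>UNIV. g1 i x * h $ i)) (at x)"
    "\<forall>x. (f2 has_derivative (\<lambda>h. \<Sum>i\<in>UNIV. g2 i x * h $ i)) (at x)" by auto
  have "((\<lambda>x. f1 x + f2 x) has_derivative (\<lambda>h. \<Sum>i\<in>UNIV. (g1 i x + g2 i x) * h $ i)) (at x)" for x
    using has_derivative_add[OF g(3)[rule_format, of x] g(4)[rule_format, of x]]
    by (simp add: sum.distrib[symmetric] algebra_simps)
  then show ?case
    using g by (intro exI[of _ "\<lambda>i x. g1 i x + g2 i x"]) (auto intro: smooth.intros)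
next
  case (mult f1 f2)
  then obtain g1 g2 where g: "\<forall>i. smooth (g1 i)" "\<forall>i. smooth (g2 i)"
    "\<forall>x. (f1 has_derivative (\<lambda>h. \<Sum>i\<in>UNIV. g1 i x * h $ i)) (at x)"
    "\<forall>x. (f2 has_derivative (\<lambda>h. \<Sum>i\<in>UNIV. g2 i x * h $ i)) (at x)" by auto
  have "((\<lambda>x. f1 x * f2 x) has_derivative (\<lambda>h. \<Sum>i\<in>UNIV. (f1 x * g2 i x + g1 i x * f2 x) * h $ i)) (at x)" for x
    using has_derivative_mult[OF g(3)[rule_format, of x] g(4)[rule_format, of x]]
    by (simp add: sum.distrib[symmetric] sum_distrib_left sum_distrib_right algebra_simps)
  then show ?case
    using g mult by (intro exI[of _ "\<lambda>i x. f1 x * g2 i x + g1 i x * f2 x"]) (auto intro!: smooth.intros)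
qed

lemma smooth_partial:
  assumes "smooth f"
  shows "smooth (partial i f)"
    and "(f has_derivative (\<lambda>h. \<Sum>i\<in>UNIV. partial i f x * h $ i)) (at x)"
proof -
  obtain g where g: "\<forall>i. smooth (g i)" and gd: "\<And>x. (f has_derivative (\<lambda>h. \<Sum>i\<in>UNIV. g i x * h $ i)) (at x)"
    using smooth_derivative[OF assms] by auto
  have eq: "partial i f = g i" for i
  proof
    fix x
    have "partial i f x = (\<Sum>k\<in>UNIV. g k x * axis i 1 $ k)"
      unfolding partial_def frechet_derivative_at[OF gd[of x], symmetric] ..
    then show "partial i f x = g i x"
      by (simp add: axis_def if_distrib[of "\<lambda>c. _ * c"] cong: if_cong)
  qed
  show "smooth (partial i f)" "(f has_derivative (\<lambda>h. \<Sum>i\<in>UNIV. partial i f x * h $ i)) (at x)"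
    unfolding eq using g gd by blast+
qed

lemma smooth_continuous: "smooth f \<Longrightarrow> continuous_on UNIV f"
  by (rule continuous_at_imp_continuous_on) (use smooth_partial(2) has_derivative_continuous in blast)

lemma smooth_borel [measurable_dest]: "smooth f \<Longrightarrow> f \<in> borel_measurable borel"
  using smooth_continuous borel_measurable_continuous_onI by blast

lemma smooth_C_k: "smooth f \<Longrightarrow> C_k k f"
proof (induction k arbitrary: f)
  case (Suc k)
  have "f differentiable (at x)" for x
    unfolding differentiable_def using smooth_partial(2)[OF Suc.prems] by blast
  then show ?case using Suc.IH smooth_partial(1)[OF Suc.prems] by simp
qed (simp add: smooth_continuous)

lemma smooth_bounded: "smooth f \<Longrightarrow> \<exists>C. \<forall>x. \<bar>f x\<bar> \<le> C"
proof (induction rule: smooth.induct)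
  case (psi j a i b)
  then show ?case using psi_le psi_nonneg by (metis abs_of_nonneg)
next
  case (add f g)
  then obtain C D where "\<forall>x. \<bar>f x\<bar> \<le> C" "\<forall>x. \<bar>g x\<bar> \<le> D" by auto
  then have "\<bar>f x + g x\<bar> \<le> C + D" for x by (meson abs_triangle_ineq add_mono order_trans)
  then show ?case by blast
next
  case (mult f g)
  then obtain C D where "\<forall>x. \<bar>f x\<bar> \<le> C" "\<forall>x. \<bar>g x\<bar> \<le> D" by auto
  then have "\<bar>f x * g x\<bar> \<le> C * D" for x
    unfolding abs_mult by (intro mult_mono) (auto intro: order_trans[OF abs_ge_zero])
  then show ?case by blast
qed auto

lemma smooth_translate: "smooth f \<Longrightarrow> smooth (\<lambda>x. f (x - v))"
proof (induction rule: smooth.induct)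
  case (psi j a i b)
  have "smooth (\<lambda>x. psi j (a * x $ i + (b - a * v $ i)))" by (rule smooth.psi)
  then show ?case by (simp add: algebra_simps)
qed (auto intro: smooth.intros)

lemma partial_translate:
  assumes "smooth f" shows "partial i (\<lambda>x. f (x - v)) x = partial i f (x - v)"
proof -
  have "((\<lambda>x. x - v) has_derivative (\<lambda>h. h)) (at x)" by (auto intro!: derivative_eq_intros)
  then have d: "((\<lambda>x. f (x - v)) has_derivative (\<lambda>h. \<Sum>i\<in>UNIV. partial i f (x - v) * h $ i)) (at x)"
    by (rule has_derivative_compose) (rule smooth_partial(2)[OF assms])
  have "partial i (\<lambda>x. f (x - v)) x = (\<Sum>k\<in>UNIV. partial k f (x - v) * axis i 1 $ k)"
    unfolding partial_def[of i "\<lambda>x. f (x - v)"] frechet_derivative_at[OF d, symmetric] ..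
  then show ?thesis by (simp add: axis_def if_distrib[of "\<lambda>c. _ * c"] cong: if_cong)
qed

text \<open>Products of factors \<open>exp (- 1 / ((n + 1) t))\<close>, where \<open>t\<close> is the distance of a coordinate to an end of
  its interval.  Dividing the exponent by \<open>n + 1\<close> makes the bumps converge to the indicator of the box.\<close>

definition bump :: "nat \<Rightarrow> real^2 \<Rightarrow> real^2 \<Rightarrow> real^2 \<Rightarrow> real" where
  "bump n a b x =
     psi 0 (real (Suc n) * x $ 1 + - (real (Suc n) * a $ 1)) * psi 0 ((- real (Suc n)) * x $ 1 + real (Suc n) * b $ 1) *
    (psi 0 (real (Suc n) * x $ 2 + - (real (Suc n) * a $ 2)) * psi 0 ((- real (Suc n)) * x $ 2 + real (Suc n) * b $ 2))"

lemma smooth_bump: "smooth (bump n a b)"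
proof -
  have "smooth (\<lambda>x. bump n a b x)" unfolding bump_def by (intro smooth.psi smooth.mult)
  then show ?thesis by simp
qed

lemma bump_alt: "bump n a b x =
     psi 0 (real (Suc n) * (x $ 1 - a $ 1)) * psi 0 (real (Suc n) * (b $ 1 - x $ 1)) *
    (psi 0 (real (Suc n) * (x $ 2 - a $ 2)) * psi 0 (real (Suc n) * (b $ 2 - x $ 2)))"
  by (simp add: bump_def algebra_simps)

lemma mem_box2: "x \<in> box a b \<longleftrightarrow> a $ 1 < x $ 1 \<and> x $ 1 < b $ 1 \<and> a $ 2 < x $ 2 \<and> x $ 2 < b $ 2"
  for x :: "real^2"
  by (auto simp: mem_box_cart forall_2)

lemma bump_bounds: "0 \<le> bump n a b x" "bump n a b x \<le> 1" "bump n a b x \<noteq> 0 \<Longrightarrow> x \<in> box a b"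
proof -
  have p: "0 \<le> psi 0 t" "psi 0 t \<le> 1" for t using psi_nonneg psi_le[of 0] by auto
  show "0 \<le> bump n a b x" unfolding bump_alt by (intro mult_nonneg_nonneg p)
  show "bump n a b x \<le> 1" unfolding bump_alt by (intro mult_le_one mult_nonneg_nonneg p)
  show "bump n a b x \<noteq> 0 \<Longrightarrow> x \<in> box a b"
    unfolding bump_alt mem_box2 by (auto simp: psi_def zero_less_mult_iff split: if_splits)
qed

lemma bump_tendsto: "(\<lambda>n. bump n a b x) \<longlonglongrightarrow> indicator (box a b) x"
proof (cases "x \<in> box a b")
  case True
  have *: "(\<lambda>n. psi 0 (real (Suc n) * u)) \<longlonglongrightarrow> 1" if "u > 0" for u
  proof -
    have "(\<lambda>n. exp (- inverse u * inverse (real (Suc n)))) \<longlonglongrightarrow> exp (- inverse u * 0)"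
      by (intro tendsto_intros LIMSEQ_inverse_real_of_nat)
    then show ?thesis using that by (simp add: psi_def inverse_mult_distrib mult.commute)
  qed
  have "(\<lambda>n. bump n a b x) \<longlonglongrightarrow> 1 * 1 * (1 * 1)"
    unfolding bump_alt by (intro tendsto_mult *) (use True in \<open>auto simp: mem_box2\<close>)
  then show ?thesis using True by simp
next
  case False
  then have "bump n a b x = 0" for n using bump_bounds(3) by blast
  then show ?thesis using False by simp
qed

section \<open>Differences of weakly differentiable functions\<close>

lemma translate_integral:
  fixes u :: "real^2 \<Rightarrow> 'b::{banach, second_countable_topology}"
  assumes "u \<in> borel_measurable borel"
  shows "(\<integral>x. u (x + h) \<partial>lborel) = (\<integral>x. u x \<partial>lborel)"
proof -
  have "(\<integral>x. u x \<partial>lborel) = (\<integral>x. u x \<partial>distr lborel borel ((+) h))" by (simp add: lborel_distr_plus)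
  also have "\<dots> = (\<integral>x. u (h + x) \<partial>lborel)" using assms by (intro integral_distr) auto
  finally show ?thesis by (simp add: add.commute)
qed

lemma translate_integrable:
  fixes u :: "real^2 \<Rightarrow> 'b::{banach, second_countable_topology}"
  assumes "integrable lborel u"
  shows "integrable lborel (\<lambda>x. u (x + h))"
proof -
  have "integrable (distr lborel borel ((+) h)) u" using assms by (simp add: lborel_distr_plus)
  then have "integrable lborel (\<lambda>x. u (h + x))"
    using assms by (subst (asm) integrable_distr_eq) auto
  then show ?thesis by (simp add: add.commute)
qed

lemma integrable_mult_bounded:
  fixes u \<phi> :: "'a::euclidean_space \<Rightarrow> real"
  assumes "integrable lborel u" "\<phi> \<in> borel_measurable borel" "\<And>x. \<bar>\<phi> x\<bar> \<le> C"
  shows "integrable lborel (\<lambda>x. u x * \<phi> x)"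
proof (rule Bochner_Integration.integrable_bound[of _ "\<lambda>x. C * u x"])
  show "integrable lborel (\<lambda>x. C * u x)" using assms by simp
  show "(\<lambda>x. u x * \<phi> x) \<in> borel_measurable lborel" using assms by measurable
  have "\<bar>u x * \<phi> x\<bar> \<le> \<bar>C * u x\<bar>" for x
  proof -
    have "\<bar>u x\<bar> * \<bar>\<phi> x\<bar> \<le> \<bar>u x\<bar> * \<bar>C\<bar>" using assms(3)[of x] by (intro mult_left_mono) auto
    then show ?thesis by (simp add: abs_mult mult.commute)
  qed
  then show "AE x in lborel. norm (u x * \<phi> x) \<le> norm (C * u x)" by simp
qed

lemma test_translate:
  assumes "smooth \<phi>" "{x. \<phi> x \<noteq> 0} \<subseteq> cbox a b" "\<And>x. x \<in> cbox a b \<Longrightarrow> x + v \<in> \<Omega>"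
  shows "(\<lambda>x. \<phi> (x - v)) \<in> test_functions \<Omega>"
proof -
  have sub: "closure {x. \<phi> (x - v) \<noteq> 0} \<subseteq> (+) v ` cbox a b"
  proof (rule closure_minimal)
    show "{x. \<phi> (x - v) \<noteq> 0} \<subseteq> (+) v ` cbox a b"
    proof
      fix x assume "x \<in> {x. \<phi> (x - v) \<noteq> 0}"
      then have "x - v \<in> cbox a b" using assms(2) by blast
      then show "x \<in> (+) v ` cbox a b" by (intro image_eqI[of _ _ "x - v"]) auto
    qed
    show "closed ((+) v ` cbox a b)" by (intro compact_imp_closed compact_translation compact_cbox)
  qed
  have "compact (closure {x. \<phi> (x - v) \<noteq> 0})"
    using sub compact_translation[OF compact_cbox] by (metis bounded_subset closed_closure compact_eq_bounded_closed)
  moreover have "closure {x. \<phi> (x - v) \<noteq> 0} \<subseteq> \<Omega>"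
    using sub assms(3) by (auto simp: add.commute)
  ultimately show ?thesis
    using smooth_C_k[OF smooth_translate[OF assms(1)]] by (simp add: test_functions_def)
qed

text \<open>The difference of a function along \<open>h\<close>, as predicted by its gradient \<open>g\<close>.\<close>

definition slope :: "(real^2 \<Rightarrow> real^2) \<Rightarrow> real^2 \<Rightarrow> real^2 \<Rightarrow> real" where
  "slope g h x = (\<integral>t. indicator {0..1} t * (h \<bullet> g (x + t *\<^sub>R h)) \<partial>lborel)"

context
  fixes \<Omega> :: "(real^2) set" and f :: "real^2 \<Rightarrow> real" and g :: "real^2 \<Rightarrow> real^2"
  assumes f: "integrable lborel f" and g: "integrable lborel g"
    and weak: "\<And>\<phi> i. \<phi> \<in> test_functions \<Omega> \<Longrightarrow>
      (\<integral>x. f x * partial i \<phi> x \<partial>lborel) = - (\<integral>x. g x $ i * \<phi> x \<partial>lborel)"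
begin

lemma g_nth: "integrable lborel (\<lambda>x. g x $ i)"
  by (rule integrable_bounded_linear[OF bounded_linear_vec_nth g])

lemma f_borel: "f \<in> borel_measurable borel"
  using borel_measurable_integrable[OF f] by simp

lemma g_borel: "g \<in> borel_measurable borel"
  using borel_measurable_integrable[OF g] by simp

lemma slope_product:
  "integrable (lborel \<Otimes>\<^sub>M lborel) (\<lambda>(t, x). indicator {0..1::real} t * (h \<bullet> g (x + t *\<^sub>R h)))"
proof (rule lborel_pair.Fubini_integrable)
  note [measurable] = f_borel g_borel
  have hg: "integrable lborel (\<lambda>x. h \<bullet> g x)"
    by (rule integrable_bounded_linear[OF bounded_linear_inner_right g])
  show "(\<lambda>(t, x). indicator {0..1} t * (h \<bullet> g (x + t *\<^sub>R h))) \<in> borel_measurable (lborel \<Otimes>\<^sub>M lborel)"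
    by measurable
  show "AE t in lborel. integrable lborel (\<lambda>x. case (t, x) of (t, x) \<Rightarrow> indicator {0..1} t * (h \<bullet> g (x + t *\<^sub>R h)))"
    using translate_integrable[OF hg] by simp
  have "(\<integral>x. norm (indicator {0..1} t * (h \<bullet> g (x + t *\<^sub>R h))) \<partial>lborel) =
      indicator {0..1} t * (\<integral>x. \<bar>h \<bullet> g x\<bar> \<partial>lborel)" for t :: real
    using translate_integral[of "\<lambda>x. \<bar>h \<bullet> g x\<bar>" "t *\<^sub>R h"] by (simp add: abs_mult indicator_def)
  then show "integrable lborel (\<lambda>t. \<integral>x. norm (case (t, x) of (t, x) \<Rightarrow> indicator {0..1} t * (h \<bullet> g (x + t *\<^sub>R h))) \<partial>lborel)"
    by simp
qed

lemma slope_integrable: "integrable lborel (slope g h)"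
  unfolding slope_def using lborel_pair.integrable_snd[OF slope_product[of h]] .

text \<open>The difference quotient is moved to the test function, which is smooth: there it is the integral
  of a directional derivative over translates, each of which is again a test function.\<close>

lemma difference_tested:
  assumes \<phi>: "smooth \<phi>" "{x. \<phi> x \<noteq> 0} \<subseteq> cbox a b"
    and in\<Omega>: "\<And>t x. 0 \<le> t \<Longrightarrow> t \<le> 1 \<Longrightarrow> x \<in> cbox a b \<Longrightarrow> x + t *\<^sub>R h \<in> \<Omega>"
  shows "(\<integral>x. (f (x + h) - f x) * \<phi> x \<partial>lborel) = (\<integral>x. slope g h x * \<phi> x \<partial>lborel)"
proof -
  note [measurable] = f_borel g_borel
  define D where "D = (\<lambda>x. \<Sum>i\<in>UNIV. h $ i * partial i \<phi> x)"
  have smD: "smooth (partial i \<phi>)" for i using smooth_partial(1)[OF \<phi>(1)] .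
  have [measurable]: "\<phi> \<in> borel_measurable borel" "partial i \<phi> \<in> borel_measurable borel" for i
    using smooth_borel \<phi>(1) smD by auto
  have [measurable]: "D \<in> borel_measurable borel" unfolding D_def by measurable
  obtain C where C: "\<And>x. \<bar>\<phi> x\<bar> \<le> C" using smooth_bounded[OF \<phi>(1)] by blast
  have "\<exists>C. \<forall>x. \<bar>partial i \<phi> x\<bar> \<le> C" for i using smooth_bounded[OF smD] .
  then obtain Ci where Ci: "\<And>i x. \<bar>partial i \<phi> x\<bar> \<le> Ci i" by metis
  define CD where "CD = (\<Sum>i\<in>UNIV. \<bar>h $ i\<bar> * Ci i)"
  have CD: "\<bar>D x\<bar> \<le> CD" for x
    unfolding D_def CD_def
    by (rule order_trans[OF sum_abs]) (auto intro!: sum_mono mult_left_mono Ci simp: abs_mult)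
  have CD0: "0 \<le> CD" using CD[of 0] by linarith
  have contD: "continuous_on UNIV D"
    unfolding D_def by (intro continuous_intros smooth_continuous smD)
  have hg: "integrable lborel (\<lambda>x. h \<bullet> g x)"
    by (rule integrable_bounded_linear[OF bounded_linear_inner_right g])
  have step: "(\<integral>x. f x * D (x - t *\<^sub>R h) \<partial>lborel) = - (\<integral>x. (h \<bullet> g (x + t *\<^sub>R h)) * \<phi> x \<partial>lborel)"
    if t: "0 \<le> t" "t \<le> 1" for t
  proof -
    define \<phi>t where "\<phi>t = (\<lambda>x. \<phi> (x - t *\<^sub>R h))"
    have test: "\<phi>t \<in> test_functions \<Omega>"
      unfolding \<phi>t_def using \<phi> by (rule test_translate) (use in\<Omega> t in auto)
    have [measurable]: "\<phi>t \<in> borel_measurable borel" unfolding \<phi>t_def by measurable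
    have i1: "integrable lborel (\<lambda>x. f x * partial i \<phi> (x - t *\<^sub>R h))" for i
      by (rule integrable_mult_bounded[OF f _ Ci]) measurable
    have i2: "integrable lborel (\<lambda>x. g x $ i * \<phi>t x)" for i
      by (rule integrable_mult_bounded[OF g_nth, of _ C]) (auto simp: \<phi>t_def C)
    have "(\<integral>x. f x * D (x - t *\<^sub>R h) \<partial>lborel) = (\<integral>x. (\<Sum>i\<in>UNIV. h $ i * (f x * partial i \<phi> (x - t *\<^sub>R h))) \<partial>lborel)"
      by (simp add: D_def sum_distrib_left algebra_simps)
    also have "\<dots> = (\<Sum>i\<in>UNIV. h $ i * (\<integral>x. f x * partial i \<phi> (x - t *\<^sub>R h) \<partial>lborel))"
      using i1 by (subst Bochner_Integration.integral_sum) auto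
    also have "\<dots> = (\<Sum>i\<in>UNIV. h $ i * - (\<integral>x. g x $ i * \<phi>t x \<partial>lborel))"
      using weak[OF test] partial_translate[OF \<phi>(1)] by (simp add: \<phi>t_def)
    also have "\<dots> = - (\<Sum>i\<in>UNIV. (\<integral>x. h $ i * (g x $ i * \<phi>t x) \<partial>lborel))"
      by (simp add: sum_negf)
    also have "\<dots> = - (\<integral>x. (\<Sum>i\<in>UNIV. h $ i * (g x $ i * \<phi>t x)) \<partial>lborel)"
      using i2 by (subst Bochner_Integration.integral_sum) auto
    also have "\<dots> = - (\<integral>x. (h \<bullet> g x) * \<phi>t x \<partial>lborel)"
      by (simp add: inner_vec_def sum_distrib_right mult.assoc)
    also have "\<dots> = - (\<integral>x. (h \<bullet> g (x + t *\<^sub>R h)) * \<phi>t (x + t *\<^sub>R h) \<partial>lborel)"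
      using translate_integral[of "\<lambda>x. (h \<bullet> g x) * \<phi>t x" "t *\<^sub>R h"] by simp
    finally show ?thesis by (simp add: \<phi>t_def)
  qed
  have prod1: "integrable (lborel \<Otimes>\<^sub>M lborel) (\<lambda>(t, x). indicator {0..1::real} t * (f x * D (x - t *\<^sub>R h)))"
  proof (rule lborel_pair.Fubini_integrable)
    show "(\<lambda>(t, x). indicator {0..1} t * (f x * D (x - t *\<^sub>R h))) \<in> borel_measurable (lborel \<Otimes>\<^sub>M lborel)"
      by measurable
    have fD: "integrable lborel (\<lambda>x. f x * D (x - t *\<^sub>R h))" for t
      by (rule integrable_mult_bounded[OF f _ CD]) measurable
    then show "AE t in lborel. integrable lborel (\<lambda>x. case (t, x) of (t, x) \<Rightarrow> indicator {0..1} t * (f x * D (x - t *\<^sub>R h)))"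
      by simp
    show "integrable lborel (\<lambda>t. \<integral>x. norm (case (t, x) of (t, x) \<Rightarrow> indicator {0..1} t * (f x * D (x - t *\<^sub>R h))) \<partial>lborel)"
    proof (rule Bochner_Integration.integrable_bound[of _ "\<lambda>t. indicator {0..1} t *\<^sub>R (CD * (\<integral>x. \<bar>f x\<bar> \<partial>lborel))"])
      show "integrable lborel (\<lambda>t::real. indicator {0..1} t *\<^sub>R (CD * (\<integral>x. \<bar>f x\<bar> \<partial>lborel)))"
        by (intro integrable_scaleR_left) simp
      show "(\<lambda>t. \<integral>x. norm (case (t, x) of (t, x) \<Rightarrow> indicator {0..1} t * (f x * D (x - t *\<^sub>R h))) \<partial>lborel) \<in> borel_measurable lborel"
        by measurable
      have "norm (\<integral>x. norm (indicator {0..1} t * (f x * D (x - t *\<^sub>R h))) \<partial>lborel)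
          \<le> norm (indicator {0..1} t *\<^sub>R (CD * (\<integral>x. \<bar>f x\<bar> \<partial>lborel)))" for t :: real
      proof -
        have "(\<integral>x. \<bar>f x * D (x - t *\<^sub>R h)\<bar> \<partial>lborel) \<le> (\<integral>x. CD * \<bar>f x\<bar> \<partial>lborel)"
        proof (rule integral_mono)
          show "\<bar>f x * D (x - t *\<^sub>R h)\<bar> \<le> CD * \<bar>f x\<bar>" for x
            using mult_left_mono[OF CD, of "\<bar>f x\<bar>" "x - t *\<^sub>R h"] by (simp add: abs_mult mult.commute)
        qed (use fD f in auto)
        then show ?thesis using CD0 by (auto simp: indicator_def abs_mult)
      qed
      then show "AE t in lborel. norm (\<integral>x. norm (case (t, x) of (t, x) \<Rightarrow> indicator {0..1} t * (f x * D (x - t *\<^sub>R h))) \<partial>lborel)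
          \<le> norm (indicator {0..1} t *\<^sub>R (CD * (\<integral>x. \<bar>f x\<bar> \<partial>lborel)))" by simp
    qed
  qed
  have ftc: "(\<integral>t. indicator {0..1} t * D (x - t *\<^sub>R h) \<partial>lborel) = \<phi> x - \<phi> (x - h)" for x
  proof -
    have d: "((\<lambda>t. - \<phi> (x - t *\<^sub>R h)) has_real_derivative D (x - t *\<^sub>R h)) (at t)" for t
    proof -
      have "((\<lambda>t. x - t *\<^sub>R h) has_derivative (\<lambda>s. - (s *\<^sub>R h))) (at t)"
        by (auto intro!: derivative_eq_intros)
      then have "((\<lambda>t. \<phi> (x - t *\<^sub>R h)) has_derivative
          (\<lambda>s. \<Sum>i\<in>UNIV. partial i \<phi> (x - t *\<^sub>R h) * (- (s *\<^sub>R h)) $ i)) (at t)"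
        by (rule has_derivative_compose) (rule smooth_partial(2)[OF \<phi>(1)])
      then have "((\<lambda>t. - \<phi> (x - t *\<^sub>R h)) has_derivative
          (\<lambda>s. - (\<Sum>i\<in>UNIV. partial i \<phi> (x - t *\<^sub>R h) * (- (s *\<^sub>R h)) $ i))) (at t)"
        by (rule has_derivative_minus)
      moreover have "(\<lambda>s. - (\<Sum>i\<in>UNIV. partial i \<phi> (x - t *\<^sub>R h) * (- (s *\<^sub>R h)) $ i)) = (*) (D (x - t *\<^sub>R h))"
        by (rule ext) (simp add: D_def sum_distrib_left sum_negf[symmetric] algebra_simps)
      ultimately show ?thesis by (simp add: has_field_derivative_def)
    qed
    have "(\<integral>t. D (x - t *\<^sub>R h) * indicator {0..1} t \<partial>lborel) = - \<phi> (x - 1 *\<^sub>R h) - - \<phi> (x - 0 *\<^sub>R h)"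
    proof (rule integral_FTC_Icc_real)
      show "DERIV (\<lambda>t. - \<phi> (x - t *\<^sub>R h)) t :> D (x - t *\<^sub>R h)" for t by (rule d)
      have "continuous_on UNIV (\<lambda>t. D (x - t *\<^sub>R h))"
        by (rule continuous_on_compose2[OF contD]) (auto intro!: continuous_intros)
      then show "isCont (\<lambda>t. D (x - t *\<^sub>R h)) t" for t by (simp add: continuous_on_eq_continuous_at)
    qed simp
    then show ?thesis by (simp add: mult.commute)
  qed
  have fb: "integrable lborel (\<lambda>x. f x * \<phi> (x - v))" for v
    by (rule integrable_mult_bounded[OF f _ C]) measurable
  have fh: "integrable lborel (\<lambda>x. f (x + h) * \<phi> x)" "integrable lborel (\<lambda>x. f x * \<phi> x)"
    by (rule integrable_mult_bounded[OF translate_integrable[OF f] _ C], measurable)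
       (rule integrable_mult_bounded[OF f _ C], measurable)
  have "(\<integral>x. (f (x + h) - f x) * \<phi> x \<partial>lborel) = (\<integral>x. f (x + h) * \<phi> x \<partial>lborel) - (\<integral>x. f x * \<phi> x \<partial>lborel)"
    using fh by (simp add: left_diff_distrib)
  also have "(\<integral>x. f (x + h) * \<phi> x \<partial>lborel) = (\<integral>x. f x * \<phi> (x - h) \<partial>lborel)"
    using translate_integral[of "\<lambda>x. f x * \<phi> (x - h)" h] by simp
  also have "(\<integral>x. f x * \<phi> (x - h) \<partial>lborel) - (\<integral>x. f x * \<phi> x \<partial>lborel) =
      - (\<integral>x. f x * (\<phi> x - \<phi> (x - h)) \<partial>lborel)"
    using fb[of h] fb[of 0] by (simp add: right_diff_distrib)
  also have "(\<integral>x. f x * (\<phi> x - \<phi> (x - h)) \<partial>lborel) =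
      (\<integral>x. (\<integral>t. indicator {0..1} t * (f x * D (x - t *\<^sub>R h)) \<partial>lborel) \<partial>lborel)"
    by (simp add: ftc[symmetric] mult.left_commute)
  also have "\<dots> = (\<integral>t. (\<integral>x. indicator {0..1} t * (f x * D (x - t *\<^sub>R h)) \<partial>lborel) \<partial>lborel)"
    using lborel_pair.Fubini_integral[OF prod1] by simp
  also have "\<dots> = (\<integral>t. indicator {0..1} t * - (\<integral>x. (h \<bullet> g (x + t *\<^sub>R h)) * \<phi> x \<partial>lborel) \<partial>lborel)"
    by (rule Bochner_Integration.integral_cong) (auto simp: step indicator_def)
  also have "- \<dots> = (\<integral>t. (\<integral>x. indicator {0..1} t * (h \<bullet> g (x + t *\<^sub>R h)) * \<phi> x \<partial>lborel) \<partial>lborel)"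
    by (simp add: mult.assoc)
  also have "\<dots> = (\<integral>x. (\<integral>t. indicator {0..1} t * (h \<bullet> g (x + t *\<^sub>R h)) * \<phi> x \<partial>lborel) \<partial>lborel)"
  proof (rule lborel_pair.Fubini_integral[symmetric])
    show "integrable (lborel \<Otimes>\<^sub>M lborel) (\<lambda>(t, x). indicator {0..1::real} t * (h \<bullet> g (x + t *\<^sub>R h)) * \<phi> x)"
    proof (rule Bochner_Integration.integrable_bound[OF integrable_mult_right[OF slope_product[of h], of C]])
      show "(\<lambda>(t, x). indicator {0..1::real} t * (h \<bullet> g (x + t *\<^sub>R h)) * \<phi> x) \<in> borel_measurable (lborel \<Otimes>\<^sub>M lborel)"
        by measurable
      have "\<bar>y * \<phi> x\<bar> \<le> \<bar>C * y\<bar>" for x y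
      proof -
        have "\<bar>y\<bar> * \<bar>\<phi> x\<bar> \<le> \<bar>y\<bar> * \<bar>C\<bar>" using C[of x] by (intro mult_left_mono) auto
        then show ?thesis by (simp add: abs_mult mult.commute)
      qed
      then show "AE z in lborel \<Otimes>\<^sub>M lborel. norm (case z of (t, x) \<Rightarrow> indicator {0..1::real} t * (h \<bullet> g (x + t *\<^sub>R h)) * \<phi> x)
          \<le> norm (C * (case z of (t, x) \<Rightarrow> indicator {0..1} t * (h \<bullet> g (x + t *\<^sub>R h))))"
        by (intro always_eventually) (auto simp: split_beta)
    qed
  qed
  also have "\<dots> = (\<integral>x. slope g h x * \<phi> x \<partial>lborel)" by (simp add: slope_def)
  finally show ?thesis .
qed

text \<open>Bump functions converge to indicators of boxes, and the integrals over small boxes determine an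
  integrable function almost everywhere.\<close>

lemma difference_eq_slope:
  assumes D: "open D" "convex D" "D \<subseteq> \<Omega>"
  shows "AE x in lborel. x \<in> D \<and> x + h \<in> D \<longrightarrow> f (x + h) - f x = slope g h x"
proof -
  note [measurable] = f_borel g_borel
  define W where "W = {x. x \<in> D \<and> x + h \<in> D}"
  define r where "r = (\<lambda>x. f (x + h) - f x - slope g h x)"
  have ir: "integrable lborel r"
    unfolding r_def by (intro Bochner_Integration.integrable_diff translate_integrable f slope_integrable)
  have [measurable]: "r \<in> borel_measurable borel" using borel_measurable_integrable[OF ir] by simp
  have W: "open W"
  proof -
    have "W = D \<inter> (\<lambda>x. x + h) -` D" by (auto simp: W_def)
    then show ?thesis using D(1) by (auto intro!: open_Int open_vimage continuous_intros)
  qed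
  have box0: "integral (cbox a b) r = 0" if "cbox a b \<subseteq> W" for a b
  proof -
    have in\<Omega>: "x + t *\<^sub>R h \<in> \<Omega>" if "0 \<le> t" "t \<le> 1" "x \<in> cbox a b" for t x
    proof -
      have "x \<in> D" "x + h \<in> D" using that \<open>cbox a b \<subseteq> W\<close> by (auto simp: W_def)
      then have "(1 - t) *\<^sub>R x + t *\<^sub>R (x + h) \<in> D" using D(2) that by (intro convexD) auto
      then show ?thesis using D(3) by (auto simp: algebra_simps)
    qed
    have int0: "(\<integral>x. r x * bump n a b x \<partial>lborel) = 0" for n
    proof -
      have supp: "{x. bump n a b x \<noteq> 0} \<subseteq> cbox a b" using bump_bounds(3) box_subset_cbox by blast
      have b: "\<bar>bump n a b x\<bar> \<le> 1" for x using bump_bounds[of n a b x] by simp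
      have [measurable]: "bump n a b \<in> borel_measurable borel" using smooth_borel smooth_bump by blast
      have "(\<integral>x. r x * bump n a b x \<partial>lborel) =
         (\<integral>x. (f (x + h) - f x) * bump n a b x \<partial>lborel) - (\<integral>x. slope g h x * bump n a b x \<partial>lborel)"
        unfolding r_def left_diff_distrib[of _ "slope g h _"]
        by (intro Bochner_Integration.integral_diff integrable_mult_bounded[OF _ _ b]
            Bochner_Integration.integrable_diff translate_integrable f slope_integrable) measurable
      then show ?thesis using difference_tested[OF smooth_bump supp in\<Omega>] by simp
    qed
    have "(\<lambda>n. \<integral>x. r x * bump n a b x \<partial>lborel) \<longlonglongrightarrow> (\<integral>x. r x * indicator (box a b) x \<partial>lborel)"
    proof (rule integral_dominated_convergence[where w = "\<lambda>x. \<bar>r x\<bar>"])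
      show "(\<lambda>x. r x * indicator (box a b) x) \<in> borel_measurable lborel" by measurable
      show "(\<lambda>x. r x * bump n a b x) \<in> borel_measurable lborel" for n
        using smooth_borel[OF smooth_bump[of n a b]] by measurable
      show "integrable lborel (\<lambda>x. \<bar>r x\<bar>)" using ir by simp
      show "AE x in lborel. (\<lambda>n. r x * bump n a b x) \<longlonglongrightarrow> r x * indicator (box a b) x"
        by (intro always_eventually allI tendsto_mult tendsto_const bump_tendsto)
      show "AE x in lborel. norm (r x * bump n a b x) \<le> \<bar>r x\<bar>" for n
      proof (intro always_eventually allI)
        fix x show "norm (r x * bump n a b x) \<le> \<bar>r x\<bar>"
          using mult_left_mono[OF bump_bounds(2)[of n a b x], of "\<bar>r x\<bar>"] bump_bounds(1)[of n a b x]
          by (simp add: abs_mult)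
      qed
    qed
    then have "(\<integral>x. r x * indicator (box a b) x \<partial>lborel) = 0" by (simp add: int0 LIMSEQ_const_iff)
    moreover have "set_integrable lborel (box a b) r"
      unfolding set_integrable_def using ir by (intro integrable_mult_indicator) auto
    ultimately have "integral (box a b) r = 0"
      using set_borel_integral_eq_integral(2)[of "box a b" r]
      by (simp add: set_lebesgue_integral_def mult.commute)
    then show ?thesis by (simp add: integral_open_interval)
  qed
  have "r integrable_on cbox a b" for a b
    using integrable_on_subcbox[OF integrable_on_lborel[OF ir]] by simp
  then obtain N where N: "negligible N" "\<And>x e. \<lbrakk>x \<notin> N; 0 < e\<rbrakk> \<Longrightarrow>
      \<exists>d>0. \<forall>s. 0 < s \<and> s < d \<longrightarrow> norm (integral (cbox x (x + s *\<^sub>R One)) r /\<^sub>R s ^ DIM(real^2) - r x) < e"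
    using integrable_ccontinuous_explicit[of r] by blast
  have zero: "r x = 0" if x: "x \<notin> N" "x \<in> W" for x
  proof (rule ccontr)
    assume "r x \<noteq> 0"
    then obtain d where d: "d > 0" "\<And>s. 0 < s \<Longrightarrow> s < d \<Longrightarrow>
        norm (integral (cbox x (x + s *\<^sub>R One)) r /\<^sub>R s ^ DIM(real^2) - r x) < norm (r x)"
      using N(2)[OF x(1), of "norm (r x)"] by auto
    obtain e where e: "e > 0" "ball x e \<subseteq> W" using W x(2) open_contains_ball by blast
    define s where "s = min (d / 2) (e / 4)"
    have s: "0 < s" "s < d" "2 * s < e" using d(1) e(1) by (auto simp: s_def)
    have "cbox x (x + s *\<^sub>R One) \<subseteq> ball x e"
    proof
      fix y assume y: "y \<in> cbox x (x + s *\<^sub>R One)"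
      have "norm (y - x) \<le> (\<Sum>b\<in>Basis. \<bar>(y - x) \<bullet> b\<bar>)" by (rule norm_le_l1)
      also have "\<dots> \<le> (\<Sum>b\<in>(Basis::(real^2) set). s)"
      proof (rule sum_mono)
        fix b :: "real^2" assume b: "b \<in> Basis"
        then have "x \<bullet> b \<le> y \<bullet> b" "y \<bullet> b \<le> x \<bullet> b + s"
          using y by (auto simp: mem_box inner_simps)
        then show "\<bar>(y - x) \<bullet> b\<bar> \<le> s" by (simp add: inner_diff_left)
      qed
      also have "\<dots> < e" using s by simp
      finally show "y \<in> ball x e" by (simp add: dist_norm norm_minus_commute)
    qed
    then have "integral (cbox x (x + s *\<^sub>R One)) r = 0" using box0 e(2) by blast
    then show False using d(2)[OF s(1,2)] by simp
  qed
  have "N \<in> null_sets lebesgue" using N(1) by (simp add: negligible_iff_null_sets)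
  then have "AE x in lebesgue. x \<notin> N" by (rule AE_not_in)
  then have "AE x in lborel. x \<notin> N" by (simp add: AE_completion_iff)
  then show ?thesis
  proof (rule AE_mp, intro always_eventually allI impI)
    fix x assume "x \<notin> N" "x \<in> D \<and> x + h \<in> D"
    then have "r x = 0" using zero by (simp add: W_def)
    then show "f (x + h) - f x = slope g h x" by (simp add: r_def)
  qed
qed

end

section \<open>Oscillation integrals\<close>

definition osc :: "(real^2 \<Rightarrow> real) \<Rightarrow> (real^2) set \<Rightarrow> ennreal" where
  "osc f D = (\<integral>\<^sup>+x. (\<integral>\<^sup>+y. indicator D x * indicator D y * ennreal \<bar>f x - f y\<bar> \<partial>lborel) \<partial>lborel)"

lemma nn_integral_affine:
  fixes u :: "real^2 \<Rightarrow> ennreal"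
  assumes "c \<noteq> 0" and [measurable]: "u \<in> borel_measurable borel"
  shows "(\<integral>\<^sup>+y. u (v + c *\<^sub>R y) \<partial>lborel) = ennreal (1 / c^2) * (\<integral>\<^sup>+y. u y \<partial>lborel)"
proof -
  have "(\<integral>\<^sup>+y. u y \<partial>lborel) = (\<integral>\<^sup>+y. u y \<partial>density (distr lborel borel (\<lambda>x. v + c *\<^sub>R x)) (\<lambda>_. \<bar>c\<bar>^DIM(real^2)))"
    using lborel_affine[OF assms(1), of v] by simp
  also have "\<dots> = (\<integral>\<^sup>+y. ennreal (c^2) * u y \<partial>distr lborel borel (\<lambda>x. v + c *\<^sub>R x))"
    by (subst nn_integral_density) (auto simp: power2_eq_square ennreal_mult)
  also have "\<dots> = (\<integral>\<^sup>+y. ennreal (c^2) * u (v + c *\<^sub>R y) \<partial>lborel)"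
    by (subst nn_integral_distr) auto
  also have "\<dots> = ennreal (c^2) * (\<integral>\<^sup>+y. u (v + c *\<^sub>R y) \<partial>lborel)"
    by (rule nn_integral_cmult) measurable
  finally have "ennreal (1 / c^2) * (\<integral>\<^sup>+y. u y \<partial>lborel) =
      ennreal (1 / c^2) * (ennreal (c^2) * (\<integral>\<^sup>+y. u (v + c *\<^sub>R y) \<partial>lborel))" by simp
  also have "\<dots> = ennreal (1 / c^2 * c^2) * (\<integral>\<^sup>+y. u (v + c *\<^sub>R y) \<partial>lborel)"
    by (simp add: mult.assoc[symmetric] ennreal_mult[symmetric])
  finally show ?thesis using assms(1) by simp
qed

lemma norm_integral_le:
  fixes u :: "'a \<Rightarrow> 'b::{banach, second_countable_topology}"
  shows "ennreal (norm (\<integral>x. u x \<partial>M)) \<le> (\<integral>\<^sup>+x. ennreal (norm (u x)) \<partial>M)"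
  by (cases "integrable M u") (auto simp: integral_norm_bound_ennreal not_integrable_integral_eq)

text \<open>At a point of the segment from \<open>x\<close> to \<open>y\<close>, one of the two ends has a weight of at least one half.
  Substituting for this end costs a factor of at most four.\<close>

lemma convex_average:
  fixes N :: "real^2 \<Rightarrow> ennreal"
  assumes [measurable]: "N \<in> borel_measurable borel" and D: "open D" "convex D" and t: "0 \<le> t" "t \<le> 1"
  shows "(\<integral>\<^sup>+x. (\<integral>\<^sup>+y. indicator D x * indicator D y * N ((1 - t) *\<^sub>R x + t *\<^sub>R y) \<partial>lborel) \<partial>lborel)
     \<le> 4 * emeasure lborel D * (\<integral>\<^sup>+x. indicator D x * N x \<partial>lborel)"
proof -
  have [measurable]: "D \<in> sets borel" using D by auto
  define u where "u = (\<lambda>x. indicator D x * N x)"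
  have [measurable]: "u \<in> borel_measurable borel" unfolding u_def by measurable
  have inD: "(1 - t) *\<^sub>R x + t *\<^sub>R y \<in> D" if "x \<in> D" "y \<in> D" for x y
    using D(2) that t by (intro convexD) auto
  have inD': "t *\<^sub>R y + (1 - t) *\<^sub>R x \<in> D" if "x \<in> D" "y \<in> D" for x y
    using inD[OF that] by (simp add: add.commute)
  have inner: "(\<integral>\<^sup>+y. u (v + c *\<^sub>R y) \<partial>lborel) \<le> 4 * (\<integral>\<^sup>+y. u y \<partial>lborel)" if "1/2 \<le> c" for v c
  proof -
    have "1/4 \<le> c^2" using mult_mono[of "1/2" c "1/2" c] that by (simp add: power2_eq_square)
    then have "1 / c^2 \<le> 4" using that by (simp add: field_simps)
    then have "ennreal (1 / c^2) \<le> 4" by (metis ennreal_leI ennreal_numeral zero_le_numeral)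
    then show ?thesis using nn_integral_affine[of c u v] that by (simp add: mult_right_mono)
  qed
  have bound: "(\<integral>\<^sup>+x. (\<integral>\<^sup>+y. indicator D x * u (v x + c *\<^sub>R y) \<partial>lborel) \<partial>lborel)
      \<le> 4 * emeasure lborel D * (\<integral>\<^sup>+x. u x \<partial>lborel)"
    if c: "1/2 \<le> c" and [measurable]: "v \<in> borel_measurable borel" for v c
  proof -
    have "(\<integral>\<^sup>+x. (\<integral>\<^sup>+y. indicator D x * u (v x + c *\<^sub>R y) \<partial>lborel) \<partial>lborel) =
        (\<integral>\<^sup>+x. indicator D x * (\<integral>\<^sup>+y. u (v x + c *\<^sub>R y) \<partial>lborel) \<partial>lborel)"
      by (intro nn_integral_cong nn_integral_cmult) measurable
    also have "\<dots> \<le> (\<integral>\<^sup>+x. indicator D x * (4 * (\<integral>\<^sup>+y. u y \<partial>lborel)) \<partial>lborel)"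
      by (intro nn_integral_mono mult_left_mono inner c) simp
    also have "\<dots> = 4 * emeasure lborel D * (\<integral>\<^sup>+x. u x \<partial>lborel)"
      by (subst nn_integral_multc) (auto simp: mult_ac)
    finally show ?thesis .
  qed
  show ?thesis
  proof (cases "1/2 \<le> t")
    case True
    have "(\<integral>\<^sup>+x. (\<integral>\<^sup>+y. indicator D x * indicator D y * N ((1 - t) *\<^sub>R x + t *\<^sub>R y) \<partial>lborel) \<partial>lborel)
       \<le> (\<integral>\<^sup>+x. (\<integral>\<^sup>+y. indicator D x * u ((1 - t) *\<^sub>R x + t *\<^sub>R y) \<partial>lborel) \<partial>lborel)"
      by (intro nn_integral_mono) (auto simp: u_def indicator_def inD)
    also have "\<dots> \<le> 4 * emeasure lborel D * (\<integral>\<^sup>+x. u x \<partial>lborel)"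
      by (rule bound[OF True]) measurable
    finally show ?thesis by (simp add: u_def)
  next
    case False
    then have t': "1/2 \<le> 1 - t" by simp
    have "(\<integral>\<^sup>+x. (\<integral>\<^sup>+y. indicator D x * indicator D y * N ((1 - t) *\<^sub>R x + t *\<^sub>R y) \<partial>lborel) \<partial>lborel)
       = (\<integral>\<^sup>+y. (\<integral>\<^sup>+x. indicator D x * indicator D y * N ((1 - t) *\<^sub>R x + t *\<^sub>R y) \<partial>lborel) \<partial>lborel)"
      by (rule lborel_pair.Fubini'[symmetric]) measurable
    also have "\<dots> \<le> (\<integral>\<^sup>+y. (\<integral>\<^sup>+x. indicator D y * u (t *\<^sub>R y + (1 - t) *\<^sub>R x) \<partial>lborel) \<partial>lborel)"
      by (intro nn_integral_mono) (auto simp: u_def indicator_def inD' add.commute)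
    also have "\<dots> \<le> 4 * emeasure lborel D * (\<integral>\<^sup>+x. u x \<partial>lborel)"
      by (rule bound[OF t']) measurable
    finally show ?thesis by (simp add: u_def)
  qed
qed

lemma nn_translate:
  fixes u :: "real^2 \<Rightarrow> ennreal"
  assumes [measurable]: "u \<in> borel_measurable borel"
  shows "(\<integral>\<^sup>+y. u y \<partial>lborel) = (\<integral>\<^sup>+h. u (x + h) \<partial>lborel)"
  using nn_integral_affine[of 1 u x] by simp

text \<open>The Poincare inequality for convex sets, in the form of a double integral: the difference of two
  values is an integral of the gradient over the segment between them.\<close>

theorem osc_weak_gradient:
  fixes f :: "real^2 \<Rightarrow> real" and g :: "real^2 \<Rightarrow> real^2"
  assumes f: "integrable lborel f" and g: "integrable lborel g"
    and weak: "\<And>\<phi> i. \<phi> \<in> test_functions \<Omega> \<Longrightarrow>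
      (\<integral>x. f x * partial i \<phi> x \<partial>lborel) = - (\<integral>x. g x $ i * \<phi> x \<partial>lborel)"
    and D: "open D" "convex D" "D \<subseteq> \<Omega>" and d: "0 \<le> d" "\<And>x y. x \<in> D \<Longrightarrow> y \<in> D \<Longrightarrow> dist x y \<le> d"
  shows "osc f D \<le> ennreal (4 * d) * emeasure lborel D * (\<integral>\<^sup>+x. indicator D x * ennreal (norm (g x)) \<partial>lborel)"
proof -
  define N where "N = (\<lambda>x. ennreal (norm (g x)))"
  have [measurable]: "f \<in> borel_measurable borel" "g \<in> borel_measurable borel" "D \<in> sets borel"
    using borel_measurable_integrable[OF f] borel_measurable_integrable[OF g] D by auto
  have [measurable]: "N \<in> borel_measurable borel" unfolding N_def by measurable
  define I :: "real \<Rightarrow> ennreal" where "I = indicator {0..1}"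
  have [measurable]: "I \<in> borel_measurable borel" unfolding I_def by measurable
  have slope: "ennreal \<bar>slope g h x\<bar> \<le> ennreal d * (\<integral>\<^sup>+t. I t * N (x + t *\<^sub>R h) \<partial>lborel)" if "norm h \<le> d" for h x
  proof -
    have "ennreal \<bar>slope g h x\<bar> \<le> (\<integral>\<^sup>+t. ennreal (norm (indicator {0..1} t * (h \<bullet> g (x + t *\<^sub>R h)))) \<partial>lborel)"
      unfolding slope_def real_norm_def[symmetric] by (rule norm_integral_le)
    also have "\<dots> \<le> (\<integral>\<^sup>+t. ennreal d * (I t * N (x + t *\<^sub>R h)) \<partial>lborel)"
    proof (rule nn_integral_mono)
      fix t :: real
      have "\<bar>h \<bullet> g (x + t *\<^sub>R h)\<bar> \<le> norm h * norm (g (x + t *\<^sub>R h))" by (rule Cauchy_Schwarz_ineq2)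
      also have "\<dots> \<le> d * norm (g (x + t *\<^sub>R h))" using that by (intro mult_right_mono) auto
      finally show "ennreal (norm (indicator {0..1} t * (h \<bullet> g (x + t *\<^sub>R h)))) \<le> ennreal d * (I t * N (x + t *\<^sub>R h))"
        using d(1) by (auto simp: I_def N_def indicator_def ennreal_mult[symmetric] intro!: ennreal_leI)
    qed
    also have "\<dots> = ennreal d * (\<integral>\<^sup>+t. I t * N (x + t *\<^sub>R h) \<partial>lborel)" by (rule nn_integral_cmult) measurable
    finally show ?thesis .
  qed
  have "osc f D = (\<integral>\<^sup>+x. (\<integral>\<^sup>+h. indicator D x * indicator D (x + h) * ennreal \<bar>f x - f (x + h)\<bar> \<partial>lborel) \<partial>lborel)"
    unfolding osc_def by (intro nn_integral_cong nn_translate) measurable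
  also have "\<dots> = (\<integral>\<^sup>+h. (\<integral>\<^sup>+x. indicator D x * indicator D (x + h) * ennreal \<bar>f x - f (x + h)\<bar> \<partial>lborel) \<partial>lborel)"
    by (rule lborel_pair.Fubini'[symmetric]) measurable
  also have "\<dots> \<le> (\<integral>\<^sup>+h. (\<integral>\<^sup>+x. indicator D x * indicator D (x + h) *
      (ennreal d * (\<integral>\<^sup>+t. I t * N (x + t *\<^sub>R h) \<partial>lborel)) \<partial>lborel) \<partial>lborel)"
  proof (rule nn_integral_mono, rule nn_integral_mono_AE)
    fix h
    have "AE x in lborel. x \<in> D \<and> x + h \<in> D \<longrightarrow> f (x + h) - f x = slope g h x"
      by (rule difference_eq_slope[OF f g weak D])
    then show "AE x in lborel. indicator D x * indicator D (x + h) * ennreal \<bar>f x - f (x + h)\<bar> \<le>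
       indicator D x * indicator D (x + h) * (ennreal d * (\<integral>\<^sup>+t. I t * N (x + t *\<^sub>R h) \<partial>lborel))"
    proof (rule AE_mp, intro always_eventually allI impI)
      fix x assume *: "x \<in> D \<and> x + h \<in> D \<longrightarrow> f (x + h) - f x = slope g h x"
      show "indicator D x * indicator D (x + h) * ennreal \<bar>f x - f (x + h)\<bar> \<le>
         indicator D x * indicator D (x + h) * (ennreal d * (\<integral>\<^sup>+t. I t * N (x + t *\<^sub>R h) \<partial>lborel))"
      proof (cases "x \<in> D \<and> x + h \<in> D")
        case True
        then have "norm h \<le> d" using d(2)[of "x + h" x] by (simp add: dist_norm)
        moreover have "\<bar>f x - f (x + h)\<bar> = \<bar>slope g h x\<bar>"
          using * True by (metis abs_minus_commute)
        ultimately show ?thesis using slope[of h x] True by simp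
      qed auto
    qed
  qed
  also have "\<dots> = (\<integral>\<^sup>+x. (\<integral>\<^sup>+h. indicator D x * indicator D (x + h) *
      (ennreal d * (\<integral>\<^sup>+t. I t * N (x + t *\<^sub>R h) \<partial>lborel)) \<partial>lborel) \<partial>lborel)"
    by (rule lborel_pair.Fubini') measurable
  also have "\<dots> = (\<integral>\<^sup>+x. (\<integral>\<^sup>+y. indicator D x * indicator D y *
      (ennreal d * (\<integral>\<^sup>+t. I t * N (x + t *\<^sub>R (y - x)) \<partial>lborel)) \<partial>lborel) \<partial>lborel)"
  proof (rule nn_integral_cong)
    fix x
    have [measurable]: "(\<lambda>y. indicator D x * indicator D y *
        (ennreal d * (\<integral>\<^sup>+t. I t * N (x + t *\<^sub>R (y - x)) \<partial>lborel))) \<in> borel_measurable borel"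
      by measurable
    show "(\<integral>\<^sup>+h. indicator D x * indicator D (x + h) *
        (ennreal d * (\<integral>\<^sup>+t. I t * N (x + t *\<^sub>R h) \<partial>lborel)) \<partial>lborel) =
      (\<integral>\<^sup>+y. indicator D x * indicator D y *
        (ennreal d * (\<integral>\<^sup>+t. I t * N (x + t *\<^sub>R (y - x)) \<partial>lborel)) \<partial>lborel)"
      using nn_translate[of "\<lambda>y. indicator D x * indicator D y *
        (ennreal d * (\<integral>\<^sup>+t. I t * N (x + t *\<^sub>R (y - x)) \<partial>lborel))" x] by simp
  qed
  also have "\<dots> = (\<integral>\<^sup>+x. (\<integral>\<^sup>+y. (\<integral>\<^sup>+t. ennreal d * I t * (indicator D x * indicator D y *
       N ((1 - t) *\<^sub>R x + t *\<^sub>R y)) \<partial>lborel) \<partial>lborel) \<partial>lborel)"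
    by (intro nn_integral_cong, subst nn_integral_cmult[symmetric], measurable,
        subst nn_integral_cmult[symmetric], measurable) (simp add: algebra_simps)
  also have "\<dots> = (\<integral>\<^sup>+x. (\<integral>\<^sup>+t. (\<integral>\<^sup>+y. ennreal d * I t * (indicator D x * indicator D y *
       N ((1 - t) *\<^sub>R x + t *\<^sub>R y)) \<partial>lborel) \<partial>lborel) \<partial>lborel)"
    by (intro nn_integral_cong lborel_pair.Fubini') measurable
  also have "\<dots> = (\<integral>\<^sup>+t. (\<integral>\<^sup>+x. (\<integral>\<^sup>+y. ennreal d * I t * (indicator D x * indicator D y *
       N ((1 - t) *\<^sub>R x + t *\<^sub>R y)) \<partial>lborel) \<partial>lborel) \<partial>lborel)"
    by (rule lborel_pair.Fubini') measurable
  also have "\<dots> = (\<integral>\<^sup>+t. ennreal d * I t * (\<integral>\<^sup>+x. (\<integral>\<^sup>+y. indicator D x * indicator D y *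
       N ((1 - t) *\<^sub>R x + t *\<^sub>R y) \<partial>lborel) \<partial>lborel) \<partial>lborel)"
    by (simp add: nn_integral_cmult)
  also have "\<dots> \<le> (\<integral>\<^sup>+t. ennreal d * I t * (4 * emeasure lborel D * (\<integral>\<^sup>+x. indicator D x * N x \<partial>lborel)) \<partial>lborel)"
  proof (rule nn_integral_mono)
    fix t :: real
    show "ennreal d * I t * (\<integral>\<^sup>+x. (\<integral>\<^sup>+y. indicator D x * indicator D y *
       N ((1 - t) *\<^sub>R x + t *\<^sub>R y) \<partial>lborel) \<partial>lborel) \<le>
      ennreal d * I t * (4 * emeasure lborel D * (\<integral>\<^sup>+x. indicator D x * N x \<partial>lborel))"
      using convex_average[OF _ D(1,2), of N t] by (cases "0 \<le> t \<and> t \<le> 1") (auto simp: I_def intro: mult_left_mono)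
  qed
  also have "\<dots> = (\<integral>\<^sup>+t. ennreal d * (4 * emeasure lborel D * (\<integral>\<^sup>+x. indicator D x * N x \<partial>lborel)) * I t \<partial>lborel)"
    by (simp add: mult_ac)
  also have "\<dots> = ennreal d * (4 * emeasure lborel D * (\<integral>\<^sup>+x. indicator D x * N x \<partial>lborel))"
    by (subst nn_integral_cmult) (auto simp: I_def)
  also have "\<dots> = ennreal (4 * d) * emeasure lborel D * (\<integral>\<^sup>+x. indicator D x * N x \<partial>lborel)"
    using d(1) by (simp add: ennreal_mult mult_ac)
  finally show ?thesis by (simp add: N_def)
qed

section \<open>Young's inequality with an optimised parameter\<close>

text \<open>A form of Hoelder's inequality that is linear in the integrals, so that it applies under iterated
  integrals before the parameter is chosen.\<close>

lemma young_powr: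
  fixes u \<tau> p :: real
  assumes "0 \<le> u" "0 < \<tau>" "1 \<le> p"
  shows "u \<le> \<tau> + \<tau> powr (1 - p) * u powr p"
proof (cases "u \<le> \<tau>")
  case True
  then show ?thesis by (simp add: add_increasing2)
next
  case False
  have "u powr (1 - p) \<le> \<tau> powr (1 - p)" using False assms by (intro powr_mono2') auto
  then have "u powr (1 - p) * u powr p \<le> \<tau> powr (1 - p) * u powr p" by (rule mult_right_mono) simp
  moreover have "u powr (1 - p) * u powr p = u" using False assms by (simp add: powr_add[symmetric])
  ultimately show ?thesis using assms by linarith
qed

text \<open>Choosing the parameter so that both terms coincide recovers Hoelder's inequality up to the
  factor two.\<close>

lemma optimise_parameter:
  fixes c m \<nu> p :: real
  assumes X: "\<And>\<tau>. 0 < \<tau> \<Longrightarrow> X \<le> ennreal (c * (\<tau> * m + \<tau> powr (1 - p) * \<nu>))"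
    and c: "0 \<le> c" and m: "0 < m" and \<nu>: "0 \<le> \<nu>" and p: "1 < p"
  shows "X \<le> ennreal (2 * c * m powr (1 - 1/p) * \<nu> powr (1/p))"
proof (cases "\<nu> = 0")
  case True
  have "(\<lambda>n. ennreal (c * (inverse (real (Suc n)) * m))) \<longlonglongrightarrow> ennreal (c * (0 * m))"
    by (intro tendsto_intros LIMSEQ_inverse_real_of_nat)
  moreover have "X \<le> ennreal (c * (inverse (real (Suc n)) * m))" for n
    using X[of "inverse (real (Suc n))"] True by simp
  ultimately have "X \<le> ennreal (c * (0 * m))" by (intro LIMSEQ_le_const) auto
  then show ?thesis using True by simp
next
  case False
  then have \<nu>: "0 < \<nu>" using \<nu> by simp
  \<comment> \<open>The value at which \<open>\<tau> m = \<tau>\<^sup>1\<^sup>-\<^sup>p \<nu>\<close>.\<close>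
  define \<tau> where "\<tau> = \<nu> powr (1/p) * m powr (- (1/p))"
  have \<tau>: "0 < \<tau>" using \<nu> m by (simp add: \<tau>_def)
  have "\<tau> * m = \<nu> powr (1/p) * (m powr (- (1/p)) * m powr 1)" using m by (simp add: \<tau>_def)
  also have "\<dots> = \<nu> powr (1/p) * m powr (1 - 1/p)" by (simp only: powr_add[symmetric]) simp
  finally have 1: "\<tau> * m = m powr (1 - 1/p) * \<nu> powr (1/p)" by simp
  have "\<tau> powr (1 - p) * \<nu> = (\<nu> powr (1/p)) powr (1 - p) * (m powr (- (1/p))) powr (1 - p) * \<nu> powr 1"
    using \<nu> m by (simp add: \<tau>_def powr_mult)
  also have "\<dots> = (\<nu> powr ((1/p) * (1 - p)) * \<nu> powr 1) * m powr (- (1/p) * (1 - p))"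
    by (simp add: powr_powr mult_ac)
  also have "\<nu> powr ((1/p) * (1 - p)) * \<nu> powr 1 = \<nu> powr (1/p)"
    using p by (simp only: powr_add[symmetric]) (simp add: field_simps)
  also have "- (1/p) * (1 - p) = 1 - 1/p" using p by (simp add: field_simps)
  finally have 2: "\<tau> powr (1 - p) * \<nu> = m powr (1 - 1/p) * \<nu> powr (1/p)" by simp
  show ?thesis using X[OF \<tau>] unfolding 1 2 by (simp add: algebra_simps)
qed

section \<open>Sobolev and Slobodeckij seminorms control oscillation integrals\<close>

text \<open>An energy \<open>\<nu>\<close> with total \<open>V\<close> that bounds the oscillation integrals over shape regular convex sets with
  the scaling of a seminorm of smoothness \<open>s\<close> and integrability \<open>q\<close>.  The number \<open>\<kappa>\<close> bounds the square of the
  diameter by the area.\<close>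

definition controls ::
  "(real^2) set \<Rightarrow> real \<Rightarrow> real \<Rightarrow> real \<Rightarrow> real \<Rightarrow> (real^2 \<Rightarrow> real) \<Rightarrow> real \<Rightarrow> ((real^2) set \<Rightarrow> real) \<Rightarrow> bool"
where
  "controls \<Omega> \<kappa> s q K f V \<nu> \<longleftrightarrow> (\<forall>D. 0 \<le> \<nu> D) \<and>
     (\<forall>D D'. open D \<and> open D' \<and> D \<subseteq> D' \<and> D' \<subseteq> \<Omega> \<longrightarrow> \<nu> D \<le> \<nu> D') \<and>
     (\<forall>\<D>. finite \<D> \<and> disjoint \<D> \<and> (\<forall>D\<in>\<D>. open D \<and> D \<subseteq> \<Omega>) \<longrightarrow> sum \<nu> \<D> \<le> V) \<and>
     (\<forall>D. open D \<and> convex D \<and> D \<noteq> {} \<and> D \<subseteq> \<Omega> \<and>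
        (\<forall>x\<in>D. \<forall>y\<in>D. (dist x y)\<^sup>2 \<le> \<kappa> * measure lborel D) \<longrightarrow>
        osc f D \<le> ennreal (K * measure lborel D powr (2 + s/2 - 1/q) * \<nu> D powr (1/q)))"

definition energy_control ::
  "(real^2) set \<Rightarrow> real \<Rightarrow> real \<Rightarrow> real \<Rightarrow> real \<Rightarrow> (real^2 \<Rightarrow> real) \<Rightarrow> real \<Rightarrow> bool" where
  "energy_control \<Omega> \<kappa> s q K f V \<longleftrightarrow> (\<exists>\<nu>. controls \<Omega> \<kappa> s q K f V \<nu>)"

lemma finite_real_of_nn:
  assumes "X \<le> ennreal V" shows "ennreal (enn2real X) = X"
  using assms by (metis ennreal_enn2real ennreal_less_top order_le_less_trans)

text \<open>Energies given by densities.  The density may live on a different space, such as pairs of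
  points, as long as disjoint sets correspond to disjoint sets there.\<close>

lemma density_energy:
  fixes u :: "'a \<Rightarrow> ennreal" and S :: "(real^2) set \<Rightarrow> 'a set"
  assumes [measurable]: "u \<in> borel_measurable M" and tot: "(\<integral>\<^sup>+x. u x \<partial>M) \<le> ennreal V" and V: "0 \<le> V"
    and S: "\<And>D. open D \<Longrightarrow> S D \<in> sets M" "\<And>D D'. D \<subseteq> D' \<Longrightarrow> S D \<subseteq> S D'"
      "\<And>D D'. D \<inter> D' = {} \<Longrightarrow> S D \<inter> S D' = {}"
  defines "\<nu> \<equiv> \<lambda>D. enn2real (\<integral>\<^sup>+x. indicator (S D) x * u x \<partial>M)"
  shows "0 \<le> \<nu> D" "open D \<Longrightarrow> ennreal (\<nu> D) = (\<integral>\<^sup>+x. indicator (S D) x * u x \<partial>M)"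
    "D \<subseteq> D' \<Longrightarrow> \<nu> D \<le> \<nu> D'"
    "finite \<D> \<Longrightarrow> disjoint \<D> \<Longrightarrow> (\<forall>D\<in>\<D>. open D) \<Longrightarrow> sum \<nu> \<D> \<le> V"
proof -
  have le: "(\<integral>\<^sup>+x. indicator (S D) x * u x \<partial>M) \<le> ennreal V" for D
    by (rule order_trans[OF nn_integral_mono tot]) (auto simp: indicator_def)
  have eq: "ennreal (\<nu> D) = (\<integral>\<^sup>+x. indicator (S D) x * u x \<partial>M)" for D
    unfolding \<nu>_def by (rule finite_real_of_nn[OF le])
  show "0 \<le> \<nu> D" by (simp add: \<nu>_def)
  show "ennreal (\<nu> D) = (\<integral>\<^sup>+x. indicator (S D) x * u x \<partial>M)" by (rule eq)
  show "\<nu> D \<le> \<nu> D'" if "D \<subseteq> D'"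
  proof -
    have "(\<integral>\<^sup>+x. indicator (S D) x * u x \<partial>M) \<le> (\<integral>\<^sup>+x. indicator (S D') x * u x \<partial>M)"
      using S(2)[OF that] by (intro nn_integral_mono mult_right_mono) (auto simp: indicator_def)
    then show ?thesis unfolding eq[symmetric] by (simp add: \<nu>_def)
  qed
  show "sum \<nu> \<D> \<le> V" if fin: "finite \<D>" "disjoint \<D>" "\<forall>D\<in>\<D>. open D"
  proof -
    have "ennreal (sum \<nu> \<D>) = (\<Sum>D\<in>\<D>. \<integral>\<^sup>+x. indicator (S D) x * u x \<partial>M)"
      unfolding eq[symmetric] by (rule sum_ennreal[symmetric]) (simp add: \<nu>_def)
    also have "\<dots> = (\<integral>\<^sup>+x. (\<Sum>D\<in>\<D>. indicator (S D) x * u x) \<partial>M)"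
      using S(1) fin(3) by (intro nn_integral_sum[symmetric]) (auto intro!: borel_measurable_times borel_measurable_indicator)
    also have "\<dots> \<le> (\<integral>\<^sup>+x. u x \<partial>M)"
    proof (rule nn_integral_mono)
      fix x
      have "(\<Sum>D\<in>\<D>. indicator (S D) x :: ennreal) \<le> 1"
      proof (cases "\<exists>D\<in>\<D>. x \<in> S D")
        case True
        then obtain D where D: "D \<in> \<D>" "x \<in> S D" by blast
        have "(\<Sum>E\<in>\<D>. indicator (S E) x :: ennreal) = (\<Sum>E\<in>{D}. indicator (S E) x)"
        proof (rule sum.mono_neutral_right)
          show "\<forall>i\<in>\<D> - {D}. indicator (S i) x = (0::ennreal)"
          proof
            fix i assume "i \<in> \<D> - {D}"
            then have "D \<inter> i = {}" using fin(2) D(1) by (auto simp: disjoint_def)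
            then have "x \<notin> S i" using S(3) D(2) by blast
            then show "indicator (S i) x = (0::ennreal)" by simp
          qed
        qed (use fin D in auto)
        then show ?thesis using D by simp
      next
        case False
        then have "(\<Sum>D\<in>\<D>. indicator (S D) x :: ennreal) = 0" by (auto simp: indicator_def)
        then show ?thesis by simp
      qed
      then have "(\<Sum>D\<in>\<D>. indicator (S D) x) * u x \<le> 1 * u x" by (rule mult_right_mono) simp
      then show "(\<Sum>D\<in>\<D>. indicator (S D) x * u x) \<le> u x" by (simp add: sum_distrib_right)
    qed
    also note tot
    finally show ?thesis using V by simp
  qed
qed

lemma Lp_norm_finite_le:
  fixes f :: "'a \<Rightarrow> 'b::real_normed_vector"
  assumes p: "0 < p" and w: "0 \<le> w" and L: "Lp_norm (ereal p) M f \<le> ereal w"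
  shows "(\<integral>\<^sup>+x. ennreal (norm (f x) powr p) \<partial>M) \<le> ennreal (w powr p)"
proof -
  define I where "I = (\<integral>\<^sup>+x. ennreal (norm (f x) powr p) \<partial>M)"
  have "1 / ereal p = ereal (1/p)" using p by (simp add: one_ereal_def)
  then have fin: "I \<noteq> \<infinity>" and le: "enn2real I powr (1/p) \<le> w"
    using L p by (auto simp: Lp_norm_def Let_def I_def split: if_splits)
  have "enn2real I = (enn2real I powr (1/p)) powr p" using p by (simp add: powr_powr)
  also have "\<dots> \<le> w powr p" using le p by (intro powr_mono2) auto
  finally have "enn2real I \<le> w powr p" .
  moreover have "I = ennreal (enn2real I)" using fin by (simp add: less_top)
  ultimately show ?thesis unfolding I_def[symmetric] by (metis ennreal_leI)
qed

lemma Lp_norm_infinite_le: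
  assumes "Lp_norm \<infinity> M f \<le> ereal w"
  shows "AE x in M. norm (f x) \<le> w"
proof -
  have le: "esssup M (\<lambda>x. ereal (norm (f x))) \<le> ereal w" using assms by (simp add: Lp_norm_def)
  have "AE x in M. ereal (norm (f x)) \<le> esssup M (\<lambda>x. ereal (norm (f x)))" by (rule esssup_AE)
  then show ?thesis
  proof eventually_elim
    case (elim x)
    then have "ereal (norm (f x)) \<le> ereal w" using le by (rule order_trans)
    then show ?case by simp
  qed
qed

lemma borel_representative:
  fixes f :: "real^2 \<Rightarrow> real"
  assumes \<Omega>: "\<Omega> \<in> sets lebesgue" and f: "f \<in> borel_measurable (lebesgue_on \<Omega>)"
  obtains f0 where "f0 \<in> borel_measurable borel" "AE x in lborel. indicator \<Omega> x * f x = f0 x"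
proof -
  have "(\<lambda>x. indicator \<Omega> x *\<^sub>R f x) \<in> borel_measurable lebesgue"
    using f \<Omega> by (simp add: borel_measurable_restrict_space_iff)
  then obtain f0 where "f0 \<in> borel_measurable lborel" "AE x in lborel. indicator \<Omega> x *\<^sub>R f x = f0 x"
    using completion_ex_borel_measurable_real by blast
  then show ?thesis using that by simp
qed

text \<open>An open set is a countable union of compact boxes.\<close>

lemma locally_integrable_measurable:
  fixes G :: "real^2 \<Rightarrow> real^2"
  assumes "open \<Omega>" "locally_integrable \<Omega> G"
  shows "G \<in> borel_measurable (lebesgue_on \<Omega>)"
proof -
  obtain \<D> where D: "countable \<D>" "\<D> \<subseteq> Pow \<Omega>" "\<And>X. X \<in> \<D> \<Longrightarrow> \<exists>a b. X = cbox a b" "\<Union>\<D> = \<Omega>"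
    using open_countable_Union_open_cbox[OF assms(1)] by metis
  have \<Omega>: "\<Omega> \<in> sets lebesgue" using assms(1) by simp
  show ?thesis
  proof (rule measurable_piecewise_restrict[OF D(1)])
    show "X \<inter> space (lebesgue_on \<Omega>) \<in> sets (lebesgue_on \<Omega>)" if X: "X \<in> \<D>" for X
    proof -
      have "X \<in> sets lebesgue" "X \<subseteq> \<Omega>" using X D by force+
      then show ?thesis using \<Omega> by (auto simp: sets_restrict_space_iff space_restrict_space Int_absorb2)
    qed
    show "space (lebesgue_on \<Omega>) \<subseteq> \<Union>\<D>" using D(4) by (simp add: space_restrict_space)
    show "G \<in> borel_measurable (restrict_space (lebesgue_on \<Omega>) X)" if X: "X \<in> \<D>" for X
    proof -
      have "compact X" "X \<subseteq> \<Omega>" using X D by force+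
      then have "set_integrable lebesgue X G" using assms(2) by (simp add: locally_integrable_def)
      then have "(\<lambda>x. indicator X x *\<^sub>R G x) \<in> borel_measurable lebesgue"
        by (simp add: set_integrable_def borel_measurable_integrable)
      moreover have "X \<in> sets lebesgue" using X D(3) by force
      ultimately have "G \<in> borel_measurable (lebesgue_on X)"
        by (simp add: borel_measurable_restrict_space_iff)
      moreover have "restrict_space (lebesgue_on \<Omega>) X = lebesgue_on X"
        using \<open>X \<subseteq> \<Omega>\<close> \<Omega> \<open>X \<in> sets lebesgue\<close> by (subst restrict_restrict_space) (auto simp: Int_absorb1)
      ultimately show ?thesis by simp
    qed
  qed
qed

lemma nn_lebesgue_on:
  assumes "\<Omega> \<in> sets lebesgue"
  shows "(\<integral>\<^sup>+x. u x \<partial>lebesgue_on \<Omega>) = (\<integral>\<^sup>+x. u x * indicator \<Omega> x \<partial>lborel)"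
  using assms by (simp add: nn_integral_restrict_space nn_integral_completion)

lemma AE_lebesgue_on:
  assumes "\<Omega> \<in> sets lebesgue"
  shows "(AE x in lebesgue_on \<Omega>. P x) \<longleftrightarrow> (AE x in lborel. x \<in> \<Omega> \<longrightarrow> P x)"
  using assms by (simp add: AE_restrict_space_iff AE_completion_iff)

lemma measure_open_pos:
  fixes D :: "(real^2) set"
  assumes "open D" "D \<noteq> {}" "bounded D"
  shows "0 < measure lborel D" "emeasure lborel D = ennreal (measure lborel D)"
proof -
  have fin: "emeasure lborel D < \<infinity>" using emeasure_bounded_finite[OF assms(3)] .
  then show eq: "emeasure lborel D = ennreal (measure lborel D)"
    by (intro emeasure_eq_ennreal_measure) auto
  have "D \<notin> null_sets lborel"
    using assms(1,2) open_not_negligible[OF assms(1,2)] negligible_iff_null_sets null_sets_completionI by blast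
  then have "emeasure lborel D \<noteq> 0" using assms(1) by (auto simp: null_sets_def)
  then show "0 < measure lborel D" using eq by (metis ennreal_0 less_eq_real_def measure_nonneg)
qed

text \<open>A bound by a supremum is a bound of integrability \<open>q\<close> for every finite \<open>q\<close>, with a multiple of the
  area as energy.\<close>

lemma area_energy:
  assumes \<Omega>: "open \<Omega>" "bounded \<Omega>" and q: "1 < q" and w: "0 \<le> w"
    and osc: "\<And>D m. \<lbrakk>open D; convex D; D \<subseteq> \<Omega>; \<forall>x\<in>D. \<forall>y\<in>D. (dist x y)\<^sup>2 \<le> \<kappa> * m; 0 < m;
      emeasure lborel D = ennreal m\<rbrakk> \<Longrightarrow> osc f D \<le> ennreal (K * m powr (2 + s/2) * w)"
  shows "energy_control \<Omega> \<kappa> s q K f (measure lborel \<Omega> * w powr q)"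
  unfolding energy_control_def controls_def
proof (intro exI[of _ "\<lambda>D. w powr q * measure lborel D"] conjI allI impI; (elim conjE)?)
  have fin: "D \<in> fmeasurable lborel" if "open D" "D \<subseteq> \<Omega>" for D
    using that bounded_subset[OF \<Omega>(2)] emeasure_bounded_finite[of D] by (intro fmeasurableI) auto
  show "0 \<le> w powr q * measure lborel D" for D by simp
  show "w powr q * measure lborel D \<le> w powr q * measure lborel D'"
    if "open D" "open D'" "D \<subseteq> D'" "D' \<subseteq> \<Omega>" for D D'
    using that fin by (intro mult_left_mono measure_mono_fmeasurable) auto
  show "(\<Sum>D\<in>\<D>. w powr q * measure lborel D) \<le> measure lborel \<Omega> * w powr q"
    if \<D>: "finite \<D>" "disjoint \<D>" "\<forall>D\<in>\<D>. open D \<and> D \<subseteq> \<Omega>" for \<D>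
  proof -
    have "(\<Sum>D\<in>\<D>. measure lborel D) = measure lborel (\<Union>\<D>)"
      using \<D> fin by (subst measure_Union') (auto simp: pairwise_def disjnt_def disjoint_def)
    also have "\<dots> \<le> measure lborel \<Omega>"
      using \<D> fin \<Omega>(1) by (intro measure_mono_fmeasurable) (auto intro: borel_open)
    finally have "w powr q * (\<Sum>D\<in>\<D>. measure lborel D) \<le> w powr q * measure lborel \<Omega>"
      by (rule mult_left_mono) simp
    moreover have "(\<Sum>D\<in>\<D>. w powr q * measure lborel D) = w powr q * (\<Sum>D\<in>\<D>. measure lborel D)"
      by (rule sum_distrib_left[symmetric])
    ultimately show ?thesis using mult.commute[of "w powr q" "measure lborel \<Omega>"] by linarith
  qed
  fix D assume D: "open D" "convex D" "D \<noteq> {}" "D \<subseteq> \<Omega>" "\<forall>x\<in>D. \<forall>y\<in>D. (dist x y)\<^sup>2 \<le> \<kappa> * measure lborel D"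
  define m where "m = measure lborel D"
  have m: "0 < m" "emeasure lborel D = ennreal m"
    using measure_open_pos[OF D(1,3) bounded_subset[OF \<Omega>(2) D(4)]] by (simp_all add: m_def)
  have "(w powr q * m) powr (1/q) = w * m powr (1/q)" using w m q by (simp add: powr_mult powr_powr)
  then have "K * m powr (2 + s/2 - 1/q) * (w powr q * m) powr (1/q) =
     K * (m powr (2 + s/2 - 1/q) * m powr (1/q)) * w" by simp
  also have "m powr (2 + s/2 - 1/q) * m powr (1/q) = m powr (2 + s/2)"
    by (simp only: powr_add[symmetric]) simp
  finally have eq: "K * m powr (2 + s/2 - 1/q) * (w powr q * m) powr (1/q) = K * m powr (2 + s/2) * w" .
  show "osc f D \<le> ennreal (K * measure lborel D powr (2 + s/2 - 1/q) * (w powr q * measure lborel D) powr (1/q))"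
    unfolding m_def[symmetric] eq using osc[OF D(1,2,4) D(5)[folded m_def] m] .
qed

text \<open>The seminorm for \<open>s = 1\<close>.\<close>

lemma gradient_energy:
  fixes f :: "real^2 \<Rightarrow> real" and g :: "real^2 \<Rightarrow> real^2"
  assumes f: "integrable lborel f" and g: "integrable lborel g"
    and weak: "\<And>\<phi> i. \<phi> \<in> test_functions \<Omega> \<Longrightarrow>
      (\<integral>x. f x * partial i \<phi> x \<partial>lborel) = - (\<integral>x. g x $ i * \<phi> x \<partial>lborel)"
    and \<Omega>: "open \<Omega>" "bounded \<Omega>" and \<kappa>: "0 \<le> \<kappa>" and q: "1 < q" and w: "0 \<le> w"
  shows "(\<integral>\<^sup>+x. ennreal (norm (g x) powr q) \<partial>lborel) \<le> ennreal (w powr q) \<Longrightarrow>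
      energy_control \<Omega> \<kappa> 1 q (8 * sqrt \<kappa>) f (w powr q)"
    and "(AE x in lborel. norm (g x) \<le> w) \<Longrightarrow>
      energy_control \<Omega> \<kappa> 1 q (8 * sqrt \<kappa>) f (measure lborel \<Omega> * w powr q)"
proof -
  have [measurable]: "g \<in> borel_measurable borel" using borel_measurable_integrable[OF g] by simp
  have gradient_osc: "osc f D \<le> ennreal (4 * sqrt \<kappa> * (m powr (1/2) * m powr 1)) *
      (\<integral>\<^sup>+x. indicator D x * ennreal (norm (g x)) \<partial>lborel)"
    if D: "open D" "convex D" "D \<subseteq> \<Omega>" "\<forall>x\<in>D. \<forall>y\<in>D. (dist x y)\<^sup>2 \<le> \<kappa> * m"
      and m: "0 < m" "emeasure lborel D = ennreal m" for D m
  proof -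
    have d: "dist x y \<le> sqrt (\<kappa> * m)" if "x \<in> D" "y \<in> D" for x y
      using D(4) that by (auto intro: real_le_rsqrt)
    have "osc f D \<le> ennreal (4 * sqrt (\<kappa> * m)) * ennreal m * (\<integral>\<^sup>+x. indicator D x * ennreal (norm (g x)) \<partial>lborel)"
      using osc_weak_gradient[OF f g weak D(1-3) _ d] \<kappa> m by simp
    also have "ennreal (4 * sqrt (\<kappa> * m)) * ennreal m = ennreal (4 * sqrt (\<kappa> * m) * m)"
      using \<kappa> m by (intro ennreal_mult[symmetric]) auto
    also have "4 * sqrt (\<kappa> * m) * m = 4 * sqrt \<kappa> * (m powr (1/2) * m powr 1)"
      using m \<kappa> by (simp add: real_sqrt_mult powr_half_sqrt)
    finally show ?thesis .
  qed
  show "energy_control \<Omega> \<kappa> 1 q (8 * sqrt \<kappa>) f (w powr q)"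
    if tot: "(\<integral>\<^sup>+x. ennreal (norm (g x) powr q) \<partial>lborel) \<le> ennreal (w powr q)"
  proof -
    define \<nu> where "\<nu> D = enn2real (\<integral>\<^sup>+x. indicator D x * ennreal (norm (g x) powr q) \<partial>lborel)" for D
    note de = density_energy[of "\<lambda>x. ennreal (norm (g x) powr q)" lborel "w powr q" "\<lambda>D. D", OF _ tot, folded \<nu>_def]
    have X: "(\<integral>\<^sup>+x. indicator D x * ennreal (norm (g x)) \<partial>lborel) \<le>
         ennreal (2 * measure lborel D powr (1 - 1/q) * \<nu> D powr (1/q))"
      if D: "open D" "D \<noteq> {}" "D \<subseteq> \<Omega>" for D
    proof -
      define m where "m = measure lborel D"
      have m: "0 < m" "emeasure lborel D = ennreal m"
        using measure_open_pos[OF D(1,2) bounded_subset[OF \<Omega>(2) D(3)]] by (simp_all add: m_def)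
      have [measurable]: "D \<in> sets borel" using D by auto
      have "(\<integral>\<^sup>+x. indicator D x * ennreal (norm (g x)) \<partial>lborel) \<le> ennreal (1 * (\<tau> * m + \<tau> powr (1 - q) * \<nu> D))"
        if \<tau>: "0 < \<tau>" for \<tau>
      proof -
        have "(\<integral>\<^sup>+x. indicator D x * ennreal (norm (g x)) \<partial>lborel) \<le>
           (\<integral>\<^sup>+x. ennreal \<tau> * indicator D x + ennreal (\<tau> powr (1 - q)) * (indicator D x * ennreal (norm (g x) powr q)) \<partial>lborel)"
          using young_powr[OF _ \<tau>, of "norm (g _)" q] q \<tau>
          by (intro nn_integral_mono) (auto simp: indicator_def ennreal_mult[symmetric] ennreal_plus[symmetric]
              simp del: ennreal_plus intro!: ennreal_leI)
        also have "\<dots> = ennreal \<tau> * ennreal m + ennreal (\<tau> powr (1 - q)) * ennreal (\<nu> D)"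
          using de(2)[of D] D(1) m by (subst nn_integral_add) (auto simp: nn_integral_cmult)
        also have "\<dots> = ennreal (1 * (\<tau> * m + \<tau> powr (1 - q) * \<nu> D))"
          using \<tau> m de(1)[of D] by (simp add: ennreal_mult ennreal_plus)
        finally show ?thesis .
      qed
      then have "(\<integral>\<^sup>+x. indicator D x * ennreal (norm (g x)) \<partial>lborel) \<le>
          ennreal (2 * 1 * m powr (1 - 1/q) * \<nu> D powr (1/q))"
        by (rule optimise_parameter) (use m de(1)[of D] q in auto)
      then show ?thesis by (simp add: m_def)
    qed
    have "osc f D \<le> ennreal (8 * sqrt \<kappa> * measure lborel D powr (2 + 1/2 - 1/q) * \<nu> D powr (1/q))"
      if D: "open D" "convex D" "D \<noteq> {}" "D \<subseteq> \<Omega>" "\<forall>x\<in>D. \<forall>y\<in>D. (dist x y)\<^sup>2 \<le> \<kappa> * measure lborel D" for D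
    proof -
      define m where "m = measure lborel D"
      have m: "0 < m" "emeasure lborel D = ennreal m"
        using measure_open_pos[OF D(1,3) bounded_subset[OF \<Omega>(2) D(4)]] by (simp_all add: m_def)
      define c where "c = 4 * sqrt \<kappa> * (m powr (1/2) * m powr 1)"
      have c: "0 \<le> c" using \<kappa> by (simp add: c_def)
      have "osc f D \<le> ennreal c * (\<integral>\<^sup>+x. indicator D x * ennreal (norm (g x)) \<partial>lborel)"
        using gradient_osc[OF D(1,2,4) D(5)[folded m_def] m] by (simp add: c_def)
      also have "\<dots> \<le> ennreal c * ennreal (2 * m powr (1 - 1/q) * \<nu> D powr (1/q))"
        using X[OF D(1,3,4)] by (intro mult_left_mono) (auto simp: m_def)
      also have "\<dots> = ennreal (c * (2 * m powr (1 - 1/q) * \<nu> D powr (1/q)))"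
        using c by (intro ennreal_mult[symmetric]) auto
      also have "c * (2 * m powr (1 - 1/q) * \<nu> D powr (1/q)) =
          8 * sqrt \<kappa> * (m powr (1/2) * m powr 1 * m powr (1 - 1/q)) * \<nu> D powr (1/q)"
        by (simp add: c_def)
      also have "m powr (1/2) * m powr 1 * m powr (1 - 1/q) = m powr (2 + 1/2 - 1/q)"
        by (simp only: powr_add[symmetric]) (simp add: algebra_simps)
      finally show ?thesis by (simp add: m_def)
    qed
    then show ?thesis
      unfolding energy_control_def controls_def
      using de by (intro exI[of _ \<nu>]) auto
  qed
  show "energy_control \<Omega> \<kappa> 1 q (8 * sqrt \<kappa>) f (measure lborel \<Omega> * w powr q)"
    if ae: "AE x in lborel. norm (g x) \<le> w"
  proof (rule area_energy[OF \<Omega> q w])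
    fix D m assume D: "open D" "convex D" "D \<subseteq> \<Omega>" "\<forall>x\<in>D. \<forall>y\<in>D. (dist x y)\<^sup>2 \<le> \<kappa> * m"
      and m: "0 < m" "emeasure lborel D = ennreal m"
    have "(\<integral>\<^sup>+x. indicator D x * ennreal (norm (g x)) \<partial>lborel) \<le> (\<integral>\<^sup>+x. ennreal w * indicator D x \<partial>lborel)"
    proof (rule nn_integral_mono_AE)
      show "AE x in lborel. indicator D x * ennreal (norm (g x)) \<le> ennreal w * indicator D x"
        using ae by (rule AE_mp) (auto intro!: always_eventually simp: indicator_def ennreal_leI)
    qed
    also have "\<dots> = ennreal (m * w)"
      using D(1) m w by (simp add: nn_integral_cmult_indicator ennreal_mult mult.commute)
    finally have "osc f D \<le> ennreal (4 * sqrt \<kappa> * (m powr (1/2) * m powr 1)) * ennreal (m * w)"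
      by (intro order_trans[OF gradient_osc[OF D m]] mult_left_mono) simp_all
    also have "\<dots> = ennreal (4 * sqrt \<kappa> * (m powr (1/2) * m powr 1) * (m * w))"
      using \<kappa> m w by (intro ennreal_mult[symmetric]) auto
    also have "4 * sqrt \<kappa> * (m powr (1/2) * m powr 1) * (m * w) = 4 * sqrt \<kappa> * (m powr (1/2) * m powr 1 * m powr 1) * w"
      using m by simp
    also have "m powr (1/2) * m powr 1 * m powr 1 = m powr (2 + 1/2)"
      by (simp only: powr_add[symmetric]) simp
    also have "ennreal (4 * sqrt \<kappa> * m powr (2 + 1/2) * w) \<le> ennreal (8 * sqrt \<kappa> * m powr (2 + 1/2) * w)"
      using \<kappa> w by (intro ennreal_leI mult_right_mono) auto
    finally show "osc f D \<le> ennreal (8 * sqrt \<kappa> * m powr (2 + 1/2) * w)" .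
  qed
qed

text \<open>The seminorm for \<open>s < 1\<close>: a difference is the difference quotient times a power of the distance, which the
  diameter bounds.\<close>

lemma quotient_energy:
  fixes f :: "real^2 \<Rightarrow> real"
  assumes [measurable]: "f \<in> borel_measurable borel"
    and \<Omega>: "open \<Omega>" "bounded \<Omega>" and \<kappa>: "0 \<le> \<kappa>" and s: "0 < s" and q: "1 < q" and w: "0 \<le> w"
  shows "(\<integral>\<^sup>+x. (\<integral>\<^sup>+y. indicator \<Omega> x * indicator \<Omega> y *
        ennreal ((\<bar>f x - f y\<bar> / dist x y powr (s + 2/q)) powr q) \<partial>lborel) \<partial>lborel) \<le> ennreal (w powr q) \<Longrightarrow>
      energy_control \<Omega> \<kappa> s q (2 * \<kappa> powr ((s + 2/q)/2)) f (w powr q)"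
    and "(AE x in lborel. x \<in> \<Omega> \<longrightarrow> (AE y in lborel. y \<in> \<Omega> \<longrightarrow> \<bar>f x - f y\<bar> / dist x y powr s \<le> w)) \<Longrightarrow>
      energy_control \<Omega> \<kappa> s q (\<kappa> powr (s/2)) f (measure lborel \<Omega> * w powr q)"
proof -
  have [measurable]: "\<Omega> \<in> sets borel" using \<Omega> by auto
  have quot: "\<bar>f x - f y\<bar> \<le> (\<kappa> * m) powr (\<sigma>/2) * (\<bar>f x - f y\<bar> / dist x y powr \<sigma>)"
    if d: "(dist x y)\<^sup>2 \<le> \<kappa> * m" and \<sigma>: "0 < \<sigma>" for x y m \<sigma>
  proof (cases "x = y")
    case False
    then have "dist x y powr \<sigma> = ((dist x y)\<^sup>2) powr (\<sigma>/2)" by (simp add: powr_powr flip: powr_numeral)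
    also have "\<dots> \<le> (\<kappa> * m) powr (\<sigma>/2)" using d \<sigma> by (intro powr_mono2) auto
    finally have "dist x y powr \<sigma> * (\<bar>f x - f y\<bar> / dist x y powr \<sigma>) \<le>
        (\<kappa> * m) powr (\<sigma>/2) * (\<bar>f x - f y\<bar> / dist x y powr \<sigma>)" by (intro mult_right_mono) auto
    then show ?thesis using False by simp
  qed simp
  show "energy_control \<Omega> \<kappa> s q (2 * \<kappa> powr ((s + 2/q)/2)) f (w powr q)"
    if tot: "(\<integral>\<^sup>+x. (\<integral>\<^sup>+y. indicator \<Omega> x * indicator \<Omega> y *
        ennreal ((\<bar>f x - f y\<bar> / dist x y powr (s + 2/q)) powr q) \<partial>lborel) \<partial>lborel) \<le> ennreal (w powr q)"
  proof -
    define \<sigma> where "\<sigma> = s + 2/q"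
    have \<sigma>: "0 < \<sigma>" using s q by (simp add: \<sigma>_def add_pos_pos)
    define F where "F = (\<lambda>x y. \<bar>f x - f y\<bar> / dist x y powr \<sigma>)"
    have [measurable]: "(\<lambda>(x, y). F x y) \<in> borel_measurable (lborel \<Otimes>\<^sub>M lborel)"
      unfolding F_def by measurable
    define u where "u = (\<lambda>(x, y). indicator \<Omega> x * indicator \<Omega> y * ennreal (F x y powr q))"
    have [measurable]: "u \<in> borel_measurable (lborel \<Otimes>\<^sub>M lborel)" unfolding u_def by measurable
    have tot': "(\<integral>\<^sup>+z. u z \<partial>(lborel \<Otimes>\<^sub>M lborel)) \<le> ennreal (w powr q)"
      using tot lborel.nn_integral_fst[of u lborel] by (simp add: u_def F_def \<sigma>_def)
    define \<nu> where "\<nu> D = enn2real (\<integral>\<^sup>+z. indicator (D \<times> D) z * u z \<partial>(lborel \<Otimes>\<^sub>M lborel))" for D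
    have S: "open D \<Longrightarrow> D \<times> D \<in> sets (lborel \<Otimes>\<^sub>M lborel)" for D :: "(real^2) set" by auto
    note de = density_energy[of u "lborel \<Otimes>\<^sub>M lborel" "w powr q" "\<lambda>D. D \<times> D", OF _ tot' _ S, folded \<nu>_def]
    have de1: "0 \<le> \<nu> D" for D by (simp add: \<nu>_def)
    have main: "osc f D \<le> ennreal (2 * \<kappa> powr (\<sigma>/2) * measure lborel D powr (2 + s/2 - 1/q) * \<nu> D powr (1/q))"
      if D: "open D" "convex D" "D \<noteq> {}" "D \<subseteq> \<Omega>" "\<forall>x\<in>D. \<forall>y\<in>D. (dist x y)\<^sup>2 \<le> \<kappa> * measure lborel D" for D
    proof -
      define m where "m = measure lborel D"
      have m: "0 < m" "emeasure lborel D = ennreal m"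
        using measure_open_pos[OF D(1,3) bounded_subset[OF \<Omega>(2) D(4)]] by (simp_all add: m_def)
      have [measurable]: "D \<in> sets borel" using D by auto
      have D\<nu>: "ennreal (\<nu> D) = (\<integral>\<^sup>+x. (\<integral>\<^sup>+y. indicator D x * indicator D y * ennreal (F x y powr q) \<partial>lborel) \<partial>lborel)"
      proof -
        have "ennreal (\<nu> D) = (\<integral>\<^sup>+z. indicator (D \<times> D) z * u z \<partial>(lborel \<Otimes>\<^sub>M lborel))"
          using D(1) by (intro de(2)) auto
        also have "\<dots> = (\<integral>\<^sup>+x. (\<integral>\<^sup>+y. indicator (D \<times> D) (x, y) * u (x, y) \<partial>lborel) \<partial>lborel)"
          by (rule lborel.nn_integral_fst[symmetric]) measurable
        also have "\<dots> = (\<integral>\<^sup>+x. (\<integral>\<^sup>+y. indicator D x * indicator D y * ennreal (F x y powr q) \<partial>lborel) \<partial>lborel)"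
          using D(4) by (intro nn_integral_cong) (auto simp: u_def indicator_def)
        finally show ?thesis .
      qed
      define c where "c = (\<kappa> * m) powr (\<sigma>/2)"
      have c: "0 \<le> c" by (simp add: c_def)
      have "osc f D \<le> ennreal (c * (\<tau> * m\<^sup>2 + \<tau> powr (1 - q) * \<nu> D))" if \<tau>: "0 < \<tau>" for \<tau>
      proof -
        have "osc f D \<le> (\<integral>\<^sup>+x. (\<integral>\<^sup>+y. ennreal (c * \<tau>) * indicator D x * indicator D y +
            ennreal (c * \<tau> powr (1 - q)) * (indicator D x * indicator D y * ennreal (F x y powr q)) \<partial>lborel) \<partial>lborel)"
          unfolding osc_def
        proof (intro nn_integral_mono)
          fix x y
          show "indicator D x * indicator D y * ennreal \<bar>f x - f y\<bar> \<le> ennreal (c * \<tau>) * indicator D x * indicator D y +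
            ennreal (c * \<tau> powr (1 - q)) * (indicator D x * indicator D y * ennreal (F x y powr q))"
          proof (cases "x \<in> D \<and> y \<in> D")
            case True
            have "\<bar>f x - f y\<bar> \<le> c * F x y"
              unfolding c_def F_def using D(5) True \<sigma> by (intro quot) (auto simp: m_def)
            also have "\<dots> \<le> c * (\<tau> + \<tau> powr (1 - q) * F x y powr q)"
              using c q \<tau> by (intro mult_left_mono young_powr) (auto simp: F_def)
            finally have "ennreal \<bar>f x - f y\<bar> \<le> ennreal (c * \<tau> + c * \<tau> powr (1 - q) * F x y powr q)"
              by (intro ennreal_leI) (simp add: algebra_simps)
            then show ?thesis using True c \<tau> by (simp add: ennreal_plus ennreal_mult)
          qed (auto simp: indicator_def)
        qed
        also have "\<dots> = (\<integral>\<^sup>+x. (\<integral>\<^sup>+y. ennreal (c * \<tau>) * indicator D x * indicator D y \<partial>lborel) +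
            (\<integral>\<^sup>+y. ennreal (c * \<tau> powr (1 - q)) * (indicator D x * indicator D y * ennreal (F x y powr q)) \<partial>lborel) \<partial>lborel)"
          by (intro nn_integral_cong nn_integral_add) measurable
        also have "\<dots> = (\<integral>\<^sup>+x. (\<integral>\<^sup>+y. ennreal (c * \<tau>) * indicator D x * indicator D y \<partial>lborel) \<partial>lborel) +
            (\<integral>\<^sup>+x. (\<integral>\<^sup>+y. ennreal (c * \<tau> powr (1 - q)) * (indicator D x * indicator D y * ennreal (F x y powr q)) \<partial>lborel) \<partial>lborel)"
          by (intro nn_integral_add) measurable
        also have "(\<integral>\<^sup>+x. (\<integral>\<^sup>+y. ennreal (c * \<tau>) * indicator D x * indicator D y \<partial>lborel) \<partial>lborel) =
            ennreal (c * \<tau> * m * m)"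
          using m c \<tau> by (simp add: nn_integral_cmult nn_integral_multc ennreal_mult)
        also have "(\<integral>\<^sup>+x. (\<integral>\<^sup>+y. ennreal (c * \<tau> powr (1 - q)) * (indicator D x * indicator D y * ennreal (F x y powr q)) \<partial>lborel) \<partial>lborel)
            = ennreal (c * \<tau> powr (1 - q)) * ennreal (\<nu> D)"
          unfolding D\<nu> by (subst nn_integral_cmult[symmetric], measurable,
            intro nn_integral_cong nn_integral_cmult) measurable
        also have "ennreal (c * \<tau> * m * m) + ennreal (c * \<tau> powr (1 - q)) * ennreal (\<nu> D) =
            ennreal (c * \<tau> * m * m) + ennreal (c * \<tau> powr (1 - q) * \<nu> D)"
          using c de1[of D] by (simp add: ennreal_mult)
        also have "\<dots> = ennreal (c * \<tau> * m * m + c * \<tau> powr (1 - q) * \<nu> D)"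
          using c m \<tau> de1[of D] by (intro ennreal_plus[symmetric]) auto
        also have "c * \<tau> * m * m + c * \<tau> powr (1 - q) * \<nu> D = c * (\<tau> * m\<^sup>2 + \<tau> powr (1 - q) * \<nu> D)"
          by (simp add: power2_eq_square algebra_simps)
        finally show ?thesis .
      qed
      then have "osc f D \<le> ennreal (2 * c * (m\<^sup>2) powr (1 - 1/q) * \<nu> D powr (1/q))"
        by (rule optimise_parameter) (use m c de1 q in auto)
      also have "2 * c * (m\<^sup>2) powr (1 - 1/q) = 2 * \<kappa> powr (\<sigma>/2) * (m powr (\<sigma>/2) * m powr (2 * (1 - 1/q)))"
        using m \<kappa> by (simp add: c_def powr_mult powr_powr flip: powr_numeral)
      also have "m powr (\<sigma>/2) * m powr (2 * (1 - 1/q)) = m powr (2 + s/2 - 1/q)"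
      proof -
        have "\<sigma>/2 + 2 * (1 - 1/q) = 2 + s/2 - 1/q" by (simp add: \<sigma>_def add_divide_distrib)
        then show ?thesis by (simp only: powr_add[symmetric])
      qed
      finally show ?thesis by (simp add: m_def)
    qed
    have m1: "\<nu> D \<le> \<nu> D'" if "D \<subseteq> D'" for D D' using that by (intro de(3)) auto
    have m2: "sum \<nu> \<D> \<le> w powr q" if "finite \<D>" "disjoint \<D>" "\<forall>D\<in>\<D>. open D" for \<D>
      using that by (intro de(4)) auto
    show ?thesis
      unfolding energy_control_def controls_def
      using main m1 m2 de1 by (intro exI[of _ \<nu>]) (simp add: \<sigma>_def)
  qed
  show "energy_control \<Omega> \<kappa> s q (\<kappa> powr (s/2)) f (measure lborel \<Omega> * w powr q)"
    if ae: "AE x in lborel. x \<in> \<Omega> \<longrightarrow> (AE y in lborel. y \<in> \<Omega> \<longrightarrow> \<bar>f x - f y\<bar> / dist x y powr s \<le> w)"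
  proof (rule area_energy[OF \<Omega> q w])
    fix D m assume D: "open D" "convex D" "D \<subseteq> \<Omega>" "\<forall>x\<in>D. \<forall>y\<in>D. (dist x y)\<^sup>2 \<le> \<kappa> * m"
      and m: "0 < m" "emeasure lborel D = ennreal m"
    have [measurable]: "D \<in> sets borel" using D by auto
    define c where "c = (\<kappa> * m) powr (s/2)"
    have c: "0 \<le> c" by (simp add: c_def)
    have "osc f D \<le> (\<integral>\<^sup>+x. (\<integral>\<^sup>+y. ennreal (c * w) * indicator D x * indicator D y \<partial>lborel) \<partial>lborel)"
      unfolding osc_def
    proof (rule nn_integral_mono_AE)
      show "AE x in lborel. (\<integral>\<^sup>+y. indicator D x * indicator D y * ennreal \<bar>f x - f y\<bar> \<partial>lborel) \<le>
          (\<integral>\<^sup>+y. ennreal (c * w) * indicator D x * indicator D y \<partial>lborel)"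
        using ae
      proof eventually_elim
        case (elim x)
        show ?case
        proof (cases "x \<in> D")
          case True
          then have "AE y in lborel. y \<in> \<Omega> \<longrightarrow> \<bar>f x - f y\<bar> / dist x y powr s \<le> w" using elim D(3) by blast
          then have "AE y in lborel. indicator D x * indicator D y * ennreal \<bar>f x - f y\<bar> \<le>
              ennreal (c * w) * indicator D x * indicator D y"
          proof eventually_elim
            case (elim y)
            show ?case
            proof (cases "y \<in> D")
              case yD: True
              have "\<bar>f x - f y\<bar> \<le> c * (\<bar>f x - f y\<bar> / dist x y powr s)"
                unfolding c_def using D(4) True yD s by (intro quot) auto
              also have "\<dots> \<le> c * w" using elim yD D(3) c by (intro mult_left_mono) auto
              finally show ?thesis using True yD by (simp add: ennreal_leI)
            qed simp
          qed
          then show ?thesis by (rule nn_integral_mono_AE)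
        qed simp
      qed
    qed
    also have "\<dots> = ennreal (c * w * m * m)"
      using m c w by (simp add: nn_integral_cmult nn_integral_multc ennreal_mult)
    also have "c * w * m * m = \<kappa> powr (s/2) * (m powr (s/2) * m powr 1 * m powr 1) * w"
      using m \<kappa> by (simp add: c_def powr_mult)
    also have "m powr (s/2) * m powr 1 * m powr 1 = m powr (2 + s/2)"
      by (simp only: powr_add[symmetric]) (simp add: add.commute)
    finally show "osc f D \<le> ennreal (\<kappa> powr (s/2) * m powr (2 + s/2) * w)" .
  qed
qed

text \<open>For \<open>s = 1\<close> the bound is required of some weak gradient, which the one chosen in the seminorm
  satisfies in particular.\<close>

definition seminorm_le :: "real \<Rightarrow> ereal \<Rightarrow> (real^2) set \<Rightarrow> (real^2 \<Rightarrow> real) \<Rightarrow> real \<Rightarrow> bool" where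
  "seminorm_le s p \<Omega> f w \<longleftrightarrow>
     (if s = 1 then \<exists>G. weak_gradient \<Omega> f G \<and> Lp_norm p (lebesgue_on \<Omega>) G \<le> ereal w
      else slobodeckij_seminorm s p \<Omega> f \<le> ereal w)"

lemma Lp_integrable:
  fixes f :: "real^2 \<Rightarrow> 'b::euclidean_space"
  assumes \<Omega>: "open \<Omega>" "bounded \<Omega>" and f: "f \<in> borel_measurable (lebesgue_on \<Omega>)"
    and L: "Lp_norm p (lebesgue_on \<Omega>) f < \<infinity>" and p: "p > 1"
  shows "integrable (lebesgue_on \<Omega>) f"
proof -
  interpret finite_measure "lebesgue_on \<Omega>"
    using \<Omega> by (intro finite_measure_lebesgue_on bounded_set_imp_lmeasurable) auto
  obtain w where w: "0 \<le> w" "Lp_norm p (lebesgue_on \<Omega>) f \<le> ereal w"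
  proof (cases "Lp_norm p (lebesgue_on \<Omega>) f")
    case (real r)
    then show ?thesis using that[of "\<bar>r\<bar>"] by simp
  next
    case MInf
    then show ?thesis using that[of 0] by simp
  qed (use L in simp)
  show ?thesis
  proof (cases "p = \<infinity>")
    case True
    then have "AE x in lebesgue_on \<Omega>. norm (f x) \<le> w" using Lp_norm_infinite_le w by blast
    then show ?thesis using f by (intro integrable_const_bound)
  next
    case False
    then obtain r where r: "p = ereal r" "1 < r" using p by (cases p) (auto simp: one_ereal_def)
    have "(\<integral>\<^sup>+x. ennreal (norm (f x)) \<partial>lebesgue_on \<Omega>) \<le> (\<integral>\<^sup>+x. 1 + ennreal (norm (f x) powr r) \<partial>lebesgue_on \<Omega>)"
    proof (rule nn_integral_mono)
      fix x
      have "norm (f x) \<le> 1 + norm (f x) powr r" using young_powr[of "norm (f x)" 1 r] r by simp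
      then have "ennreal (norm (f x)) \<le> ennreal (1 + norm (f x) powr r)" by (rule ennreal_leI)
      then show "ennreal (norm (f x)) \<le> 1 + ennreal (norm (f x) powr r)" by (simp add: ennreal_plus)
    qed
    also have "\<dots> = emeasure (lebesgue_on \<Omega>) (space (lebesgue_on \<Omega>)) + (\<integral>\<^sup>+x. ennreal (norm (f x) powr r) \<partial>lebesgue_on \<Omega>)"
      using f by (subst nn_integral_add) auto
    also have "\<dots> < \<infinity>"
    proof -
      have "(\<integral>\<^sup>+x. ennreal (norm (f x) powr r) \<partial>lebesgue_on \<Omega>) \<le> ennreal (w powr r)"
        using Lp_norm_finite_le[of r w] r w by simp
      then have "(\<integral>\<^sup>+x. ennreal (norm (f x) powr r) \<partial>lebesgue_on \<Omega>) < \<infinity>"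
        using ennreal_less_top order_le_less_trans by (metis infinity_ennreal_def)
      moreover have "emeasure (lebesgue_on \<Omega>) (space (lebesgue_on \<Omega>)) < \<infinity>"
        using emeasure_finite by (metis infinity_ennreal_def top.not_eq_extremum)
      ultimately show ?thesis by simp
    qed
    finally show ?thesis using f by (intro integrableI_bounded) auto
  qed
qed

lemma integrable_representative:
  fixes f :: "real^2 \<Rightarrow> 'b::euclidean_space"
  assumes \<Omega>: "open \<Omega>" and f: "integrable (lebesgue_on \<Omega>) f"
    and f0: "f0 \<in> borel_measurable borel" "AE x in lborel. indicator \<Omega> x *\<^sub>R f x = f0 x"
  shows "integrable lborel f0"
proof -
  have i: "integrable lebesgue (\<lambda>x. indicator \<Omega> x *\<^sub>R f x)"
    using f \<Omega> by (simp add: integrable_restrict_space)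
  have "f0 \<in> borel_measurable lebesgue" using f0(1) by (simp add: measurable_completion)
  then have "integrable lebesgue f0"
    using integrable_cong_AE[of "\<lambda>x. indicator \<Omega> x *\<^sub>R f x" lebesgue f0] i f0(2)
    by (simp add: AE_completion_iff borel_measurable_integrable)
  then show ?thesis using f0(1) by (simp add: integrable_completion)
qed

lemma tested_representative:
  fixes f :: "real^2 \<Rightarrow> real"
  assumes \<Omega>: "open \<Omega>" and f: "f \<in> borel_measurable (lebesgue_on \<Omega>)" and b: "b \<in> borel_measurable borel"
    and f0: "f0 \<in> borel_measurable borel" "AE x in lborel. indicator \<Omega> x * f x = f0 x"
  shows "(LINT x|lebesgue_on \<Omega>. f x * b x) = (\<integral>x. f0 x * b x \<partial>lborel)"
proof -
  have \<Omega>': "\<Omega> \<in> sets lebesgue" using \<Omega> by simp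
  have b': "b \<in> borel_measurable lebesgue" "f0 \<in> borel_measurable lebesgue"
    using b f0(1) by (simp_all add: measurable_completion)
  have "(\<lambda>x. indicator \<Omega> x *\<^sub>R f x) \<in> borel_measurable lebesgue"
    using f \<Omega>' by (simp add: borel_measurable_restrict_space_iff)
  then have m: "(\<lambda>x. (indicator \<Omega> x * f x) * b x) \<in> borel_measurable lebesgue" using b' by simp
  have "(LINT x|lebesgue_on \<Omega>. f x * b x) = (LINT x|lebesgue. (indicator \<Omega> x * f x) * b x)"
    using \<Omega>' by (subst integral_restrict_space) (simp_all add: mult.assoc)
  also have "\<dots> = (LINT x|lebesgue. f0 x * b x)"
  proof (rule integral_cong_AE[OF m])
    show "(\<lambda>x. f0 x * b x) \<in> borel_measurable lebesgue" using b' by simp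
    show "AE x in lebesgue. indicator \<Omega> x * f x * b x = f0 x * b x"
      unfolding AE_completion_iff using f0(2) by eventually_elim simp
  qed
  also have "\<dots> = (\<integral>x. f0 x * b x \<partial>lborel)"
    using b f0(1) by (intro integral_completion) simp
  finally show ?thesis .
qed

lemma test_function_borel:
  assumes "\<phi> \<in> test_functions \<Omega>"
  shows "\<phi> \<in> borel_measurable borel" "partial i \<phi> \<in> borel_measurable borel"
proof -
  have "C_k 0 \<phi>" "C_k (Suc 0) \<phi>" using assms by (auto simp: test_functions_def simp del: C_k.simps)
  then show "\<phi> \<in> borel_measurable borel" "partial i \<phi> \<in> borel_measurable borel"
    by (auto intro: borel_measurable_continuous_onI)
qed

lemma gradient_representative:
  fixes f :: "real^2 \<Rightarrow> real" and G :: "real^2 \<Rightarrow> real^2"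
  assumes \<Omega>: "open \<Omega>" "bounded \<Omega>" and weak: "weak_gradient \<Omega> f G"
    and fm: "f \<in> borel_measurable (lebesgue_on \<Omega>)"
    and f0: "f0 \<in> borel_measurable borel" "AE x in lborel. indicator \<Omega> x * f x = f0 x"
    and L: "Lp_norm p (lebesgue_on \<Omega>) G < \<infinity>" "p > 1"
  obtains g where "g \<in> borel_measurable borel" "integrable lborel g" "AE x in lborel. indicator \<Omega> x *\<^sub>R G x = g x"
    "\<And>\<phi> i. \<phi> \<in> test_functions \<Omega> \<Longrightarrow>
      (\<integral>x. f0 x * partial i \<phi> x \<partial>lborel) = - (\<integral>x. g x $ i * \<phi> x \<partial>lborel)"
proof -
  have \<Omega>': "\<Omega> \<in> sets lebesgue" using \<Omega> by simp
  have G: "G \<in> borel_measurable (lebesgue_on \<Omega>)"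
    using locally_integrable_measurable[OF \<Omega>(1)] weak by (simp add: weak_gradient_def)
  have iG: "integrable (lebesgue_on \<Omega>) G" by (rule Lp_integrable[OF \<Omega> G L])
  have Gi: "(\<lambda>x. G x $ i) \<in> borel_measurable (lebesgue_on \<Omega>)" for i
    using integrable_bounded_linear[OF bounded_linear_vec_nth iG] by (simp add: borel_measurable_integrable)
  have "\<forall>i. \<exists>h. h \<in> borel_measurable borel \<and> (AE x in lborel. indicator \<Omega> x * G x $ i = h x)"
  proof
    fix i
    obtain h where "h \<in> borel_measurable borel" "AE x in lborel. indicator \<Omega> x * G x $ i = h x"
      by (rule borel_representative[OF \<Omega>' Gi[of i]])
    then show "\<exists>h. h \<in> borel_measurable borel \<and> (AE x in lborel. indicator \<Omega> x * G x $ i = h x)" by blast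
  qed
  from choice[OF this] obtain h where h0: "\<forall>i. h i \<in> borel_measurable borel \<and>
      (AE x in lborel. indicator \<Omega> x * G x $ i = h i x)" ..
  have h: "h i \<in> borel_measurable borel" "AE x in lborel. indicator \<Omega> x * G x $ i = h i x" for i
    using h0[rule_format, of i] by simp_all
  define g :: "real^2 \<Rightarrow> real^2" where "g x = (\<Sum>i\<in>UNIV. h i x *\<^sub>R axis i 1)" for x
  have gi: "g x $ i = h i x" for x i
    by (simp add: g_def axis_def if_distrib[of "\<lambda>c. _ * c"] cong: if_cong)
  have [measurable]: "g \<in> borel_measurable borel" unfolding g_def using h(1) by measurable
  have "AE x in lborel. \<forall>i. indicator \<Omega> x * G x $ i = h i x" using h(2) by (simp add: AE_all_countable)
  then have ae: "AE x in lborel. indicator \<Omega> x *\<^sub>R G x = g x"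
    by eventually_elim (simp add: vec_eq_iff gi)
  have ig: "integrable lborel g" by (rule integrable_representative[OF \<Omega>(1) iG _ ae]) measurable
  have wk: "(\<integral>x. f0 x * partial i \<phi> x \<partial>lborel) = - (\<integral>x. g x $ i * \<phi> x \<partial>lborel)"
    if \<phi>: "\<phi> \<in> test_functions \<Omega>" for \<phi> i
  proof -
    have "(LINT x|lebesgue_on \<Omega>. f x * partial i \<phi> x) = - (LINT x|lebesgue_on \<Omega>. G x $ i * \<phi> x)"
      using weak \<phi> by (simp add: weak_gradient_def)
    then show ?thesis
      using tested_representative[OF \<Omega>(1) fm test_function_borel(2)[OF \<phi>, of i] f0]
        tested_representative[OF \<Omega>(1) Gi test_function_borel(1)[OF \<phi>] h(1) h(2), of i] by (simp add: gi)
  qed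
  show ?thesis by (rule that[OF _ ig ae wk]) measurable
qed

lemma slobodeckij_representative:
  fixes f :: "real^2 \<Rightarrow> real"
  assumes \<Omega>: "open \<Omega>" "bounded \<Omega>" and fm: "f \<in> borel_measurable (lebesgue_on \<Omega>)"
    and f0: "AE x in lborel. indicator \<Omega> x * f x = f0 x" and w: "0 \<le> w"
    and L: "slobodeckij_seminorm s p \<Omega> f \<le> ereal w"
  shows "p = ereal q \<Longrightarrow> 0 < q \<Longrightarrow> (\<integral>\<^sup>+x. (\<integral>\<^sup>+y. indicator \<Omega> x * indicator \<Omega> y *
        ennreal ((\<bar>f0 x - f0 y\<bar> / dist x y powr (s + 2/q)) powr q) \<partial>lborel) \<partial>lborel) \<le> ennreal (w powr q)"
    and "p = \<infinity> \<Longrightarrow>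
      AE x in lborel. x \<in> \<Omega> \<longrightarrow> (AE y in lborel. y \<in> \<Omega> \<longrightarrow> \<bar>f0 x - f0 y\<bar> / dist x y powr s \<le> w)"
proof -
  have \<Omega>': "\<Omega> \<in> sets lebesgue" using \<Omega> by simp
  interpret M: finite_measure "lebesgue_on \<Omega>"
    using \<Omega> by (intro finite_measure_lebesgue_on bounded_set_imp_lmeasurable) auto
  interpret MM: pair_sigma_finite "lebesgue_on \<Omega>" "lebesgue_on \<Omega>" ..
  have f0': "AE x in lborel. x \<in> \<Omega> \<longrightarrow> f x = f0 x"
    using f0 by eventually_elim (auto simp: indicator_def)
  have idm: "(\<lambda>x. x) \<in> borel_measurable (lebesgue_on \<Omega>)"
    using id_borel_measurable_lebesgue_on[of \<Omega>] by (simp add: id_def)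
  show "(\<integral>\<^sup>+x. (\<integral>\<^sup>+y. indicator \<Omega> x * indicator \<Omega> y *
        ennreal ((\<bar>f0 x - f0 y\<bar> / dist x y powr (s + 2/q)) powr q) \<partial>lborel) \<partial>lborel) \<le> ennreal (w powr q)"
    if p: "p = ereal q" "0 < q"
  proof -
    define \<sigma> where "\<sigma> = s + 2/q"
    have rq: "real_of_ereal (1 / p) = 1/q" using p by (simp add: one_ereal_def)
    define F where "F = (\<lambda>(x, y). \<bar>f x - f y\<bar> / dist x y powr \<sigma>)"
    have m1: "(\<lambda>z. f (fst z)) \<in> borel_measurable (lebesgue_on \<Omega> \<Otimes>\<^sub>M lebesgue_on \<Omega>)"
      "(\<lambda>z. f (snd z)) \<in> borel_measurable (lebesgue_on \<Omega> \<Otimes>\<^sub>M lebesgue_on \<Omega>)"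
      "(\<lambda>z. fst z) \<in> borel_measurable (lebesgue_on \<Omega> \<Otimes>\<^sub>M lebesgue_on \<Omega>)"
      "(\<lambda>z. snd z) \<in> borel_measurable (lebesgue_on \<Omega> \<Otimes>\<^sub>M lebesgue_on \<Omega>)"
      using measurable_compose[OF measurable_fst fm] measurable_compose[OF measurable_snd fm]
        measurable_compose[OF measurable_fst idm] measurable_compose[OF measurable_snd idm] by auto
    note [measurable] = m1
    have "F \<in> borel_measurable (lebesgue_on \<Omega> \<Otimes>\<^sub>M lebesgue_on \<Omega>)"
      unfolding F_def split_beta by measurable
    then have Fm: "(\<lambda>z. ennreal (F z powr q)) \<in> borel_measurable (lebesgue_on \<Omega> \<Otimes>\<^sub>M lebesgue_on \<Omega>)"
      by measurable
    have "Lp_norm (ereal q) (lebesgue_on \<Omega> \<Otimes>\<^sub>M lebesgue_on \<Omega>) F \<le> ereal w"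
      using L p rq by (simp add: slobodeckij_seminorm_def F_def \<sigma>_def)
    then have "(\<integral>\<^sup>+z. ennreal (norm (F z) powr q) \<partial>(lebesgue_on \<Omega> \<Otimes>\<^sub>M lebesgue_on \<Omega>)) \<le> ennreal (w powr q)"
      using Lp_norm_finite_le[OF p(2) w] by blast
    moreover have "norm (F z) = F z" for z by (simp add: F_def split_beta)
    ultimately have "(\<integral>\<^sup>+x. (\<integral>\<^sup>+y. ennreal (F (x, y) powr q) \<partial>lebesgue_on \<Omega>) \<partial>lebesgue_on \<Omega>) \<le> ennreal (w powr q)"
      using M.nn_integral_fst[OF Fm] by simp
    also have "(\<integral>\<^sup>+x. (\<integral>\<^sup>+y. ennreal (F (x, y) powr q) \<partial>lebesgue_on \<Omega>) \<partial>lebesgue_on \<Omega>) =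
        (\<integral>\<^sup>+x. (\<integral>\<^sup>+y. ennreal (F (x, y) powr q) * indicator \<Omega> y \<partial>lborel) * indicator \<Omega> x \<partial>lborel)"
      by (simp add: nn_lebesgue_on[OF \<Omega>'])
    also have "\<dots> = (\<integral>\<^sup>+x. (\<integral>\<^sup>+y. indicator \<Omega> x * indicator \<Omega> y *
        ennreal ((\<bar>f0 x - f0 y\<bar> / dist x y powr \<sigma>) powr q) \<partial>lborel) \<partial>lborel)"
    proof (rule nn_integral_cong_AE)
      show "AE x in lborel. (\<integral>\<^sup>+y. ennreal (F (x, y) powr q) * indicator \<Omega> y \<partial>lborel) * indicator \<Omega> x =
         (\<integral>\<^sup>+y. indicator \<Omega> x * indicator \<Omega> y * ennreal ((\<bar>f0 x - f0 y\<bar> / dist x y powr \<sigma>) powr q) \<partial>lborel)"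
        using f0'
      proof eventually_elim
        case (elim x)
        show ?case
        proof (cases "x \<in> \<Omega>")
          case True
          then have "f x = f0 x" using elim by simp
          have "AE y in lborel. ennreal (F (x, y) powr q) * indicator \<Omega> y =
              indicator \<Omega> x * indicator \<Omega> y * ennreal ((\<bar>f0 x - f0 y\<bar> / dist x y powr \<sigma>) powr q)"
            using f0' by eventually_elim (use True \<open>f x = f0 x\<close> in \<open>auto simp: F_def indicator_def\<close>)
          then show ?thesis using nn_integral_cong_AE True by fastforce
        qed simp
      qed
    qed
    finally show ?thesis by (simp add: \<sigma>_def)
  qed
  show "AE x in lborel. x \<in> \<Omega> \<longrightarrow> (AE y in lborel. y \<in> \<Omega> \<longrightarrow> \<bar>f0 x - f0 y\<bar> / dist x y powr s \<le> w)"
    if p: "p = \<infinity>"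
  proof -
    have "Lp_norm \<infinity> (lebesgue_on \<Omega> \<Otimes>\<^sub>M lebesgue_on \<Omega>) (\<lambda>(x, y). \<bar>f x - f y\<bar> / dist x y powr s) \<le> ereal w"
      using L p by (simp add: slobodeckij_seminorm_def)
    then have "AE z in lebesgue_on \<Omega> \<Otimes>\<^sub>M lebesgue_on \<Omega>. norm (case z of (x, y) \<Rightarrow> \<bar>f x - f y\<bar> / dist x y powr s) \<le> w"
      by (rule Lp_norm_infinite_le)
    from MM.AE_pair[OF this]
    have "AE x in lborel. x \<in> \<Omega> \<longrightarrow> (AE y in lborel. y \<in> \<Omega> \<longrightarrow> \<bar>f x - f y\<bar> / dist x y powr s \<le> w)"
      by (simp add: AE_lebesgue_on[OF \<Omega>'])
    then show ?thesis using f0'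
    proof eventually_elim
      case (elim x)
      show ?case
      proof
        assume x: "x \<in> \<Omega>"
        with elim have "AE y in lborel. y \<in> \<Omega> \<longrightarrow> \<bar>f x - f y\<bar> / dist x y powr s \<le> w" "f x = f0 x" by auto
        from this(1) f0' show "AE y in lborel. y \<in> \<Omega> \<longrightarrow> \<bar>f0 x - f0 y\<bar> / dist x y powr s \<le> w"
          by eventually_elim (use \<open>f x = f0 x\<close> in auto)
      qed
    qed
  qed
qed

text \<open>The four cases \<open>s = 1\<close> or \<open>s < 1\<close>, \<open>p < \<infinity>\<close> or \<open>p = \<infinity>\<close> become one.  Passing to a Borel representative
  turns measurability on the product of completed measures into measurability of Borel functions.\<close>

theorem sobolev_control:
  assumes \<Omega>: "open \<Omega>" "bounded \<Omega>" and s: "0 < s" "s \<le> 1" and p: "p > ereal (2/s)" and \<kappa>: "0 \<le> \<kappa>"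
  obtains q K V where "2/s < q" "0 \<le> K" "0 \<le> V"
    "\<forall>f\<in>sobolev_space s p \<Omega>. \<exists>f0. f0 \<in> borel_measurable borel \<and> integrable lborel f0 \<and>
       (AE x in lborel. x \<in> \<Omega> \<longrightarrow> f x = f0 x) \<and>
       (\<forall>w\<ge>0. seminorm_le s p \<Omega> f w \<longrightarrow> energy_control \<Omega> \<kappa> s q K f0 (V * w powr q))"
proof -
  \<comment> \<open>For infinite \<open>p\<close> every finite exponent above \<open>2/s\<close> is possible.\<close>
  define q where "q = (if p = \<infinity> then 2/s + 1 else real_of_ereal p)"
  have q: "2/s < q" using p s by (cases p) (auto simp: q_def)
  have "2 \<le> 2/s" using s by (simp add: field_simps)
  then have q1: "1 < q" using q by linarith
  have p1: "p > 1" using p \<open>2 \<le> 2/s\<close> by (cases p) (auto simp: one_ereal_def)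
  have pq: "p \<noteq> \<infinity> \<Longrightarrow> p = ereal q" using p by (cases p) (auto simp: q_def)
  define K where "K = (if s = 1 then 8 * sqrt \<kappa> else if p = \<infinity> then \<kappa> powr (s/2) else 2 * \<kappa> powr ((s + 2/q)/2))"
  define V where "V = (if p = \<infinity> then measure lborel \<Omega> else 1)"
  have KV: "0 \<le> K" "0 \<le> V" using \<kappa> by (auto simp: K_def V_def)
  have \<Omega>': "\<Omega> \<in> sets lebesgue" using \<Omega> by simp
  have "\<exists>f0. f0 \<in> borel_measurable borel \<and> integrable lborel f0 \<and>
       (AE x in lborel. x \<in> \<Omega> \<longrightarrow> f x = f0 x) \<and>
       (\<forall>w\<ge>0. seminorm_le s p \<Omega> f w \<longrightarrow> energy_control \<Omega> \<kappa> s q K f0 (V * w powr q))"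
    if f: "f \<in> sobolev_space s p \<Omega>" for f
  proof -
    have fm: "f \<in> borel_measurable (lebesgue_on \<Omega>)" and fL: "Lp_norm p (lebesgue_on \<Omega>) f < \<infinity>"
      using f by (auto simp: sobolev_space_def Lp_space_def)
    obtain f0 where f0: "f0 \<in> borel_measurable borel" "AE x in lborel. indicator \<Omega> x * f x = f0 x"
      using borel_representative[OF \<Omega>' fm] .
    have if0: "integrable lborel f0"
      using integrable_representative[OF \<Omega>(1) Lp_integrable[OF \<Omega> fm fL p1] f0(1)] f0(2) by simp
    have "energy_control \<Omega> \<kappa> s q K f0 (V * w powr q)" if w: "0 \<le> w" "seminorm_le s p \<Omega> f w" for w
    proof (cases "s = 1")
      case True
      then obtain G where G: "weak_gradient \<Omega> f G" "Lp_norm p (lebesgue_on \<Omega>) G \<le> ereal w"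
        using w by (auto simp: seminorm_le_def)
      then have "Lp_norm p (lebesgue_on \<Omega>) G < \<infinity>" by (metis ereal_less_PInfty order_le_less_trans PInfty_neq_ereal(1) less_ereal.simps(2))
      then obtain g where g: "g \<in> borel_measurable borel" "integrable lborel g" "AE x in lborel. indicator \<Omega> x *\<^sub>R G x = g x"
        "\<And>\<phi> i. \<phi> \<in> test_functions \<Omega> \<Longrightarrow>
          (\<integral>x. f0 x * partial i \<phi> x \<partial>lborel) = - (\<integral>x. g x $ i * \<phi> x \<partial>lborel)"
        using gradient_representative[OF \<Omega> G(1) fm f0 _ p1] by blast
      note ge = gradient_energy[OF if0 g(2,4) \<Omega> \<kappa> q1 w(1)]
      show ?thesis
      proof (cases "p = \<infinity>")
        case pinf: True
        then have "AE x in lebesgue_on \<Omega>. norm (G x) \<le> w" using G(2) Lp_norm_infinite_le by blast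
        then have "AE x in lborel. x \<in> \<Omega> \<longrightarrow> norm (G x) \<le> w" by (simp add: AE_lebesgue_on[OF \<Omega>'])
        then have "AE x in lborel. norm (g x) \<le> w" using g(3)
        proof eventually_elim
          case (elim x)
          then have "g x = indicator \<Omega> x *\<^sub>R G x" by simp
          then show ?case using elim(1) w(1) by (cases "x \<in> \<Omega>") auto
        qed
        then show ?thesis using ge(2) True pinf by (simp add: K_def V_def)
      next
        case False
        then have "(\<integral>\<^sup>+x. ennreal (norm (G x) powr q) \<partial>lebesgue_on \<Omega>) \<le> ennreal (w powr q)"
          using Lp_norm_finite_le[of q w] q1 w(1) G(2) pq by simp
        also have "(\<integral>\<^sup>+x. ennreal (norm (G x) powr q) \<partial>lebesgue_on \<Omega>) =
            (\<integral>\<^sup>+x. ennreal (norm (G x) powr q) * indicator \<Omega> x \<partial>lborel)" by (rule nn_lebesgue_on[OF \<Omega>'])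
        also have "\<dots> = (\<integral>\<^sup>+x. ennreal (norm (g x) powr q) \<partial>lborel)"
          by (rule nn_integral_cong_AE, use g(3) in eventually_elim) (auto simp: indicator_def split: if_splits)
        finally show ?thesis using ge(1) True False by (simp add: K_def V_def)
      qed
    next
      case False
      then have L: "slobodeckij_seminorm s p \<Omega> f \<le> ereal w" using w by (simp add: seminorm_le_def)
      note sr = slobodeckij_representative[OF \<Omega> fm f0(2) w(1) L]
      note qe = quotient_energy[OF f0(1) \<Omega> \<kappa> s(1) q1 w(1)]
      show ?thesis
      proof (cases "p = \<infinity>")
        case True
        then show ?thesis using qe(2) sr(2) False by (simp add: K_def V_def)
      next
        case pf: False
        then show ?thesis using qe(1) sr(1)[OF pq] q1 False by (simp add: K_def V_def)
      qed
    qed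
    moreover have "AE x in lborel. x \<in> \<Omega> \<longrightarrow> f x = f0 x"
      using f0(2) by eventually_elim (auto simp: indicator_def)
    ultimately show ?thesis using f0 if0 by blast
  qed
  then show ?thesis using that[OF q KV] by blast
qed

section \<open>Size and shape of the triangles\<close>

definition area :: "tri \<Rightarrow> real" where
  "area E = measure lborel (region E)"

abbreviation inn :: "tri \<Rightarrow> (real^2) set" where
  "inn E \<equiv> interior (region E)"

text \<open>The sum of squares of the two sides at the newest vertex is halved by a bisection, by the parallelogram
  law, exactly as the area is.  The ratio of both, a measure of shape regularity, is
  therefore the same for all descendants of a triangle.\<close>

definition legs :: "tri \<Rightarrow> real" where
  "legs E = (dist (nv E) (ov1 E))\<^sup>2 + (dist (nv E) (ov2 E))\<^sup>2"

lemma dist2_sq: "(dist x y)\<^sup>2 = (x$1 - y$1)\<^sup>2 + (x$2 - y$2)\<^sup>2" for x y :: "real^2"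
  by (simp add: dist_vec_def L2_set_def sum_2 dist_real_def)

lemma midpoint_nth: "midpoint a b $ i = (a $ i + b $ i) / 2" for a b :: "real^2"
  by (simp add: midpoint_def)

lemma legs_child: "C \<in> children E \<Longrightarrow> legs C = legs E / 2"
  by (cases E, auto simp: children_def legs_def dist2_sq midpoint_nth)
    (simp_all add: power2_eq_square field_simps)

lemma area_Tri:
  "area (Tri v a b) = \<bar>(b$1 - v$1) * (a$2 - v$2) - (a$1 - v$1) * (b$2 - v$2)\<bar> / 2"
  using content_triangle[of v a b] by (simp add: area_def region_def)

lemma area_child:
  assumes "C \<in> children E" shows "area C = area E / 2"
proof -
  obtain v a b where E: "E = Tri v a b" by (cases E)
  define X where "X = (b$1 - v$1) * (a$2 - v$2) - (a$1 - v$1) * (b$2 - v$2)"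
  have 1: "(a$1 - midpoint a b$1) * (v$2 - midpoint a b$2) - (v$1 - midpoint a b$1) * (a$2 - midpoint a b$2) = X / 2"
    by (simp add: X_def midpoint_nth field_simps)
  have 2: "(b$1 - midpoint a b$1) * (v$2 - midpoint a b$2) - (v$1 - midpoint a b$1) * (b$2 - midpoint a b$2) = - (X / 2)"
    by (simp add: X_def midpoint_nth field_simps)
  have "area E = \<bar>X\<bar> / 2" by (simp add: E area_Tri X_def)
  moreover have "C = Tri (midpoint a b) v a \<or> C = Tri (midpoint a b) v b"
    using assms by (auto simp: children_def E)
  ultimately show ?thesis by (auto simp: area_Tri 1 2)
qed

lemma area_pos:
  assumes "nd E" shows "0 < area E"
proof -
  obtain v a b where E: "E = Tri v a b" by (cases E)
  define X where "X = (b$1 - v$1) * (a$2 - v$2) - (a$1 - v$1) * (b$2 - v$2)"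
  have "(b - a)$1 * (v - midpoint a b)$2 - (b - a)$2 * (v - midpoint a b)$1 = - X"
    by (simp add: X_def midpoint_nth field_simps)
  then have "X \<noteq> 0" using collinear_if_det_0[of b a v] assms by (auto simp: E nd_def)
  then show ?thesis by (simp add: E area_Tri X_def)
qed

lemma dist_le_legs:
  assumes "x \<in> region E" "y \<in> region E" shows "(dist x y)\<^sup>2 \<le> 2 * legs E"
proof -
  obtain u v where uv: "u \<in> verts E" "v \<in> verts E" "\<forall>x\<in>convex hull verts E. \<forall>y\<in>convex hull verts E. norm (x - y) \<le> norm (u - v)"
  proof -
    have "verts E \<noteq> {}" by (simp add: verts_def)
    then show ?thesis using simplex_extremal_le[OF finite_verts[of E]] that by blast
  qed
  have "dist x y \<le> dist u v" using uv assms by (simp add: region_def dist_norm)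
  then have "(dist x y)\<^sup>2 \<le> (dist u v)\<^sup>2" by (intro power_mono) auto
  also have "\<dots> \<le> 2 * legs E"
  proof -
    have "dist (ov1 E) (ov2 E) \<le> dist (nv E) (ov1 E) + dist (nv E) (ov2 E)"
      by (rule dist_triangle3)
    then have "(dist (ov1 E) (ov2 E))\<^sup>2 \<le> (dist (nv E) (ov1 E) + dist (nv E) (ov2 E))\<^sup>2" by (intro power_mono) auto
    also have "\<dots> \<le> 2 * legs E"
      using sum_squares_bound[of "dist (nv E) (ov1 E)" "dist (nv E) (ov2 E)"]
      by (simp add: legs_def power2_sum)
    finally have "(dist (ov1 E) (ov2 E))\<^sup>2 \<le> 2 * legs E" .
    moreover have "(dist (nv E) (ov1 E))\<^sup>2 \<le> 2 * legs E" "(dist (nv E) (ov2 E))\<^sup>2 \<le> 2 * legs E" "0 \<le> 2 * legs E"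
      by (simp_all add: legs_def)
    ultimately show ?thesis using uv by (auto simp: verts_def dist_commute)
  qed
  finally show ?thesis .
qed

lemma compact_region: "compact (region E)"
  unfolding region_def by (intro finite_imp_compact_convex_hull) simp

lemma convex_region: "convex (region E)"
  by (simp add: region_def)

lemma negligible_frontier_region: "negligible (frontier (region E))"
  by (rule negligible_convex_frontier[OF convex_region])

lemma AE_frontier: "AE x in lborel. x \<notin> frontier (region E)"
proof -
  have "frontier (region E) \<in> null_sets lebesgue"
    using negligible_frontier_region by (simp add: negligible_iff_null_sets)
  then have "AE x in lebesgue. x \<notin> frontier (region E)" by (rule AE_not_in)
  then show ?thesis by (simp add: AE_completion_iff)
qed

lemma region_inn: "x \<in> region E \<Longrightarrow> x \<notin> frontier (region E) \<Longrightarrow> x \<in> inn E"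
  using closure_subset[of "region E"] by (auto simp: frontier_def)

lemma measure_inn: "measure lborel (inn E) = area E"
  unfolding area_def
proof (rule measure_eq_AE)
  show "AE x in lborel. x \<in> inn E \<longleftrightarrow> x \<in> region E"
    using AE_frontier[of E] by eventually_elim (use region_inn interior_subset in blast)
  show "inn E \<in> sets lborel" "region E \<in> sets lborel"
    using compact_region by (auto intro: borel_compact)
qed

lemma inn_children:
  "AE x in lborel. x \<in> inn E \<longrightarrow> (\<exists>C\<in>children E. x \<in> inn C)"
proof -
  have "AE x in lborel. \<forall>C\<in>children E. x \<notin> frontier (region C)"
    by (rule AE_finite_allI) (auto simp: children_def AE_frontier)
  then show ?thesis
  proof eventually_elim
    case (elim x)
    show ?case
    proof
      assume "x \<in> inn E"
      then have "x \<in> region E" using interior_subset by blast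
      then obtain C where "C \<in> children E" "x \<in> region C" using region_children[of E] by blast
      then show "\<exists>C\<in>children E. x \<in> inn C" using elim region_inn by blast
    qed
  qed
qed

lemma inn_child_subset: "C \<in> children E \<Longrightarrow> inn C \<subseteq> inn E"
  using region_children[of E] by (intro interior_mono) blast

context labelled
begin

lemma forest_nd: "E \<in> forest \<Longrightarrow> nd E"
  using conf_nd[OF conf_U] lev_gen by blast

lemma forest_area_pos: "E \<in> forest \<Longrightarrow> 0 < area E"
  using area_pos forest_nd by blast

lemma forest_inn: "E \<in> forest \<Longrightarrow> inn E \<noteq> {}"
  using forest_area_pos measure_inn[of E] by fastforce

lemma root_scaling:
  assumes "E \<in> U k" obtains R where "R \<in> T0" "legs E = legs R / 2 ^ k" "area E = area R / 2 ^ k"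
proof -
  have "E \<in> U k \<Longrightarrow> \<exists>R\<in>T0. legs E = legs R / 2 ^ k \<and> area E = area R / 2 ^ k" for E k
  proof (induction k arbitrary: E)
    case (Suc k)
    then obtain P where P: "P \<in> U k" "E \<in> children P" by (blast elim: lev_SucE)
    obtain R where "R \<in> T0" "legs P = legs R / 2 ^ k" "area P = area R / 2 ^ k" using Suc.IH[OF P(1)] by blast
    then show ?case using legs_child[OF P(2)] area_child[OF P(2)] by (intro bexI[of _ R]) simp_all
  qed auto
  then show ?thesis using that assms by blast
qed

definition shape :: real where "shape = (\<Sum>R\<in>T0. 2 * legs R / area R)"

lemma finite_T0: "finite T0"
  using conf0 by (simp add: conf_def)

lemma legs_nonneg: "0 \<le> legs E"
  by (simp add: legs_def)

lemma T0_forest: "R \<in> T0 \<Longrightarrow> R \<in> forest"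
  using in_forest[of R 0] by simp

lemma shape_nonneg: "0 \<le> shape"
  unfolding shape_def using legs_nonneg forest_area_pos[OF T0_forest] by (intro sum_nonneg) (simp add: less_imp_le)

lemma dist_le_shape:
  assumes E: "E \<in> forest" and "x \<in> region E" "y \<in> region E"
  shows "(dist x y)\<^sup>2 \<le> shape * area E"
proof -
  obtain R where R: "R \<in> T0" "legs E = legs R / 2 ^ gen E" "area E = area R / 2 ^ gen E"
    using root_scaling[OF lev_gen[OF E]] .
  have pos: "0 < area R" using forest_area_pos[OF T0_forest[OF R(1)]] .
  have "2 * legs R / area R \<le> shape"
    unfolding shape_def using R(1) finite_T0 legs_nonneg forest_area_pos[OF T0_forest]
    by (intro member_le_sum) (auto intro!: divide_nonneg_pos)
  then have "2 * legs R \<le> shape * area R" using pos by (simp add: field_simps)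
  then have "2 * legs E \<le> shape * area E" unfolding R(2,3) by (simp add: divide_right_mono)
  then show ?thesis using dist_le_legs[OF assms(2,3)] by linarith
qed

lemma area_le:
  assumes "E \<in> U k" shows "area E \<le> (\<Sum>R\<in>T0. area R) / 2 ^ k"
proof -
  obtain R where R: "R \<in> T0" "area E = area R / 2 ^ k" using root_scaling[OF assms] .
  have "area R \<le> (\<Sum>R\<in>T0. area R)"
    using R(1) finite_T0 forest_area_pos[OF T0_forest] by (intro member_le_sum) (auto intro: less_imp_le)
  then show ?thesis using R(2) by (simp add: divide_right_mono)
qed

lemma inn_disjoint:
  assumes "D \<in> U k" "F \<in> U k" "D \<noteq> F" shows "inn D \<inter> inn F = {}"
proof -
  have "inn D \<inter> inn F = interior (convex hull (verts D \<inter> verts F))"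
    using conf_Int[OF conf_U assms(1,2)] by (simp add: interior_Int[symmetric])
  also have "\<dots> = {}"
    using common_verts_collinear(2)[OF conf_U assms] by (intro empty_interior_convex_hull) auto
  finally show ?thesis .
qed

lemma leaves_disjoint:
  assumes T: "T \<in> refs" "E \<in> T" "F \<in> T" "E \<noteq> F" shows "inn E \<inter> inn F = {}"
proof -
  have *: "inn E \<inter> inn F = {}" if le: "gen E \<le> gen F" and "E \<in> T" "F \<in> T" "E \<noteq> F" for E F
  proof -
    have f: "E \<in> forest" "F \<in> forest" using that ref_forest[OF T(1)] by auto
    obtain A where A: "A \<in> U (gen E)" "anc A F" using ancestor_at[OF lev_gen[OF f(2)] le] .
    have "A \<noteq> E"
    proof
      assume "A = E"
      then show False using leaf_unique[OF T(1) that(2,3), of F] A that(4) by simp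
    qed
    then have "inn E \<inter> inn A = {}" using inn_disjoint[OF lev_gen[OF f(1)] A(1)] by auto
    moreover have "inn F \<subseteq> inn A" using desc_props(3)[OF A(2) in_forest[OF A(1)]] by (rule interior_mono)
    ultimately show ?thesis by blast
  qed
  show ?thesis using *[of E F] *[of F E] T by (metis Int_commute nat_le_linear)
qed

lemma refs_cover: "T \<in> refs \<Longrightarrow> \<Union>(region ` T) = \<Union>(region ` T0)"
proof (induction rule: refinements.induct)
  case (bisection T E)
  have "\<Union>(region ` bisect T E) = \<Union>(region ` (T - {E})) \<union> region E"
    using region_children[of E] by (auto simp: bisect_def)
  also have "\<dots> = \<Union>(region ` T)" using bisection(2) by blast
  finally show ?case using bisection by simp
qed simp

lemma inn_disjoint_family:
  "disjoint (inn ` U k)" "inj_on inn (U k)"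
proof -
  show "disjoint (inn ` U k)" using inn_disjoint by (force simp: disjoint_def)
  show "inj_on inn (U k)"
  proof (rule inj_onI, rule ccontr)
    fix D F assume "D \<in> U k" "F \<in> U k" "inn D = inn F" "D \<noteq> F"
    then show False using inn_disjoint[of D k F] forest_inn[OF in_forest[of D k]] by auto
  qed
qed

end

section \<open>From oscillation integrals to pointwise bounds\<close>

definition avg :: "(real^2 \<Rightarrow> real) \<Rightarrow> tri \<Rightarrow> real" where
  "avg f E = (\<integral>x. indicator (inn E) x * f x \<partial>lborel) / area E"

definition dev :: "(real^2 \<Rightarrow> real) \<Rightarrow> real \<Rightarrow> tri \<Rightarrow> ennreal" where
  "dev f c E = (\<integral>\<^sup>+x. indicator (inn E) x * ennreal \<bar>f x - c\<bar> \<partial>lborel)"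

lemma emeasure_inn: "nd E \<Longrightarrow> emeasure lborel (inn E) = ennreal (area E)"
proof -
  assume "nd E"
  then have "inn E \<noteq> {}" using area_pos measure_inn[of E] by fastforce
  moreover have "bounded (inn E)" using compact_region compact_imp_bounded bounded_interior by blast
  ultimately show ?thesis using measure_open_pos(2)[of "inn E"] measure_inn by simp
qed

lemma avg_diff:
  assumes f: "integrable lborel f" and E: "nd E"
  shows "ennreal (area E * \<bar>avg f E - c\<bar>) \<le> (\<integral>\<^sup>+y. indicator (inn E) y * ennreal \<bar>f y - c\<bar> \<partial>lborel)"
proof -
  have a: "0 < area E" using area_pos[OF E] .
  have i: "integrable lborel (\<lambda>y. indicator (inn E) y *\<^sub>R f y)" using f by (intro integrable_mult_indicator) auto
  have j: "integrable lborel (\<lambda>y. indicator (inn E) y * c)"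
    using emeasure_inn[OF E] by (intro integrable_mult_left) (simp add: integrable_indicator_iff)
  have "(\<integral>y. indicator (inn E) y * (f y - c) \<partial>lborel) = area E * (avg f E - c)"
    using i j a measure_inn[of E] by (simp add: right_diff_distrib avg_def)
  then have "area E * \<bar>avg f E - c\<bar> = norm (\<integral>y. indicator (inn E) y * (f y - c) \<partial>lborel)"
    using a by (simp add: abs_mult)
  also have "ennreal \<dots> \<le> (\<integral>\<^sup>+y. ennreal (norm (indicator (inn E) y * (f y - c))) \<partial>lborel)"
    by (rule norm_integral_le)
  also have "\<dots> = (\<integral>\<^sup>+y. indicator (inn E) y * ennreal \<bar>f y - c\<bar> \<partial>lborel)"
    by (intro nn_integral_cong) (auto simp: indicator_def)
  finally show ?thesis .
qed

lemma dev_le_osc: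
  assumes f: "integrable lborel f" and E: "nd E"
  shows "ennreal (area E) * dev f (avg f E) E \<le> osc f (inn E)"
proof -
  have [measurable]: "f \<in> borel_measurable borel" using borel_measurable_integrable[OF f] by simp
  have "ennreal (area E) * dev f (avg f E) E =
      (\<integral>\<^sup>+x. ennreal (area E) * (indicator (inn E) x * ennreal \<bar>f x - avg f E\<bar>) \<partial>lborel)"
    unfolding dev_def by (rule nn_integral_cmult[symmetric]) measurable
  also have "\<dots> \<le> (\<integral>\<^sup>+x. indicator (inn E) x * (\<integral>\<^sup>+y. indicator (inn E) y * ennreal \<bar>f x - f y\<bar> \<partial>lborel) \<partial>lborel)"
  proof (rule nn_integral_mono)
    fix x
    have "ennreal (area E) * ennreal \<bar>f x - avg f E\<bar> = ennreal (area E * \<bar>avg f E - f x\<bar>)"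
      using area_pos[OF E] by (simp add: ennreal_mult abs_minus_commute)
    also have "\<dots> \<le> (\<integral>\<^sup>+y. indicator (inn E) y * ennreal \<bar>f y - f x\<bar> \<partial>lborel)"
      by (rule avg_diff[OF f E])
    finally have "ennreal (area E) * ennreal \<bar>f x - avg f E\<bar> \<le> (\<integral>\<^sup>+y. indicator (inn E) y * ennreal \<bar>f x - f y\<bar> \<partial>lborel)"
      by (simp add: abs_minus_commute)
    then show "ennreal (area E) * (indicator (inn E) x * ennreal \<bar>f x - avg f E\<bar>) \<le>
       indicator (inn E) x * (\<integral>\<^sup>+y. indicator (inn E) y * ennreal \<bar>f x - f y\<bar> \<partial>lborel)"
      by (auto simp: indicator_def)
  qed
  also have "\<dots> = osc f (inn E)"
    unfolding osc_def by (intro nn_integral_cong, subst nn_integral_cmult[symmetric]) (auto simp: mult.assoc)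
  finally show ?thesis .
qed

context labelled
begin

text \<open>Means over successive descendants differ by terms of a geometric series, as \<open>\<alpha> > 0\<close>.  The function
  tends to follow these means: the \<open>L\<^sup>1\<close> distance to the mean, summed over the descendants of one
  generation, decays as well.  A pointwise bound almost everywhere results in the limit.\<close>

lemma pointwise_bound:
  fixes f :: "real^2 \<Rightarrow> real" and \<nu> :: "tri \<Rightarrow> real"
  assumes f: "integrable lborel f" and K: "0 \<le> K" and \<alpha>: "0 < \<alpha>" and q: "0 < q"
    and \<nu>: "\<And>E. E \<in> forest \<Longrightarrow> 0 \<le> \<nu> E" "\<And>E C. E \<in> forest \<Longrightarrow> C \<in> children E \<Longrightarrow> \<nu> C \<le> \<nu> E"
    and osc: "\<And>E. E \<in> forest \<Longrightarrow> osc f (inn E) \<le> ennreal (K * area E powr (2 + \<alpha>) * \<nu> E powr (1/q))"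
    and E: "E \<in> forest"
  shows "AE x in lborel. x \<in> inn E \<longrightarrow>
    \<bar>f x - avg f E\<bar> \<le> 2 * K / (1 - 2 powr - \<alpha>) * area E powr \<alpha> * \<nu> E powr (1/q)"
proof -
  have [measurable]: "f \<in> borel_measurable borel" using borel_measurable_integrable[OF f] by simp
  define r :: real where "r = 2 powr - \<alpha>"
  have r: "0 < r" "r < 1" using \<alpha> by (auto simp: r_def powr_less_one)
  define S where "S = 1 / (1 - r)"
  have S: "0 < S" "1 + r * S = S" using r by (auto simp: S_def field_simps)
  define b where "b E = K * area E powr \<alpha> * \<nu> E powr (1/q)" for E
  have b: "0 \<le> b E" for E using K by (simp add: b_def)
  have half: "(x / 2) powr \<alpha> = r * x powr \<alpha>" if "0 < x" for x
    using that by (simp add: r_def powr_divide powr_minus field_simps)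
  have bC: "b C \<le> r * b E" if "E \<in> forest" "C \<in> children E" for E C
  proof -
    have "\<nu> C powr (1/q) \<le> \<nu> E powr (1/q)"
      using \<nu>(2)[OF that] \<nu>(1)[OF children_forest[OF that]] q by (intro powr_mono2) auto
    then have "K * (r * area E powr \<alpha>) * \<nu> C powr (1/q) \<le> K * (r * area E powr \<alpha>) * \<nu> E powr (1/q)"
      using K r by (intro mult_left_mono) auto
    moreover have "area C powr \<alpha> = r * area E powr \<alpha>"
      unfolding area_child[OF that(2)] by (rule half[OF forest_area_pos[OF that(1)]])
    ultimately show ?thesis by (simp add: b_def mult_ac)
  qed
  have dev: "dev f (avg f E) E \<le> ennreal (area E * b E)" if E: "E \<in> forest" for E
  proof -
    have a: "0 < area E" using forest_area_pos[OF E] .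
    have "ennreal (area E) * dev f (avg f E) E \<le> ennreal (K * area E powr (2 + \<alpha>) * \<nu> E powr (1/q))"
      using dev_le_osc[OF f forest_nd[OF E]] osc[OF E] by (rule order_trans)
    also have "K * area E powr (2 + \<alpha>) * \<nu> E powr (1/q) = area E * (area E * b E)"
      using a by (simp add: b_def powr_add power2_eq_square)
    also have "ennreal \<dots> = ennreal (area E) * ennreal (area E * b E)"
      using a b[of E] by (simp add: ennreal_mult)
    finally show ?thesis using a by (simp add: ennreal_mult_le_mult_iff)
  qed
  have avgC: "\<bar>avg f C - avg f E\<bar> \<le> 2 * b E" if E: "E \<in> forest" "C \<in> children E" for E C
  proof -
    have a: "0 < area E" "area C = area E / 2" using forest_area_pos[OF E(1)] area_child[OF E(2)] by auto
    have "ennreal (area C * \<bar>avg f C - avg f E\<bar>) \<le> (\<integral>\<^sup>+y. indicator (inn C) y * ennreal \<bar>f y - avg f E\<bar> \<partial>lborel)"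
      by (rule avg_diff[OF f forest_nd[OF children_forest[OF E]]])
    also have "\<dots> \<le> dev f (avg f E) E"
      unfolding dev_def using inn_child_subset[OF E(2)] by (intro nn_integral_mono) (auto simp: indicator_def)
    also have "\<dots> \<le> ennreal (area E * b E)" using dev[OF E(1)] .
    finally have "area C * \<bar>avg f C - avg f E\<bar> \<le> area E * b E"
      using a(1) b[of E] by (subst (asm) ennreal_le_iff) simp_all
    then show ?thesis using a by (simp add: field_simps)
  qed
  \<comment> \<open>The excess over a level \<open>k\<close> that dominates the means of all descendants is at most the \<open>L\<^sup>1\<close>
      distance to these means; induction on the number of bisections gains a factor \<open>r < 1\<close> each time.\<close>
  have claim: "(\<integral>\<^sup>+x. indicator (inn E) x * ennreal (\<bar>f x - c\<bar> - k) \<partial>lborel) \<le> ennreal (area E * b E * r ^ n)"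
    if "E \<in> forest" "\<bar>avg f E - c\<bar> + 2 * S * b E \<le> k" for E c k n
    using that
  proof (induction n arbitrary: E)
    case 0
    have "(\<integral>\<^sup>+x. indicator (inn E) x * ennreal (\<bar>f x - c\<bar> - k) \<partial>lborel) \<le> dev f (avg f E) E"
      unfolding dev_def
    proof (rule nn_integral_mono)
      fix x
      have "0 \<le> 2 * S * b E" using S b[of E] by simp
      then have "\<bar>f x - c\<bar> - k \<le> \<bar>f x - avg f E\<bar>" using 0(2) by linarith
      then show "indicator (inn E) x * ennreal (\<bar>f x - c\<bar> - k) \<le> indicator (inn E) x * ennreal \<bar>f x - avg f E\<bar>"
        by (intro mult_left_mono ennreal_leI) auto
    qed
    then show ?case using dev[OF 0(1)] by simp
  next
    case (Suc n)
    have a: "0 < area E" using forest_area_pos[OF Suc(2)] .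
    have C: "(\<integral>\<^sup>+x. indicator (inn C) x * ennreal (\<bar>f x - c\<bar> - k) \<partial>lborel) \<le> ennreal (area E * b E * r ^ Suc n / 2)"
      if C: "C \<in> children E" for C
    proof -
      have "2 * S * b C \<le> 2 * S * (r * b E)" using bC[OF Suc(2) C] S by (intro mult_left_mono) auto
      then have "\<bar>avg f C - c\<bar> + 2 * S * b C \<le> \<bar>avg f E - c\<bar> + 2 * b E + 2 * S * (r * b E)"
        using avgC[OF Suc(2) C] by linarith
      also have "\<dots> = \<bar>avg f E - c\<bar> + 2 * (1 + r * S) * b E" by (simp add: algebra_simps)
      also have "\<dots> \<le> k" using Suc(3) S(2) by simp
      finally have "(\<integral>\<^sup>+x. indicator (inn C) x * ennreal (\<bar>f x - c\<bar> - k) \<partial>lborel) \<le> ennreal (area C * b C * r ^ n)"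
        by (rule Suc.IH[OF children_forest[OF Suc(2) C]])
      also have "area C * b C * r ^ n \<le> area E / 2 * (r * b E) * r ^ n"
        using bC[OF Suc(2) C] a r area_child[OF C] by (intro mult_right_mono mult_mono) (auto simp: b)
      finally show ?thesis by (simp add: mult_ac ennreal_leI)
    qed
    have "(\<integral>\<^sup>+x. indicator (inn E) x * ennreal (\<bar>f x - c\<bar> - k) \<partial>lborel) \<le>
       (\<integral>\<^sup>+x. (\<Sum>C\<in>children E. indicator (inn C) x * ennreal (\<bar>f x - c\<bar> - k)) \<partial>lborel)"
    proof (rule nn_integral_mono_AE)
      show "AE x in lborel. indicator (inn E) x * ennreal (\<bar>f x - c\<bar> - k) \<le>
          (\<Sum>C\<in>children E. indicator (inn C) x * ennreal (\<bar>f x - c\<bar> - k))"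
        using inn_children[of E]
      proof eventually_elim
        case (elim x)
        show ?case
        proof (cases "x \<in> inn E")
          case True
          then obtain C where "C \<in> children E" "x \<in> inn C" using elim by blast
          then show ?thesis
            using True member_le_sum[of C "children E" "\<lambda>C. indicator (inn C) x * ennreal (\<bar>f x - c\<bar> - k)"]
            by (simp add: children_def)
        qed simp
      qed
    qed
    also have "\<dots> = (\<Sum>C\<in>children E. \<integral>\<^sup>+x. indicator (inn C) x * ennreal (\<bar>f x - c\<bar> - k) \<partial>lborel)"
      by (rule nn_integral_sum) measurable
    also have "\<dots> \<le> (\<Sum>C\<in>children E. ennreal (area E * b E * r ^ Suc n / 2))"
      by (rule sum_mono[OF C])
    also have "\<dots> \<le> ennreal (area E * b E * r ^ Suc n / 2) + ennreal (area E * b E * r ^ Suc n / 2)"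
      by (simp add: children_def sum.insert_if del: sum_constant)
    also have "\<dots> = ennreal (area E * b E * r ^ Suc n)"
      using a b[of E] r by (subst ennreal_plus[symmetric]) auto
    finally show ?case .
  qed
  define k where "k = 2 * S * b E"
  have "(\<lambda>n. ennreal (area E * b E * r ^ n)) \<longlonglongrightarrow> ennreal (area E * b E * 0)"
    using r by (intro tendsto_intros LIMSEQ_power_zero) auto
  then have "(\<integral>\<^sup>+x. indicator (inn E) x * ennreal (\<bar>f x - avg f E\<bar> - k) \<partial>lborel) \<le> ennreal (area E * b E * 0)"
    by (rule LIMSEQ_le_const) (use claim[OF E, of "avg f E" k] in \<open>auto simp: k_def\<close>)
  then have "(\<integral>\<^sup>+x. indicator (inn E) x * ennreal (\<bar>f x - avg f E\<bar> - k) \<partial>lborel) = 0" by simp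
  then have "AE x in lborel. indicator (inn E) x * ennreal (\<bar>f x - avg f E\<bar> - k) = 0"
    by (subst (asm) nn_integral_0_iff_AE) auto
  then show ?thesis
  proof eventually_elim
    case (elim x)
    show ?case
    proof
      assume "x \<in> inn E"
      then have "\<bar>f x - avg f E\<bar> \<le> k" using elim by (simp add: ennreal_eq_0_iff)
      then show "\<bar>f x - avg f E\<bar> \<le> 2 * K / (1 - 2 powr - \<alpha>) * area E powr \<alpha> * \<nu> E powr (1/q)"
        by (simp add: k_def b_def S_def r_def)
    qed
  qed
qed

end

section \<open>The rate of GREEDY\<close>

lemma measurable_on_negligible:
  fixes f :: "real^2 \<Rightarrow> real"
  assumes "negligible N" shows "f \<in> borel_measurable (lebesgue_on N)"
proof (rule measurableI)
  fix X
  have "f -` X \<inter> N \<in> sets lebesgue" using assms by (intro negligible_imp_sets negligible_subset[OF assms]) auto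
  then show "f -` X \<inter> space (lebesgue_on N) \<in> sets (lebesgue_on N)"
    using negligible_imp_sets[OF assms] by (simp add: sets_restrict_space_iff)
qed simp

lemma matrix_integral_nth:
  fixes A :: "'a \<Rightarrow> real^2^2"
  assumes A: "\<And>i j. integrable M (\<lambda>x. A x $ i $ j)"
  shows "integrable M A" "(LINT x|M. A x) $ i $ j = (LINT x|M. A x $ i $ j)"
proof -
  have "A x = (\<Sum>k\<in>UNIV. \<Sum>l\<in>UNIV. A x $ k $ l *\<^sub>R axis k (axis l 1))" for x
    by (simp add: vec_eq_iff forall_2 sum_2 axis_def)
  then have "A = (\<lambda>x. \<Sum>k\<in>UNIV. \<Sum>l\<in>UNIV. A x $ k $ l *\<^sub>R axis k (axis l 1))" by (rule ext)
  moreover have "integrable M (\<lambda>x. \<Sum>k\<in>UNIV. \<Sum>l\<in>UNIV. A x $ k $ l *\<^sub>R axis k (axis l (1::real)) :: real^2^2)"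
    using A by (intro Bochner_Integration.integrable_sum integrable_scaleR_left) auto
  ultimately show i: "integrable M A" by metis
  have "bounded_linear (\<lambda>M::real^2^2. M $ i $ j)"
    by (rule bounded_linear_compose[OF bounded_linear_vec_nth bounded_linear_vec_nth])
  from integral_bounded_linear[OF this i] show "(LINT x|M. A x) $ i $ j = (LINT x|M. A x $ i $ j)" by simp
qed

lemma matrix_measurable:
  fixes A :: "'a \<Rightarrow> real^2^2"
  assumes A: "\<And>i j. (\<lambda>x. A x $ i $ j) \<in> borel_measurable M"
  shows "A \<in> borel_measurable M"
proof -
  have "A x = (\<Sum>k\<in>UNIV. \<Sum>l\<in>UNIV. A x $ k $ l *\<^sub>R axis k (axis l 1))" for x
    by (simp add: vec_eq_iff forall_2 sum_2 axis_def)
  then have "A = (\<lambda>x. \<Sum>k\<in>UNIV. \<Sum>l\<in>UNIV. A x $ k $ l *\<^sub>R axis k (axis l 1))" by (rule ext)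
  moreover have "(\<lambda>x. \<Sum>k\<in>UNIV. \<Sum>l\<in>UNIV. A x $ k $ l *\<^sub>R axis k (axis l (1::real)) :: real^2^2) \<in> borel_measurable M"
    using A by (intro borel_measurable_sum borel_measurable_scaleR) auto
  ultimately show ?thesis by metis
qed

lemma matrix_norm_le:
  fixes M :: "real^2^2"
  assumes "\<And>i j. \<bar>M $ i $ j\<bar> \<le> b"
  shows "norm M \<le> 4 * b"
proof -
  have "norm M \<le> (\<Sum>i\<in>UNIV. norm (M $ i))" unfolding norm_vec_def by (rule L2_set_le_sum) simp
  also have "\<dots> \<le> (\<Sum>i\<in>UNIV. \<Sum>j\<in>UNIV. \<bar>M $ i $ j\<bar>)" by (intro sum_mono norm_le_l1_cart)
  also have "\<dots> \<le> (\<Sum>i\<in>(UNIV::2 set). \<Sum>j\<in>(UNIV::2 set). b)" by (intro sum_mono assms)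
  finally show ?thesis by simp
qed

locale meshed = labelled +
  fixes \<Omega> :: "(real^2) set"
  assumes open_domain: "open \<Omega>" and bounded_domain: "bounded \<Omega>" and nonempty_domain: "\<Omega> \<noteq> {}"
    and regular: "interior (closure \<Omega>) = \<Omega>" and cover: "\<Union>(region ` T0) = closure \<Omega>"
begin

lemma inn_domain: "E \<in> forest \<Longrightarrow> inn E \<subseteq> \<Omega>"
proof -
  assume "E \<in> forest"
  then obtain R where R: "R \<in> T0" "anc R E" using forest_iff by blast
  then have "region E \<subseteq> region R" using desc_props(3)[OF R(2) T0_forest] by simp
  also have "\<dots> \<subseteq> closure \<Omega>" unfolding cover[symmetric] using R(1) by (rule UN_upper)
  finally show ?thesis using interior_mono[of "region E" "closure \<Omega>"] regular by simp
qed

lemma domain_lebesgue: "\<Omega> \<in> sets lebesgue"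
  using open_domain by simp

lemma region_lebesgue: "region E \<in> sets lebesgue"
  using compact_region by (intro fmeasurableD lmeasurable_compact)

lemma AE_in_leaf:
  assumes "T \<in> refs" shows "AE x in lborel. x \<in> \<Omega> \<longrightarrow> (\<exists>E\<in>T. x \<in> inn E)"
proof -
  have sub: "\<Omega> \<subseteq> \<Union>(region ` T)"
    using closure_subset[of \<Omega>] refs_cover[OF assms] cover by simp
  have "AE x in lborel. \<forall>E\<in>T. x \<notin> frontier (region E)"
    using ref_finite[OF assms] AE_frontier by (intro AE_finite_allI) auto
  then show ?thesis
  proof eventually_elim
    case (elim x)
    show ?case
    proof
      assume "x \<in> \<Omega>"
      then obtain E where "E \<in> T" "x \<in> region E" using sub by blast
      then show "\<exists>E\<in>T. x \<in> inn E" using elim region_inn[of x E] by blast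
    qed
  qed
qed

lemma T0_nonempty: "T0 \<noteq> {}"
  using cover nonempty_domain closure_subset by force

lemma restrict_region_measurable:
  fixes f :: "real^2 \<Rightarrow> real"
  assumes f: "f \<in> borel_measurable (lebesgue_on \<Omega>)" and E: "E \<in> forest"
  shows "f \<in> borel_measurable (lebesgue_on (region E))"
proof -
  have N: "negligible (region E - \<Omega>)"
  proof (rule negligible_subset[OF negligible_frontier_region])
    show "region E - \<Omega> \<subseteq> frontier (region E)" using inn_domain[OF E] region_inn by blast
  qed
  have sub: "restrict_space (lebesgue_on (region E)) X = lebesgue_on X" if "X \<subseteq> region E" "X \<in> sets lebesgue" for X
    using that region_lebesgue by (subst restrict_restrict_space) (auto simp: Int_absorb1)
  show ?thesis
  proof (rule measurable_piecewise_restrict[of "{region E \<inter> \<Omega>, region E - \<Omega>}"])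
    fix X assume X: "X \<in> {region E \<inter> \<Omega>, region E - \<Omega>}"
    then have XL: "X \<in> sets lebesgue" "X \<subseteq> region E" using region_lebesgue domain_lebesgue by auto
    then show "X \<inter> space (lebesgue_on (region E)) \<in> sets (lebesgue_on (region E))"
      using region_lebesgue by (auto simp: sets_restrict_space_iff Int_absorb2)
    have "f \<in> borel_measurable (lebesgue_on X)"
      using X measurable_on_negligible[OF N] measurable_restrict_mono[OF f, of "region E \<inter> \<Omega>"] by auto
    then show "f \<in> borel_measurable (restrict_space (lebesgue_on (region E)) X)" using sub XL by simp
  qed auto
qed

lemma region_integral:
  assumes f: "f \<in> borel_measurable (lebesgue_on \<Omega>)" and E: "E \<in> forest"
    and f0: "integrable lborel f0" "AE x in lborel. x \<in> \<Omega> \<longrightarrow> f x = f0 x"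
  shows "integrable (lebesgue_on (region E)) f" "(LINT x|lebesgue_on (region E). f x) = area E * avg f0 E"
proof -
  have ae: "AE x in lebesgue. indicator (region E) x *\<^sub>R f x = indicator (inn E) x * f0 x"
    unfolding AE_completion_iff using f0(2) AE_frontier[of E]
  proof eventually_elim
    case (elim x)
    then show ?case
      using region_inn[of x E] interior_subset[of "region E"] inn_domain[OF E] by (cases "x \<in> inn E") (auto simp: indicator_def)
  qed
  have b0: "f0 \<in> borel_measurable borel" using borel_measurable_integrable[OF f0(1)] by simp
  have m: "(\<lambda>x. indicator (region E) x *\<^sub>R f x) \<in> borel_measurable lebesgue"
    using restrict_region_measurable[OF f E] region_lebesgue by (simp add: borel_measurable_restrict_space_iff)
  have b1: "(\<lambda>x. indicator (inn E) x * f0 x) \<in> borel_measurable borel" using b0 by simp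
  then have m0: "(\<lambda>x. indicator (inn E) x * f0 x) \<in> borel_measurable lebesgue" by (simp add: measurable_completion)
  have i: "integrable lborel (\<lambda>x. indicator (inn E) x * f0 x)"
    using integrable_mult_indicator[of "inn E" lborel f0] f0(1) by simp
  then have "integrable lebesgue (\<lambda>x. indicator (inn E) x * f0 x)"
    using b1 by (simp add: integrable_completion)
  then have "integrable lebesgue (\<lambda>x. indicator (region E) x *\<^sub>R f x)"
    using integrable_cong_AE[OF m m0 ae] by simp
  then show "integrable (lebesgue_on (region E)) f"
    using region_lebesgue by (simp add: integrable_restrict_space)
  have "(LINT x|lebesgue_on (region E). f x) = (LINT x|lebesgue. indicator (region E) x *\<^sub>R f x)"
    using region_lebesgue by (simp add: integral_restrict_space)
  also have "\<dots> = (LINT x|lebesgue. indicator (inn E) x * f0 x)" by (rule integral_cong_AE[OF m m0 ae])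
  also have "\<dots> = (\<integral>x. indicator (inn E) x * f0 x \<partial>lborel)" using b1 by (intro integral_completion) simp
  also have "\<dots> = area E * avg f0 E" using forest_area_pos[OF E] by (simp add: avg_def)
  finally show "(LINT x|lebesgue_on (region E). f x) = area E * avg f0 E" .
qed

context
  fixes A :: matrix_field and f :: "2 \<Rightarrow> 2 \<Rightarrow> real^2 \<Rightarrow> real"
  assumes A: "\<And>i j. (\<lambda>x. A x $ i $ j) \<in> borel_measurable (lebesgue_on \<Omega>)"
    and f: "\<And>i j. integrable lborel (f i j)" "\<And>i j. AE x in lborel. x \<in> \<Omega> \<longrightarrow> A x $ i $ j = f i j x"
begin

lemma mean_nth: "E \<in> forest \<Longrightarrow> mean E A $ i $ j = avg (f i j) E"
proof -
  assume E: "E \<in> forest"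
  have "(LINT x|lebesgue_on (region E). A x) $ i $ j = area E * avg (f i j) E"
    using matrix_integral_nth(2)[OF region_integral(1)[OF A E f]] region_integral(2)[OF A E f] by simp
  moreover have "measure lebesgue (region E) = area E"
    using compact_region[of E] by (simp add: area_def borel_compact)
  ultimately show ?thesis using forest_area_pos[OF E] by (simp add: mean_def)
qed

text \<open>The factor four accounts for the number of entries of the matrix.\<close>

lemma local_zeta_le:
  assumes E: "E \<in> forest" and b: "\<And>i j. AE x in lborel. x \<in> inn E \<longrightarrow> \<bar>f i j x - avg (f i j) E\<bar> \<le> b"
  shows "local_zeta E A \<le> ereal (4 * b)"
proof -
  have m: "A \<in> borel_measurable (lebesgue_on (region E))"
    using matrix_measurable restrict_region_measurable[OF A E] by blast
  have "AE x in lborel. \<forall>i j. (x \<in> \<Omega> \<longrightarrow> A x $ i $ j = f i j x) \<and> (x \<in> inn E \<longrightarrow> \<bar>f i j x - avg (f i j) E\<bar> \<le> b)"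
    using f(2) b by (simp add: AE_all_countable AE_conj_iff)
  then have "AE x in lborel. x \<in> region E \<longrightarrow> norm (A x - mean E A) \<le> 4 * b"
    using AE_frontier[of E]
  proof eventually_elim
    case (elim x)
    show ?case
    proof
      assume "x \<in> region E"
      then have "x \<in> inn E" using elim region_inn by blast
      then have "\<bar>(A x - mean E A) $ i $ j\<bar> \<le> b" for i j
        using elim inn_domain[OF E] mean_nth[OF E] by auto
      then show "norm (A x - mean E A) \<le> 4 * b" by (rule matrix_norm_le)
    qed
  qed
  then have "AE x in lebesgue_on (region E). ereal (norm (A x - mean E A)) \<le> ereal (4 * b)"
    by (simp add: AE_lebesgue_on[OF region_lebesgue])
  then show ?thesis
    unfolding local_zeta_def Lp_norm_def using m by (auto intro!: esssup_I)
qed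

lemma zeta_le:
  assumes T: "T \<in> refs" and loc: "\<And>E. E \<in> T \<Longrightarrow> local_zeta E A \<le> ereal c"
  shows "zeta \<Omega> T A \<le> ereal c"
proof -
  have pm: "piecewise_mean T A x = mean E A" if E: "E \<in> T" "x \<in> inn E" for E x
  proof -
    have "piecewise_mean T A x = (\<Sum>F\<in>{E}. indicator (inn F) x *\<^sub>R mean F A)"
      unfolding piecewise_mean_def
    proof (rule sum.mono_neutral_right)
      show "\<forall>F\<in>T - {E}. indicator (inn F) x *\<^sub>R mean F A = 0"
      proof
        fix F assume "F \<in> T - {E}"
        then have "x \<notin> inn F" using leaves_disjoint[OF T E(1), of F] E(2) by auto
        then show "indicator (inn F) x *\<^sub>R mean F A = 0" by simp
      qed
    qed (use E ref_finite[OF T] in auto)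
    then show ?thesis using E by simp
  qed
  have "AE x in lborel. x \<in> region E \<longrightarrow> norm (A x - mean E A) \<le> c" if "E \<in> T" for E
    using Lp_norm_infinite_le[OF loc[OF that, unfolded local_zeta_def]] by (simp add: AE_lebesgue_on[OF region_lebesgue])
  then have "AE x in lborel. \<forall>E\<in>T. x \<in> region E \<longrightarrow> norm (A x - mean E A) \<le> c"
    using ref_finite[OF T] by (intro AE_finite_allI) auto
  then have "AE x in lborel. x \<in> \<Omega> \<longrightarrow> norm (A x - piecewise_mean T A x) \<le> c"
    using AE_in_leaf[OF T]
  proof eventually_elim
    case (elim x)
    show ?case
    proof
      assume "x \<in> \<Omega>"
      then obtain E where "E \<in> T" "x \<in> inn E" using elim by blast
      then show "norm (A x - piecewise_mean T A x) \<le> c"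
        using elim(1) interior_subset[of "region E"] pm by auto
    qed
  qed
  then have "AE x in lebesgue_on \<Omega>. ereal (norm (A x - piecewise_mean T A x)) \<le> ereal c"
    by (simp add: AE_lebesgue_on[OF domain_lebesgue])
  moreover have "(\<lambda>x. ereal (norm (A x - piecewise_mean T A x))) \<in> borel_measurable (lebesgue_on \<Omega>)"
  proof -
    have "piecewise_mean T A \<in> borel_measurable borel"
      unfolding piecewise_mean_def[abs_def] by measurable
    then have "piecewise_mean T A \<in> borel_measurable (lebesgue_on \<Omega>)"
      by (simp add: measurable_completion measurable_restrict_space1)
    then show ?thesis using matrix_measurable[of A, OF A] by simp
  qed
  ultimately show ?thesis unfolding zeta_def Lp_norm_def by (auto intro!: esssup_I)
qed

lemma essentially_bounded:
  assumes b: "\<And>E. E \<in> T0 \<Longrightarrow> AE x in lborel. x \<in> inn E \<longrightarrow> \<bar>f i j x - avg (f i j) E\<bar> \<le> b E"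
    and b0: "\<And>E. E \<in> T0 \<Longrightarrow> 0 \<le> b E"
  shows "(\<lambda>x. A x $ i $ j) \<in> Lp_space \<infinity> (lebesgue_on \<Omega>)"
proof -
  define c where "c = (\<Sum>E\<in>T0. \<bar>avg (f i j) E\<bar> + b E)"
  have "AE x in lborel. \<forall>E\<in>T0. x \<in> inn E \<longrightarrow> \<bar>f i j x - avg (f i j) E\<bar> \<le> b E"
    using finite_T0 b by (intro AE_finite_allI) auto
  then have "AE x in lborel. x \<in> \<Omega> \<longrightarrow> \<bar>A x $ i $ j\<bar> \<le> c"
    using AE_in_leaf[OF refinements.initial] f(2)[of i j]
  proof eventually_elim
    case (elim x)
    show ?case
    proof
      assume x: "x \<in> \<Omega>"
      then obtain E where E: "E \<in> T0" "x \<in> inn E" using elim by blast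
      have "\<bar>A x $ i $ j\<bar> \<le> \<bar>avg (f i j) E\<bar> + b E" using elim x E by fastforce
      also have "\<dots> \<le> c" unfolding c_def using finite_T0 E(1) b0 by (intro member_le_sum) auto
      finally show "\<bar>A x $ i $ j\<bar> \<le> c" .
    qed
  qed
  then have "AE x in lebesgue_on \<Omega>. ereal (norm (A x $ i $ j)) \<le> ereal c"
    by (simp add: AE_lebesgue_on[OF domain_lebesgue])
  then have "Lp_norm \<infinity> (lebesgue_on \<Omega>) (\<lambda>x. A x $ i $ j) \<le> ereal c"
    unfolding Lp_norm_def using A[of i j] by (auto intro!: esssup_I)
  then have "Lp_norm \<infinity> (lebesgue_on \<Omega>) (\<lambda>x. A x $ i $ j) < \<infinity>"
    by (rule order_le_less_trans) simp
  then show ?thesis using A by (simp add: Lp_space_def)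
qed

end

lemma seminorm_le_mono: "seminorm_le s p \<Omega> f w \<Longrightarrow> w \<le> w' \<Longrightarrow> seminorm_le s p \<Omega> f w'"
  unfolding seminorm_le_def by (cases "s = 1") (auto, (metis ereal_less_eq(3) order_trans)+)

lemma seminorm_le_exists:
  assumes "f \<in> sobolev_space s p \<Omega>" shows "\<exists>w\<ge>0. seminorm_le s p \<Omega> f w"
proof -
  have "\<exists>w\<ge>0. X \<le> ereal w" if "X < \<infinity>" for X :: ereal
  proof (cases X)
    case (real r) then show ?thesis by (intro exI[of _ "\<bar>r\<bar>"]) simp
  next
    case MInf then show ?thesis by (intro exI[of _ 0]) simp
  qed (use that in simp)
  then show ?thesis
    using assms unfolding sobolev_space_def seminorm_le_def Lp_space_def by (cases "s = 1") (simp, blast, simp)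
qed

text \<open>The number of triangles of one generation with large error is bounded by Chebyshev's inequality for the
  energy.\<close>

theorem greedy_rate:
  assumes s: "0 < s" "s \<le> 1" and p: "p > ereal (2/s)"
  obtains C where "0 \<le> C"
    "\<And>A. A \<in> matrix_space (sobolev_space s p \<Omega>) \<Longrightarrow> A \<in> matrix_space (Lp_space \<infinity> (lebesgue_on \<Omega>))"
    "\<And>A. A \<in> matrix_space (sobolev_space s p \<Omega>) \<Longrightarrow> \<exists>b. zeta \<Omega> T0 A \<le> ereal b"
    "\<And>A. A \<in> matrix_space (sobolev_space s p \<Omega>) \<Longrightarrow> \<exists>w\<ge>0. \<forall>i j. seminorm_le s p \<Omega> (\<lambda>x. A x $ i $ j) w"
    "\<And>A w ord \<delta>. \<lbrakk>A \<in> matrix_space (sobolev_space s p \<Omega>); 0 \<le> w; \<forall>i j. seminorm_le s p \<Omega> (\<lambda>x. A x $ i $ j) w;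
       processing_order ord; 0 < \<delta>\<rbrakk> \<Longrightarrow>
      \<exists>T. greedy T0 \<Lambda> ord \<delta> A T0 = Some T \<and> T \<in> refs \<and> admissible T0 \<Lambda> T \<and> zeta \<Omega> T A \<le> ereal \<delta> \<and>
        real (card T) \<le> real (card T0) + C * (w / \<delta>) powr (2/s)"
proof -
  obtain q K V where q: "2/s < q" and K: "0 \<le> K" and V: "0 \<le> V"
    and ctl: "\<forall>f\<in>sobolev_space s p \<Omega>. \<exists>f0. f0 \<in> borel_measurable borel \<and> integrable lborel f0 \<and>
       (AE x in lborel. x \<in> \<Omega> \<longrightarrow> f x = f0 x) \<and>
       (\<forall>w\<ge>0. seminorm_le s p \<Omega> f w \<longrightarrow> energy_control \<Omega> shape s q K f0 (V * w powr q))"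
    by (rule sobolev_control[OF open_domain bounded_domain s p shape_nonneg])
  have q0: "0 < q" using q s by (smt (verit) divide_pos_pos)
  define \<alpha> where "\<alpha> = s/2 - 1/q"
  have \<alpha>: "0 < \<alpha>" using q q0 s by (simp add: \<alpha>_def field_simps)
  define \<beta> where "\<beta> = \<alpha> * q"
  have \<beta>: "0 < \<beta>" using \<alpha> q0 by (simp add: \<beta>_def)
  have \<beta>1: "1 + \<beta> = s * q / 2" using q0 by (simp add: \<beta>_def \<alpha>_def field_simps)
  define r :: real where "r = 2 powr - \<beta>"
  have r: "0 < r" "r < 1" using \<beta> by (auto simp: r_def powr_less_one)
  define K' where "K' = 2 * K / (1 - 2 powr - \<alpha>)"
  have K': "0 \<le> K'" using K \<alpha> by (simp add: K'_def powr_less_one less_imp_le)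
  define a0 where "a0 = (\<Sum>R\<in>T0. area R)"
  have a0: "0 \<le> a0" unfolding a0_def using forest_area_pos[OF T0_forest] by (intro sum_nonneg) (auto intro: less_imp_le)
  define Q where "Q = 2 * ((4 * K') powr q * a0 powr \<beta> * (4 * V)) / (1 - r)"
  have Q: "0 \<le> Q" using V r by (simp add: Q_def)
  define C where "C = (2 * real (card T0) + 1 / (1 - r)) * Q powr (2 / (s * q))"
  have C: "0 \<le> C" using r by (simp add: C_def)
  have core: "\<exists>f \<nu>. (\<forall>i j. integrable lborel (f i j)) \<and> (\<forall>i j. AE x in lborel. x \<in> \<Omega> \<longrightarrow> A x $ i $ j = f i j x) \<and>
      (\<forall>E\<in>forest. 0 \<le> \<nu> E) \<and> (\<forall>k. sum \<nu> (U k) \<le> 4 * V * w powr q) \<and>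
      (\<forall>E\<in>forest. \<forall>i j. AE x in lborel. x \<in> inn E \<longrightarrow>
         \<bar>f i j x - avg (f i j) E\<bar> \<le> K' * area E powr \<alpha> * \<nu> E powr (1/q))"
    if Asob: "A \<in> matrix_space (sobolev_space s p \<Omega>)" and w: "0 \<le> w" "\<forall>i j. seminorm_le s p \<Omega> (\<lambda>x. A x $ i $ j) w" for A w
  proof -
    have "\<forall>i j. \<exists>f0. integrable lborel f0 \<and> (AE x in lborel. x \<in> \<Omega> \<longrightarrow> A x $ i $ j = f0 x) \<and>
        energy_control \<Omega> shape s q K f0 (V * w powr q)"
    proof (intro allI)
      fix i j
      have "(\<lambda>x. A x $ i $ j) \<in> sobolev_space s p \<Omega>" using Asob by (simp add: matrix_space_def)
      from bspec[OF ctl this] obtain f0 where f0: "integrable lborel f0"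
        "AE x in lborel. x \<in> \<Omega> \<longrightarrow> A x $ i $ j = f0 x"
        "\<forall>w\<ge>0. seminorm_le s p \<Omega> (\<lambda>x. A x $ i $ j) w \<longrightarrow> energy_control \<Omega> shape s q K f0 (V * w powr q)"
        by (elim exE conjE)
      have "energy_control \<Omega> shape s q K f0 (V * w powr q)"
        using f0(3)[rule_format, OF w(1) w(2)[rule_format, of i j]] .
      with f0(1,2) show "\<exists>f0. integrable lborel f0 \<and> (AE x in lborel. x \<in> \<Omega> \<longrightarrow> A x $ i $ j = f0 x) \<and>
        energy_control \<Omega> shape s q K f0 (V * w powr q)" by (intro exI[of _ f0] conjI)
    qed
    then obtain f where f: "\<And>i j. integrable lborel (f i j)" "\<And>i j. AE x in lborel. x \<in> \<Omega> \<longrightarrow> A x $ i $ j = f i j x"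
        "\<And>i j. energy_control \<Omega> shape s q K (f i j) (V * w powr q)"
      by (auto simp: choice_iff)
    have "\<forall>i j. \<exists>\<nu>. controls \<Omega> shape s q K (f i j) (V * w powr q) \<nu>"
      using f(3) unfolding energy_control_def by simp
    then obtain \<mu> where \<mu>: "\<And>i j. controls \<Omega> shape s q K (f i j) (V * w powr q) (\<mu> i j)" by metis
    have \<mu>0: "\<And>i j D. 0 \<le> \<mu> i j D"
      and \<mu>1: "\<And>i j D D'. open D \<Longrightarrow> open D' \<Longrightarrow> D \<subseteq> D' \<Longrightarrow> D' \<subseteq> \<Omega> \<Longrightarrow> \<mu> i j D \<le> \<mu> i j D'"
      and \<mu>2: "\<And>i j \<D>. finite \<D> \<Longrightarrow> disjoint \<D> \<Longrightarrow> (\<forall>D\<in>\<D>. open D \<and> D \<subseteq> \<Omega>) \<Longrightarrow> sum (\<mu> i j) \<D> \<le> V * w powr q"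
      and \<mu>3: "\<And>i j D. open D \<Longrightarrow> convex D \<Longrightarrow> D \<noteq> {} \<Longrightarrow> D \<subseteq> \<Omega> \<Longrightarrow>
        (\<forall>x\<in>D. \<forall>y\<in>D. (dist x y)\<^sup>2 \<le> shape * measure lborel D) \<Longrightarrow>
        osc (f i j) D \<le> ennreal (K * measure lborel D powr (2 + s/2 - 1/q) * \<mu> i j D powr (1/q))"
      using \<mu> unfolding controls_def by blast+
    define \<nu> where "\<nu> E = (\<Sum>i\<in>UNIV. \<Sum>j\<in>UNIV. \<mu> i j (inn E))" for E
    have \<nu>0: "0 \<le> \<nu> E" for E unfolding \<nu>_def by (intro sum_nonneg \<mu>0)
    have \<nu>le: "\<mu> i j (inn E) \<le> \<nu> E" for i j E
    proof -
      have "\<mu> i j (inn E) \<le> (\<Sum>j\<in>UNIV. \<mu> i j (inn E))" by (intro member_le_sum) (auto simp: \<mu>0)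
      also have "\<dots> \<le> \<nu> E" unfolding \<nu>_def by (intro member_le_sum) (auto simp: \<mu>0 intro: sum_nonneg)
      finally show ?thesis .
    qed
    have tot: "sum \<nu> (U k) \<le> 4 * V * w powr q" for k
    proof -
      have "(\<Sum>E\<in>U k. \<mu> i j (inn E)) \<le> V * w powr q" for i j
      proof -
        have "(\<Sum>E\<in>U k. \<mu> i j (inn E)) = sum (\<mu> i j) (inn ` U k)"
          using inn_disjoint_family(2)[of k] by (simp add: sum.reindex)
        also have "\<dots> \<le> V * w powr q"
          using inn_disjoint_family(1)[of k] finite_lev[of k] inn_domain[OF in_forest] by (intro \<mu>2) auto
        finally show ?thesis .
      qed
      then have "(\<Sum>i\<in>UNIV. \<Sum>j\<in>UNIV. \<Sum>E\<in>U k. \<mu> i j (inn E)) \<le> (\<Sum>i\<in>(UNIV::2 set). \<Sum>j\<in>(UNIV::2 set). V * w powr q)"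
        by (intro sum_mono)
      moreover have "sum \<nu> (U k) = (\<Sum>i\<in>UNIV. \<Sum>j\<in>UNIV. \<Sum>E\<in>U k. \<mu> i j (inn E))"
        unfolding \<nu>_def by (subst sum.swap, intro sum.cong refl, subst sum.swap) simp
      ultimately show ?thesis by simp
    qed
    have pw: "AE x in lborel. x \<in> inn E \<longrightarrow> \<bar>f i j x - avg (f i j) E\<bar> \<le> K' * area E powr \<alpha> * \<nu> E powr (1/q)"
      if E: "E \<in> forest" for E i j
    proof -
      have osc: "osc (f i j) (inn E) \<le> ennreal (K * area E powr (2 + \<alpha>) * \<mu> i j (inn E) powr (1/q))" if E: "E \<in> forest" for E
      proof -
        have "\<forall>x\<in>inn E. \<forall>y\<in>inn E. (dist x y)\<^sup>2 \<le> shape * measure lborel (inn E)"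
          using dist_le_shape[OF E] interior_subset[of "region E"] unfolding measure_inn by blast
        from \<mu>3[OF _ _ forest_inn[OF E] inn_domain[OF E] this, of i j] show ?thesis
          using convex_interior[OF convex_region] by (simp add: measure_inn \<alpha>_def add_diff_eq)
      qed
      have "AE x in lborel. x \<in> inn E \<longrightarrow>
         \<bar>f i j x - avg (f i j) E\<bar> \<le> 2 * K / (1 - 2 powr - \<alpha>) * area E powr \<alpha> * \<mu> i j (inn E) powr (1/q)"
        using inn_child_subset inn_domain
        by (intro pointwise_bound[where \<nu> = "\<lambda>E. \<mu> i j (inn E)", OF f(1) K \<alpha> q0 _ _ osc E] \<mu>0 \<mu>1) auto
      then show ?thesis
      proof eventually_elim
        case (elim x)
        have "\<mu> i j (inn E) powr (1/q) \<le> \<nu> E powr (1/q)"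
          using \<nu>le \<mu>0 q0 by (intro powr_mono2) auto
        then have "K' * area E powr \<alpha> * \<mu> i j (inn E) powr (1/q) \<le> K' * area E powr \<alpha> * \<nu> E powr (1/q)"
          using K' by (intro mult_left_mono) auto
        then show ?case using elim by (auto simp: K'_def)
      qed
    qed
    show ?thesis using f \<nu>0 tot pw by (intro exI[of _ f] exI[of _ \<nu>]) blast
  qed
  have Am: "(\<lambda>x. A x $ i $ j) \<in> borel_measurable (lebesgue_on \<Omega>)" if "A \<in> matrix_space (sobolev_space s p \<Omega>)" for A i j
    using that by (simp add: matrix_space_def sobolev_space_def Lp_space_def)
  have wex: "\<exists>w\<ge>0. \<forall>i j. seminorm_le s p \<Omega> (\<lambda>x. A x $ i $ j) w" if "A \<in> matrix_space (sobolev_space s p \<Omega>)" for A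
  proof -
    have "\<forall>i j. \<exists>w\<ge>0. seminorm_le s p \<Omega> (\<lambda>x. A x $ i $ j) w"
      using that seminorm_le_exists by (simp add: matrix_space_def)
    then obtain W where W: "\<And>i j. 0 \<le> W i j" "\<And>i j. seminorm_le s p \<Omega> (\<lambda>x. A x $ i $ j) (W i j)" by metis
    have "W i j \<le> (\<Sum>i\<in>UNIV. \<Sum>j\<in>UNIV. W i j)" for i j
    proof -
      have "W i j \<le> (\<Sum>j\<in>UNIV. W i j)" by (intro member_le_sum) (auto simp: W)
      also have "\<dots> \<le> (\<Sum>i\<in>UNIV. \<Sum>j\<in>UNIV. W i j)" by (intro member_le_sum) (auto simp: W intro: sum_nonneg)
      finally show ?thesis .
    qed
    then have "seminorm_le s p \<Omega> (\<lambda>x. A x $ i $ j) (\<Sum>i\<in>UNIV. \<Sum>j\<in>UNIV. W i j)" for i j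
      by (rule seminorm_le_mono[OF W(2)])
    moreover have "0 \<le> (\<Sum>i\<in>UNIV. \<Sum>j\<in>UNIV. W i j)" by (intro sum_nonneg W)
    ultimately show ?thesis by blast
  qed
  show ?thesis
  proof (rule that[OF C])
    fix A assume Asob: "A \<in> matrix_space (sobolev_space s p \<Omega>)"
    obtain w where w: "0 \<le> w" "\<forall>i j. seminorm_le s p \<Omega> (\<lambda>x. A x $ i $ j) w" using wex[OF Asob] by blast
    obtain f \<nu> where f: "\<And>i j. integrable lborel (f i j)" "\<And>i j. AE x in lborel. x \<in> \<Omega> \<longrightarrow> A x $ i $ j = f i j x"
      and \<nu>: "\<forall>E\<in>forest. 0 \<le> \<nu> E"
      and pw: "\<And>E i j. E \<in> forest \<Longrightarrow> AE x in lborel. x \<in> inn E \<longrightarrow>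
         \<bar>f i j x - avg (f i j) E\<bar> \<le> K' * area E powr \<alpha> * \<nu> E powr (1/q)"
      using core[OF Asob w] by blast
    show "\<exists>w\<ge>0. \<forall>i j. seminorm_le s p \<Omega> (\<lambda>x. A x $ i $ j) w" by (rule wex[OF Asob])
    show "A \<in> matrix_space (Lp_space \<infinity> (lebesgue_on \<Omega>))"
      unfolding matrix_space_def
      using essentially_bounded[OF Am[OF Asob] f pw[OF T0_forest]] K' by simp
    have "local_zeta E A \<le> ereal (\<Sum>E\<in>T0. 4 * (K' * area E powr \<alpha> * \<nu> E powr (1/q)))" if E: "E \<in> T0" for E
    proof -
      have "local_zeta E A \<le> ereal (4 * (K' * area E powr \<alpha> * \<nu> E powr (1/q)))"
        by (rule local_zeta_le[OF Am[OF Asob] f T0_forest[OF E] pw[OF T0_forest[OF E]]])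
      also have "\<dots> \<le> ereal (\<Sum>E\<in>T0. 4 * (K' * area E powr \<alpha> * \<nu> E powr (1/q)))"
        unfolding ereal_less_eq(3) using E finite_T0 K'
        by (intro member_le_sum[of E T0 "\<lambda>E. 4 * (K' * area E powr \<alpha> * \<nu> E powr (1/q))"]) auto
      finally show ?thesis .
    qed
    then show "\<exists>b. zeta \<Omega> T0 A \<le> ereal b"
      using zeta_le[OF Am[OF Asob] f refinements.initial] by blast
  next
    fix A w ord \<delta>
    assume Asob: "A \<in> matrix_space (sobolev_space s p \<Omega>)" and w: "0 \<le> w" "\<forall>i j. seminorm_le s p \<Omega> (\<lambda>x. A x $ i $ j) w"
      and ord: "processing_order ord" and \<delta>: "0 < (\<delta>::real)"
    obtain f \<nu> where f: "\<And>i j. integrable lborel (f i j)" "\<And>i j. AE x in lborel. x \<in> \<Omega> \<longrightarrow> A x $ i $ j = f i j x"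
      and \<nu>: "\<forall>E\<in>forest. 0 \<le> \<nu> E" "\<forall>k. sum \<nu> (U k) \<le> 4 * V * w powr q"
      and pw: "\<And>E i j. E \<in> forest \<Longrightarrow> AE x in lborel. x \<in> inn E \<longrightarrow>
         \<bar>f i j x - avg (f i j) E\<bar> \<le> K' * area E powr \<alpha> * \<nu> E powr (1/q)"
      using core[OF Asob w] by blast
    define R where "R = (4 * K') powr q * a0 powr \<beta> * (4 * V) * (w / \<delta>) powr q"
    have R: "0 \<le> R" using V by (simp add: R_def)
    have cnt: "real (card {E\<in>U k. ereal \<delta> < local_zeta E A}) \<le> R * (2 powr - \<beta>) ^ k" for k
    proof -
      define M where "M = {E\<in>U k. ereal \<delta> < local_zeta E A}"
      have each: "\<delta> powr q \<le> (4 * K') powr q * (a0 powr \<beta> * r ^ k) * \<nu> E" if E: "E \<in> M" for E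
      proof -
        have Ek: "E \<in> U k" and fE: "E \<in> forest" and z: "ereal \<delta> < local_zeta E A" using E in_forest by (auto simp: M_def)
        have a: "0 < area E" using forest_area_pos[OF fE] .
        have n0: "0 \<le> \<nu> E" using \<nu>(1) fE by blast
        have "local_zeta E A \<le> ereal (4 * (K' * area E powr \<alpha> * \<nu> E powr (1/q)))"
          by (rule local_zeta_le[OF Am[OF Asob] f fE pw[OF fE]])
        then have "ereal \<delta> < ereal (4 * (K' * area E powr \<alpha> * \<nu> E powr (1/q)))" using z by (rule less_le_trans[rotated])
        then have "\<delta> \<le> 4 * K' * area E powr \<alpha> * \<nu> E powr (1/q)" by simp
        then have "\<delta> powr q \<le> (4 * K' * area E powr \<alpha> * \<nu> E powr (1/q)) powr q"
          using \<delta> q0 by (intro powr_mono2) auto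
        also have "\<dots> = (4 * K') powr q * area E powr \<beta> * \<nu> E"
          using K' n0 q0 by (simp add: powr_mult powr_powr \<beta>_def)
        also have "area E powr \<beta> \<le> (a0 / 2 ^ k) powr \<beta>"
          using area_le[OF Ek] a \<beta> by (intro powr_mono2) (auto simp: a0_def)
        also have "(a0 / 2 ^ k) powr \<beta> = a0 powr \<beta> * r ^ k"
        proof -
          have "(2 ^ k :: real) powr \<beta> = 2 powr (\<beta> * real k)"
            by (simp add: powr_realpow[symmetric] powr_powr mult.commute)
          moreover have "r ^ k = 2 powr (- (\<beta> * real k))" by (simp add: r_def powr_power mult.commute)
          moreover have "(a0 / 2 ^ k) powr \<beta> = a0 powr \<beta> / (2 ^ k) powr \<beta>"
            by (rule powr_divide)
          ultimately show ?thesis by (simp add: powr_minus divide_inverse)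
        qed
        finally show ?thesis using n0 by (simp add: mult_left_mono mult_right_mono)
      qed
      have fM: "finite M" using finite_lev[of k] by (simp add: M_def)
      have "real (card M) * \<delta> powr q = (\<Sum>E\<in>M. \<delta> powr q)" by simp
      also have "\<dots> \<le> (\<Sum>E\<in>M. (4 * K') powr q * (a0 powr \<beta> * r ^ k) * \<nu> E)" by (rule sum_mono[OF each])
      also have "\<dots> = (4 * K') powr q * (a0 powr \<beta> * r ^ k) * sum \<nu> M" by (simp add: sum_distrib_left)
      also have "\<dots> \<le> (4 * K') powr q * (a0 powr \<beta> * r ^ k) * (4 * V * w powr q)"
      proof (rule mult_left_mono)
        have "sum \<nu> M \<le> sum \<nu> (U k)"
          using \<nu>(1) in_forest by (intro sum_mono2 finite_lev) (auto simp: M_def)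
        then show "sum \<nu> M \<le> 4 * V * w powr q" using \<nu>(2) by (meson order_trans)
      qed (use r in simp)
      finally have "real (card M) \<le> (4 * K') powr q * (a0 powr \<beta> * r ^ k) * (4 * V * w powr q) / \<delta> powr q"
        using \<delta> by (simp add: pos_le_divide_eq)
      also have "\<dots> = R * r ^ k" using w(1) \<delta> by (simp add: R_def powr_divide)
      finally show ?thesis by (simp add: M_def r_def)
    qed
    obtain T where T: "greedy T0 \<Lambda> ord \<delta> A T0 = Some T" "T \<in> refs" "admissible T0 \<Lambda> T" "marked \<delta> A T = {}"
      "real (card T) \<le> real (card T0) + (2 * real (card T0) + 1 / (1 - 2 powr - \<beta>)) *
        (2 * R / (1 - 2 powr - \<beta>)) powr (1 / (1 + \<beta>))"
      using greedy_cardinality[OF ord \<beta> R cnt] by blast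
    have "2 * R / (1 - r) = Q * (w / \<delta>) powr q" by (simp add: R_def Q_def)
    then have "(2 * R / (1 - r)) powr (1 / (1 + \<beta>)) = Q powr (2 / (s * q)) * (w / \<delta>) powr (2/s)"
      using q0 s(1) w(1) \<delta> by (simp add: \<beta>1 powr_mult powr_powr)
    then have "real (card T) \<le> real (card T0) + C * (w / \<delta>) powr (2/s)"
      using T(5) by (simp add: C_def r_def mult.assoc)
    moreover have "zeta \<Omega> T A \<le> ereal \<delta>"
    proof (rule zeta_le[OF Am[OF Asob] f T(2)])
      show "local_zeta E A \<le> ereal \<delta>" if "E \<in> T" for E
        using T(4) that by (force simp: marked_def not_less[symmetric])
    qed
    ultimately show "\<exists>T. greedy T0 \<Lambda> ord \<delta> A T0 = Some T \<and> T \<in> refs \<and> admissible T0 \<Lambda> T \<and> zeta \<Omega> T A \<le> ereal \<delta> \<and>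
        real (card T) \<le> real (card T0) + C * (w / \<delta>) powr (2/s)" using T by blast
  qed
qed

end

lemma Lp_norm_nonneg:
  assumes "emeasure M (space M) \<noteq> 0" shows "0 \<le> Lp_norm p M f"
proof (cases "p = \<infinity>")
  case True
  have "esssup M (\<lambda>x. 0::ereal) \<le> esssup M (\<lambda>x. ereal (norm (f x)))"
    by (rule esssup_mono) auto
  then show ?thesis using True esssup_const[OF assms, of "0::ereal"] by (simp add: Lp_norm_def)
qed (simp add: Lp_norm_def Let_def)

context meshed
begin

lemma domain_measure_pos: "emeasure (lebesgue_on \<Omega>) (space (lebesgue_on \<Omega>)) \<noteq> 0"
proof -
  have "emeasure lborel \<Omega> \<noteq> 0"
    using measure_open_pos[OF open_domain nonempty_domain bounded_domain] by simp
  then show ?thesis using domain_lebesgue open_domain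
    by (simp add: emeasure_restrict_space space_restrict_space)
qed

lemma sobolev_seminorm_nonneg: "0 \<le> sobolev_seminorm s p \<Omega> f"
proof -
  interpret finite_measure "lebesgue_on \<Omega>"
    using open_domain bounded_domain by (intro finite_measure_lebesgue_on bounded_set_imp_lmeasurable) auto
  have "emeasure (lebesgue_on \<Omega> \<Otimes>\<^sub>M lebesgue_on \<Omega>) (space (lebesgue_on \<Omega> \<Otimes>\<^sub>M lebesgue_on \<Omega>)) \<noteq> 0"
    using domain_measure_pos by (simp add: space_pair_measure emeasure_pair_measure_Times)
  then show ?thesis
    unfolding sobolev_seminorm_def slobodeckij_seminorm_def
    by (simp add: Lp_norm_nonneg Lp_norm_nonneg[OF domain_measure_pos])
qed

lemma seminorm_le_of_sobolev:
  assumes "f \<in> sobolev_space s p \<Omega>" "sobolev_seminorm s p \<Omega> f \<le> ereal w"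
  shows "seminorm_le s p \<Omega> f w"
proof (cases "s = 1")
  case True
  then have "\<exists>G. weak_gradient \<Omega> f G" using assms(1) by (auto simp: sobolev_space_def)
  then have "weak_gradient \<Omega> f (SOME G. weak_gradient \<Omega> f G)" by (rule someI_ex)
  then show ?thesis using assms(2) True by (auto simp: seminorm_le_def sobolev_seminorm_def)
qed (use assms in \<open>simp add: seminorm_le_def sobolev_seminorm_def\<close>)

lemma component_le_matrix_seminorm:
  "sobolev_seminorm s p \<Omega> (\<lambda>x. A x $ i $ j) \<le> matrix_sobolev_seminorm s p \<Omega> A"
proof -
  have member: "f k \<le> sum f UNIV" if "\<And>k. 0 \<le> f k" for f :: "2 \<Rightarrow> ereal" and k
    using sum_mono2[of UNIV "{k}" f] that by simp
  have "sobolev_seminorm s p \<Omega> (\<lambda>x. A x $ i $ j) \<le> (\<Sum>j\<in>UNIV. sobolev_seminorm s p \<Omega> (\<lambda>x. A x $ i $ j))"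
    using member[of "\<lambda>j. sobolev_seminorm s p \<Omega> (\<lambda>x. A x $ i $ j)" j] sobolev_seminorm_nonneg by simp
  also have "\<dots> \<le> matrix_sobolev_seminorm s p \<Omega> A"
    unfolding matrix_sobolev_seminorm_def
    by (rule member[of "\<lambda>i. \<Sum>j\<in>UNIV. sobolev_seminorm s p \<Omega> (\<lambda>x. A x $ i $ j)" i])
      (intro sum_nonneg sobolev_seminorm_nonneg)
  finally show ?thesis .
qed

end

lemma meshed_initial:
  assumes "polygonal_domain \<Omega>" "initial_mesh \<Omega> T0"
  shows "meshed T0 \<Omega>"
proof -
  interpret labelled T0 using conf_initial[OF assms(2)] by unfold_locales
  show ?thesis
    using assms by unfold_locales (auto simp: polygonal_domain_def initial_mesh_def)
qed

text \<open>Solves the bound on the cardinality for the tolerance.\<close>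

lemma tolerance_le:
  fixes a C w \<delta> n s :: real
  assumes "0 < a" "0 < C" "0 \<le> w" "0 < \<delta>" "0 < n" "0 < s" "a * n \<le> C * (w / \<delta>) powr (2/s)"
  shows "\<delta> \<le> (C / a) powr (s/2) * w * n powr (- s / 2)"
proof -
  have "n \<le> (C / a) * (w / \<delta>) powr (2/s)" using assms(1,7) by (simp add: field_simps)
  then have "n powr (s/2) \<le> ((C / a) * (w / \<delta>) powr (2/s)) powr (s/2)"
    using assms by (intro powr_mono2) auto
  also have "\<dots> = (C / a) powr (s/2) * ((w / \<delta>) powr (2/s)) powr (s/2)"
    using assms by (simp add: powr_mult del: times_divide_eq_left)
  also have "((w / \<delta>) powr (2/s)) powr (s/2) = w / \<delta>"
    using assms by (simp add: powr_powr)
  finally have "\<delta> * n powr (s/2) \<le> (C / a) powr (s/2) * w" using assms(4) by (simp add: field_simps)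
  then show ?thesis using assms(5) by (simp add: powr_minus field_simps)
qed

theorem corollary9p3:
  fixes \<Omega> :: "(real^2) set" and T0 :: mesh and \<Lambda> :: nat and s c0 :: real and p :: ereal
  assumes "polygonal_domain \<Omega>" and "initial_mesh \<Omega> T0" and "\<Lambda> \<ge> 1"
    and "0 < s" and "s \<le> 1" and "p > ereal (2 / s)" and "c0 > 1"
  shows "\<exists>C. \<forall>A \<in> matrix_space (sobolev_space s p \<Omega>).
    A \<in> approximation_class \<Omega> T0 \<Lambda> (s / 2) \<and>
    (\<forall>ord \<delta>. processing_order ord \<and> \<delta> > 0 \<longrightarrow>
      (\<exists>T. greedy T0 \<Lambda> ord \<delta> A T0 = Some T \<and>
           T \<in> admissible_refinements T0 \<Lambda> (card T) \<and>
           (real (card T) \<ge> c0 * real (card T0) \<longrightarrow>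
             zeta \<Omega> T A \<le>
               ereal (C * measure lebesgue \<Omega> powr (s / 2 - real_of_ereal (1 / p)))
                 * matrix_sobolev_seminorm s p \<Omega> A
                 * ereal (real (card T) powr (- s / 2)))))"
proof -
  interpret meshed T0 \<Omega> by (rule meshed_initial[OF assms(1,2)])
  obtain C where C: "0 \<le> C"
    and Linf: "\<And>A. A \<in> matrix_space (sobolev_space s p \<Omega>) \<Longrightarrow> A \<in> matrix_space (Lp_space \<infinity> (lebesgue_on \<Omega>))"
    and coarse: "\<And>A. A \<in> matrix_space (sobolev_space s p \<Omega>) \<Longrightarrow> \<exists>b. zeta \<Omega> T0 A \<le> ereal b"
    and bounded: "\<And>A. A \<in> matrix_space (sobolev_space s p \<Omega>) \<Longrightarrow> \<exists>w\<ge>0. \<forall>i j. seminorm_le s p \<Omega> (\<lambda>x. A x $ i $ j) w"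
    and rate: "\<And>A w ord \<delta>. \<lbrakk>A \<in> matrix_space (sobolev_space s p \<Omega>); 0 \<le> w; \<forall>i j. seminorm_le s p \<Omega> (\<lambda>x. A x $ i $ j) w;
       processing_order ord; 0 < \<delta>\<rbrakk> \<Longrightarrow>
      \<exists>T. greedy T0 \<Lambda> ord \<delta> A T0 = Some T \<and> T \<in> refs \<and> admissible T0 \<Lambda> T \<and> zeta \<Omega> T A \<le> ereal \<delta> \<and>
        real (card T) \<le> real (card T0) + C * (w / \<delta>) powr (2/s)"
    by (rule greedy_rate[OF assms(4,5,6), where \<Lambda> = \<Lambda>]) blast
  define C1 where "C1 = C + 1"
  have C1: "0 < C1" "C \<le> C1" using C by (auto simp: C1_def)
  have s: "0 < s" by fact
  have n0: "1 \<le> card T0" using T0_nonempty finite_T0 by (simp add: Suc_le_eq card_gt_0_iff)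
  have vol: "0 < measure lebesgue \<Omega>"
    using measure_open_pos(1)[OF open_domain nonempty_domain bounded_domain] open_domain by simp
  define a where "a = 1 - 1 / c0"
  have a: "0 < a" using assms(7) by (simp add: a_def)
  define e where "e = measure lebesgue \<Omega> powr (s / 2 - real_of_ereal (1 / p))"
  have e: "0 < e" using vol by (simp add: e_def)
  define C2 where "C2 = (C1 / a) powr (s/2) / e"
  have C2: "0 < C2" using C1 a e by (simp add: C2_def)
  have approx: "A \<in> approximation_class \<Omega> T0 \<Lambda> (s/2)" if A: "A \<in> matrix_space (sobolev_space s p \<Omega>)" for A
  proof -
    obtain b where b: "zeta \<Omega> T0 A \<le> ereal b" using coarse[OF A] by blast
    obtain w' where "0 \<le> w'" "\<forall>i j. seminorm_le s p \<Omega> (\<lambda>x. A x $ i $ j) w'" using bounded[OF A] by blast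
    then have w: "0 < w' + 1" "\<forall>i j. seminorm_le s p \<Omega> (\<lambda>x. A x $ i $ j) (w' + 1)"
      using seminorm_le_mono[of s p _ w' "w' + 1"] by simp_all
    define w where "w = w' + 1"
    define ord :: "mesh \<Rightarrow> tri set \<Rightarrow> tri list" where "ord = (\<lambda>T M. SOME xs. set xs = M)"
    have ord: "processing_order ord"
      unfolding processing_order_def ord_def using someI_ex[OF finite_list] by blast
    define b0 where "b0 = max b 0 * (2 * real (card T0)) powr (s/2)"
    define b1 where "b1 = w * (2 * C1) powr (s/2)"
    have "(INF T \<in> admissible_refinements T0 \<Lambda> N. zeta \<Omega> T A) \<le> ereal (max b0 b1 * real N powr (- (s/2)))"
      if N: "card T0 \<le> N" for N
    proof -
      have Npos: "0 < real N" using N n0 by simp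
      show ?thesis
      proof (cases "real N < 2 * real (card T0)")
        case True
        have T0: "T0 \<in> admissible_refinements T0 \<Lambda> N"
          using N admissible_T0 refinements.initial by (simp add: admissible_refinements_def)
        have "b \<le> max b 0 * 1" by simp
        also have "1 \<le> (2 * real (card T0)) powr (s/2) * real N powr (- (s/2))"
        proof -
          have "real N powr (s/2) \<le> (2 * real (card T0)) powr (s/2)" using True s by (intro powr_mono2) auto
          then show ?thesis using Npos by (simp add: powr_minus field_simps)
        qed
        then have "max b 0 * 1 \<le> max b 0 * ((2 * real (card T0)) powr (s/2) * real N powr (- (s/2)))"
          by (rule mult_left_mono) simp
        also have "\<dots> = b0 * real N powr (- (s/2))" by (simp add: b0_def)
        also have "\<dots> \<le> max b0 b1 * real N powr (- (s/2))" by (intro mult_right_mono) auto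
        finally have "zeta \<Omega> T0 A \<le> ereal (max b0 b1 * real N powr (- (s/2)))"
          using b by (meson ereal_less_eq(3) order_trans)
        then show ?thesis by (rule INF_lower2[OF T0])
      next
        case False
        \<comment> \<open>With this tolerance GREEDY adds at most \<open>N/2\<close> elements to at most \<open>N/2\<close> initial ones.\<close>
        define \<delta> where "\<delta> = w * (2 * C1 / real N) powr (s/2)"
        have \<delta>: "0 < \<delta>" using w Npos C1 by (simp add: \<delta>_def w_def)
        obtain T where T: "T \<in> refs" "admissible T0 \<Lambda> T" "zeta \<Omega> T A \<le> ereal \<delta>"
          "real (card T) \<le> real (card T0) + C * (w / \<delta>) powr (2/s)"
          using rate[OF A _ w(2) ord \<delta>] w(1) by (auto simp: w_def)
        have "w / \<delta> = (2 * C1 / real N) powr (- (s/2))"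
        proof -
          have "w / (w * X) = inverse X" for X using w(1) by (simp add: w_def divide_inverse)
          then show ?thesis by (simp add: \<delta>_def powr_minus)
        qed
        then have "(w / \<delta>) powr (2/s) = (2 * C1 / real N) powr (- (s/2) * (2/s))" by (simp only: powr_powr)
        also have "- (s/2) * (2/s) = - 1" using s by simp
        also have "(2 * C1 / real N) powr - 1 = real N / (2 * C1)" using Npos C1 by (simp add: powr_minus)
        finally have "(w / \<delta>) powr (2/s) = real N / (2 * C1)" .
        moreover have "C * (w / \<delta>) powr (2/s) \<le> C1 * (w / \<delta>) powr (2/s)"
          using C1 by (intro mult_right_mono) auto
        ultimately have "C * (w / \<delta>) powr (2/s) \<le> real N / 2" using C1 by simp
        then have "real (card T) \<le> real N" using T(4) False by linarith
        then have TN: "T \<in> admissible_refinements T0 \<Lambda> N" using T by (simp add: admissible_refinements_def)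
        have "\<delta> = b1 * real N powr (- (s/2))"
          using Npos C1 by (simp add: \<delta>_def b1_def powr_divide powr_minus field_simps)
        also have "\<dots> \<le> max b0 b1 * real N powr (- (s/2))" by (intro mult_right_mono) auto
        finally have "zeta \<Omega> T A \<le> ereal (max b0 b1 * real N powr (- (s/2)))"
          using T(3) by (meson ereal_less_eq(3) order_trans)
        then show ?thesis by (rule INF_lower2[OF TN])
      qed
    qed
    then show ?thesis unfolding approximation_class_def using Linf[OF A] by blast
  qed
  have main: "\<exists>T. greedy T0 \<Lambda> ord \<delta> A T0 = Some T \<and> T \<in> admissible_refinements T0 \<Lambda> (card T) \<and>
      (real (card T) \<ge> c0 * real (card T0) \<longrightarrow>
        zeta \<Omega> T A \<le> ereal (C2 * e) * matrix_sobolev_seminorm s p \<Omega> A * ereal (real (card T) powr (- s / 2)))"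
    if A: "A \<in> matrix_space (sobolev_space s p \<Omega>)" and ord: "processing_order ord" and \<delta>: "0 < \<delta>" for A ord \<delta>
  proof -
    obtain w' where "0 \<le> w'" "\<forall>i j. seminorm_le s p \<Omega> (\<lambda>x. A x $ i $ j) w'" using bounded[OF A] by blast
    then obtain T where T: "greedy T0 \<Lambda> ord \<delta> A T0 = Some T" "T \<in> refs" "admissible T0 \<Lambda> T" "zeta \<Omega> T A \<le> ereal \<delta>"
      using rate[OF A _ _ ord \<delta>] by blast
    have "zeta \<Omega> T A \<le> ereal (C2 * e) * matrix_sobolev_seminorm s p \<Omega> A * ereal (real (card T) powr (- s / 2))"
      if large: "real (card T) \<ge> c0 * real (card T0)"
    proof -
      define W where "W = matrix_sobolev_seminorm s p \<Omega> A"
      have "0 < c0 * real (card T0)" using assms(7) n0 by simp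
      then have n: "0 < real (card T)" using large by linarith
      have W0: "0 \<le> W"
        using component_le_matrix_seminorm[of s p A 1 1] sobolev_seminorm_nonneg order_trans unfolding W_def by blast
      show ?thesis
      proof (cases W)
        case PInf
        \<comment> \<open>The weak gradient chosen in the seminorm may have infinite norm a priori.\<close>
        have "ereal (C2 * e) * W * ereal (real (card T) powr (- s / 2)) = \<infinity>"
          using PInf C2 e n by simp
        then show ?thesis unfolding W_def by (simp only: ereal_less_eq(1))
      next
        case (real w)
        then have w: "0 \<le> w" using W0 by simp
        have "\<forall>i j. seminorm_le s p \<Omega> (\<lambda>x. A x $ i $ j) w"
        proof (intro allI seminorm_le_of_sobolev)
          fix i j
          show "(\<lambda>x. A x $ i $ j) \<in> sobolev_space s p \<Omega>" using A by (simp add: matrix_space_def)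
          show "sobolev_seminorm s p \<Omega> (\<lambda>x. A x $ i $ j) \<le> ereal w"
            using component_le_matrix_seminorm[of s p A i j] real by (simp add: W_def)
        qed
        then obtain T' where T': "greedy T0 \<Lambda> ord \<delta> A T0 = Some T'"
            "real (card T') \<le> real (card T0) + C * (w / \<delta>) powr (2/s)"
          using rate[OF A w _ ord \<delta>] by blast
        then have "real (card T) \<le> real (card T0) + C * (w / \<delta>) powr (2/s)" using T(1) by simp
        moreover have "C * (w / \<delta>) powr (2/s) \<le> C1 * (w / \<delta>) powr (2/s)" using C1 by (intro mult_right_mono) auto
        moreover have "real (card T0) \<le> real (card T) / c0" using large assms(7) by (simp add: field_simps)
        ultimately have "a * real (card T) \<le> C1 * (w / \<delta>) powr (2/s)" by (simp add: a_def left_diff_distrib)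
        then have "\<delta> \<le> (C1 / a) powr (s/2) * w * real (card T) powr (- s / 2)"
          using tolerance_le[OF a C1(1) w \<delta> n s] by blast
        also have "\<dots> = C2 * e * w * real (card T) powr (- s / 2)" using e by (simp add: C2_def)
        finally have "zeta \<Omega> T A \<le> ereal (C2 * e * w * real (card T) powr (- s / 2))"
          using T(4) by (meson ereal_less_eq(3) order_trans)
        then show ?thesis using real by (simp add: W_def)
      qed (use W0 in simp)
    qed
    then show ?thesis using T by (auto simp: admissible_refinements_def)
  qed
  show ?thesis
    using approx main unfolding e_def by (intro exI[of _ C2]) blast
qed

end
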